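(* Let $A$ be a closed symmetric operator in a Hilbert space $H$ (not necessarily densely defined), and let $\lambda_0\in\mathbb{R}_e$ be an arbitrary point. An arbitrary generalized resolvent $\mathbf{R}_{s;\lambda}$ of $A$ has the form $$\mathbf{R}_{s;\lambda}=\begin{cases}\left(A_{F(\lambda),\lambda_0}-\lambda E_H\right)^{-1}, & \lambda\in\Pi_{\lambda_0},\\ \left(A_{F^*(\overline\lambda),\overline{\lambda_0}}-\lambda E_H\right)^{-1}, & \overline\lambda\in\Pi_{\lambda_0},\end{cases}\qquad( * )$$ where $F(\lambda)$ is a function from $\mathcal{S}_{a;\lambda_0}(\Pi_{\lambda_0};\mathcal{N}_{\lambda_0}(A),\mathcal{N}_{\overline{\lambda_0}}(A))$. Conversely, an arbitrary function $F(\lambda)\in\mathcal{S}_{a;\lambda_0}(\Pi_{\lambda_0};\mathcal{N}_{\lambda_0}(A),\mathcal{N}_{\overline{\lambda_0}}(A))$ defines by relation $( * )$ a generalized resolvent $\mathbf{R}_{s;\lambda}$ of $A$. Moreover, to different functions from $\mathcal{S}_{a;\lambda_0}(\Pi_{\lambda_0};\mathcal{N}_{\lambda_0}(A),\mathcal{N}_{\overline{\lambda_0}}(A))$ there correspond different generalized resolvents of $A$.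
   Context: Hilbert spaces are complex and separable; operators are linear. "Symmetric" means $(Af,g)=(f,Ag)$ for $f,g\in D(A)$; $D(A)$ need not be dense. $\mathbb{R}_e=\mathbb{C}\setminus\mathbb{R}$; $\Pi_{\lambda_0}$ is the open half-plane ($\mathbb{C}_+$ or $\mathbb{C}_-$) containing $\lambda_0$; $\Pi_{\lambda_0}^\varepsilon=\{\lambda\in\Pi_{\lambda_0}:\varepsilon<|\arg\lambda|<\pi-\varepsilon\}$, $0<\varepsilon<\pi/2$. $E_H$ is the identity; $P^{\widetilde H}_H$ is the orthogonal projection of $\widetilde H$ onto $H$. $\mathcal{M}_z(A)=(A-zE_H)D(A)$, $\mathcal{N}_z(A)=H\ominus\mathcal{M}_z(A)$. Generalized resolvent of $A$: a function $\mathbf{R}_{s;\lambda}=P^{\widetilde H}_H(\widetilde A-\lambda E_{\widetilde H})^{-1}|_H$, $\lambda\in\mathbb{R}_e$, where $\widetilde A\supseteq A$ is a self-adjoint operator in some Hilbert space $\widetilde H\supseteq H$ (such extensions always exist). Forbidden operator: for $z\in\mathbb{R}_e$, $X_z=X_z(A)$ has domain $\mathcal{N}_z(A)\cap(\mathcal{N}_{\overline z}(A)\dotplus D(A))$ and $X_z\psi=\varphi$, where $\varphi$ is the unique element of $\mathcal{N}_{\overline z}(A)$ with $\psi-\varphi\in D(A)$. Admissible operators: an operator $T$ with $D(T)\subseteq\mathcal{N}_z(A)$, $R(T)\subseteq\mathcal{N}_{\overline z}(A)$ is $z$-admissible with respect to $A$ if $\psi\in D(T)$, $T\psi-\psi\in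 D(A)$ imply $\psi=0$ (equivalently, $T\psi=X_z\psi$ with $\psi\in D(T)\cap D(X_z)$ only for $\psi=0$). For a non-expanding $z$-admissible $T$, with the Cayley transformation $U_z(A)=(A-\overline zE_H)(A-zE_H)^{-1}$, the operator $U_z(A)\oplus T$ has no non-zero fixed elements, and the quasi-self-adjoint extension of $A$ defined by $T$ is $$A_{T,z}=zE_H+(z-\overline z)(U_z(A)\oplus T-E_H)^{-1}.$$ $\mathcal{S}(D;N,N')$ is the class of all operator-valued functions analytic in the domain $D$ whose values are linear non-expanding operators (norm $\le1$) mapping the whole Hilbert space $N$ into the Hilbert space $N'$. Admissible functions: a function $F(\lambda)\in\mathcal{S}(\Pi_{\lambda_0};\mathcal{N}_{\lambda_0}(A),\mathcal{N}_{\overline{\lambda_0}}(A))$ is $\lambda_0$-admissible with respect to $A$ if, for $\psi\in D(X_{\lambda_0}(A))$, the validity for some $\varepsilon\in(0,\pi/2)$ of $$\lim_{\lambda\in\Pi_{\lambda_0}^\varepsilon,\ \lambda\to\infty}F(\lambda)\psi=X_{\lambda_0}(A)\psi\quad\text{and}\quad \varliminf_{\lambda\in\Pi_{\lambda_0}^\varepsilon,\ \lambda\to\infty}\left[|\lambda|\left(\|\psi\|_H-\|F(\lambda)\psi\|_H\right)\right]<+\infty$$ implies $\psi=0$. $\mathcal{S}_{a;\lambda_0}(\Pi_{\lambda_0};\mathcal{N}_{\lambda_0}(A),\mathcal{N}_{\overline{\lambda_0}}(A))$ is the set of all such functions. For such $F$, each value $F(\lambda)$ is a $\lambda_0$-admissible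 operator and its adjoint $F^*(\lambda)=(F(\lambda))^*:\mathcal{N}_{\overline{\lambda_0}}(A)\to\mathcal{N}_{\lambda_0}(A)$ is $\overline{\lambda_0}$-admissible, so the extensions in $( * )$ are defined. *)

theory Defs
  imports "HOL-Analysis.Analysis"
begin

section \<open>Separable complex Hilbert spaces\<close>

(* Separability is second countability and completeness is complete_space; both come from
   polish_space. The inherited real inner product, hence the norm and the topology, is tied to
   cinner by its real part. cinner is linear in its first argument. *)
class complex_hilbert = real_inner + polish_space +
  fixes scaleC :: "complex \<Rightarrow> 'a \<Rightarrow> 'a" (infixr "*\<^sub>C" 75)
    and cinner :: "'a \<Rightarrow> 'a \<Rightarrow> complex"
  assumes scaleC_add_right: "c *\<^sub>C (x + y) = c *\<^sub>C x + c *\<^sub>C y"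
    and scaleC_add_left: "(c + d) *\<^sub>C x = c *\<^sub>C x + d *\<^sub>C x"
    and scaleC_scaleC: "c *\<^sub>C d *\<^sub>C x = (c * d) *\<^sub>C x"
    and scaleR_eq_scaleC: "r *\<^sub>R x = complex_of_real r *\<^sub>C x"
    and cinner_commute: "cinner x y = cnj (cinner y x)"
    and cinner_add_left: "cinner (x + y) z = cinner x z + cinner y z"
    and cinner_scaleC_left: "cinner (c *\<^sub>C x) y = c * cinner x y"
    and inner_eq_Re_cinner: "inner x y = Re (cinner x y)"

section \<open>Operators as graphs\<close>

(* An operator is its graph, so that the domain of definition is Domain, the range is Range,
   extension of operators is inclusion, the inverse is converse, the product S T is T O S, and a
   closed operator is one whose graph is closed in the product topology. *)
type_synonym ('a, 'b) op_graph = "('a \<times> 'b) set"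

definition linear_operator :: "('a::complex_hilbert, 'b::complex_hilbert) op_graph \<Rightarrow> bool" where
  "linear_operator G \<longleftrightarrow> single_valued G \<and> (0, 0) \<in> G \<and>
     (\<forall>x x' y y'. (x, x') \<in> G \<longrightarrow> (y, y') \<in> G \<longrightarrow> (x + y, x' + y') \<in> G) \<and>
     (\<forall>c x x'. (x, x') \<in> G \<longrightarrow> (c *\<^sub>C x, c *\<^sub>C x') \<in> G)"

definition symmetric_operator :: "('a::complex_hilbert, 'a) op_graph \<Rightarrow> bool" where
  "symmetric_operator A \<longleftrightarrow> linear_operator A \<and>
     (\<forall>f f' g g'. (f, f') \<in> A \<longrightarrow> (g, g') \<in> A \<longrightarrow> cinner f' g = cinner f g')"

definition adjoint_graph :: "('a::complex_hilbert, 'a) op_graph \<Rightarrow> ('a, 'a) op_graph" where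
  "adjoint_graph A = {(g, h). \<forall>f f'. (f, f') \<in> A \<longrightarrow> cinner f' g = cinner f h}"

definition selfadjoint_operator :: "('a::complex_hilbert, 'a) op_graph \<Rightarrow> bool" where
  "selfadjoint_operator A \<longleftrightarrow>
     linear_operator A \<and> closure (Domain A) = UNIV \<and> adjoint_graph A = A"

(* G + c E *)
definition add_scalar :: "('a::complex_hilbert, 'a) op_graph \<Rightarrow> complex \<Rightarrow> ('a, 'a) op_graph" where
  "add_scalar G c = {(x, y + c *\<^sub>C x) | x y. (x, y) \<in> G}"

(* c G *)
definition mult_scalar :: "complex \<Rightarrow> ('a::complex_hilbert, 'a) op_graph \<Rightarrow> ('a, 'a) op_graph" where
  "mult_scalar c G = {(x, c *\<^sub>C y) | x y. (x, y) \<in> G}"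

(* (G - z E)^(-1) *)
definition resolvent :: "('a::complex_hilbert, 'a) op_graph \<Rightarrow> complex \<Rightarrow> ('a, 'a) op_graph" where
  "resolvent G z = (add_scalar G (- z))\<inverse>"

definition op_sum ::
  "('a::complex_hilbert, 'a) op_graph \<Rightarrow> ('a, 'a) op_graph \<Rightarrow> ('a, 'a) op_graph" where
  "op_sum U T = {(x + y, x' + y') | x x' y y'. (x, x') \<in> U \<and> (y, y') \<in> T}"

section \<open>Generalized resolvents\<close>

definition isometric_embedding :: "('a::complex_hilbert \<Rightarrow> 'b::complex_hilbert) \<Rightarrow> bool" where
  "isometric_embedding V \<longleftrightarrow>
     (\<forall>x y. V (x + y) = V x + V y) \<and> (\<forall>c x. V (c *\<^sub>C x) = c *\<^sub>C V x) \<and>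
     (\<forall>x y. cinner (V x) (V y) = cinner x y)"

(* With H identified with the closed subspace range V, this is P S|H: the second component p of
   a pair is determined by V p being the orthogonal projection onto range V of S (V h). *)
definition compression ::
  "('a::complex_hilbert \<Rightarrow> 'b::complex_hilbert) \<Rightarrow> ('b, 'b) op_graph \<Rightarrow> ('a, 'a) op_graph" where
  "compression V S = {(h, p). \<exists>k. (V h, k) \<in> S \<and> (\<forall>g. cinner (k - V p) (V g) = 0)}"

(* R is a generalized resolvent of A obtained from a self-adjoint extension At of A in a Hilbert
   space 'k that contains H = 'h through the isometry V. Only the values of R at non-real points
   matter. HOL cannot quantify over types, so the larger space is a type parameter here. *)
definition generalized_resolvent ::
  "'k::complex_hilbert itself \<Rightarrow> ('h::complex_hilbert, 'h) op_graph \<Rightarrow>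
     (complex \<Rightarrow> ('h, 'h) op_graph) \<Rightarrow> bool" where
  "generalized_resolvent _ A R \<longleftrightarrow>
     (\<exists>(V :: 'h \<Rightarrow> 'k) At. isometric_embedding V \<and> selfadjoint_operator At \<and>
        (\<forall>(f, f') \<in> A. (V f, V f') \<in> At) \<and>
        (\<forall>z. z \<notin> \<real> \<longrightarrow> R z = compression V (resolvent At z)))"

section \<open>Defect subspaces, the forbidden operator, quasi-self-adjoint extensions\<close>

definition range_at :: "('a::complex_hilbert, 'a) op_graph \<Rightarrow> complex \<Rightarrow> 'a set" where
  "range_at A z = Range (add_scalar A (- z))"

definition defect_space :: "('a::complex_hilbert, 'a) op_graph \<Rightarrow> complex \<Rightarrow> 'a set" where
  "defect_space A z = {h. \<forall>g \<in> range_at A z. cinner h g = 0}"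

(* The value at psi is unique for symmetric A, see single_valued_forbidden_operator. *)
definition forbidden_operator ::
  "('a::complex_hilbert, 'a) op_graph \<Rightarrow> complex \<Rightarrow> ('a, 'a) op_graph" where
  "forbidden_operator A z =
     {(\<psi>, \<phi>). \<psi> \<in> defect_space A z \<and> \<phi> \<in> defect_space A (cnj z) \<and> \<psi> - \<phi> \<in> Domain A}"

definition cayley :: "('a::complex_hilbert, 'a) op_graph \<Rightarrow> complex \<Rightarrow> ('a, 'a) op_graph" where
  "cayley A z = resolvent A z O add_scalar A (- cnj z)"

(* z E + (z - cnj z) (U_z(A) + T - E)^(-1), with U_z(A) + T the orthogonal sum *)
definition quasi_selfadjoint_ext ::
  "('a::complex_hilbert, 'a) op_graph \<Rightarrow> ('a, 'a) op_graph \<Rightarrow> complex \<Rightarrow> ('a, 'a) op_graph" where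
  "quasi_selfadjoint_ext A T z =
     add_scalar (mult_scalar (z - cnj z) (resolvent (op_sum (cayley A z) T) 1)) z"

section \<open>Contractive analytic functions and admissibility\<close>

definition half_plane :: "complex \<Rightarrow> complex set" where
  "half_plane z0 = {z. 0 < Im z * Im z0}"

definition sector :: "complex \<Rightarrow> real \<Rightarrow> complex set" where
  "sector z0 \<epsilon> = {z \<in> half_plane z0. \<epsilon> < \<bar>Arg z\<bar> \<and> \<bar>Arg z\<bar> < pi - \<epsilon>}"

definition contraction_between ::
  "'a::complex_hilbert set \<Rightarrow> 'a set \<Rightarrow> ('a \<Rightarrow> 'a) \<Rightarrow> bool" where
  "contraction_between N N' T \<longleftrightarrow>
     (\<forall>x \<in> N. T x \<in> N' \<and> norm (T x) \<le> norm x) \<and>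
     (\<forall>x \<in> N. \<forall>y \<in> N. T (x + y) = T x + T y) \<and>
     (\<forall>c. \<forall>x \<in> N. T (c *\<^sub>C x) = c *\<^sub>C T x)"

(* Uniform convergence on the unit ball of N is convergence in operator norm, so the second
   conjunct is complex differentiability in the operator norm at every point of the open set D.
   (The limit L is then automatically linear and bounded from N to N'.) The values of F outside D
   and off N are irrelevant. *)
definition schur_class ::
  "complex set \<Rightarrow> 'a::complex_hilbert set \<Rightarrow> 'a set \<Rightarrow> (complex \<Rightarrow> 'a \<Rightarrow> 'a) set" where
  "schur_class D N N' = {F.
     (\<forall>z \<in> D. contraction_between N N' (F z)) \<and>
     (\<forall>z \<in> D. \<exists>L. uniform_limit {\<psi> \<in> N. norm \<psi> \<le> 1}
        (\<lambda>\<mu> \<psi>. inverse (\<mu> - z) *\<^sub>C (F \<mu> \<psi> - F z \<psi>)) L (at z))}"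

definition admissible_functions ::
  "('a::complex_hilbert, 'a) op_graph \<Rightarrow> complex \<Rightarrow> (complex \<Rightarrow> 'a \<Rightarrow> 'a) set" where
  "admissible_functions A z0 =
     {F \<in> schur_class (half_plane z0) (defect_space A z0) (defect_space A (cnj z0)).
        \<forall>(\<psi>, \<phi>) \<in> forbidden_operator A z0.
          (\<exists>\<epsilon>. 0 < \<epsilon> \<and> \<epsilon> < pi / 2 \<and>
             ((\<lambda>z. F z \<psi>) \<longlongrightarrow> \<phi>) (inf at_infinity (principal (sector z0 \<epsilon>))) \<and>
             Liminf (inf at_infinity (principal (sector z0 \<epsilon>)))
               (\<lambda>z. ereal (cmod z * (norm \<psi> - norm (F z \<psi>)))) < \<infinity>)
          \<longrightarrow> \<psi> = 0}"

definition graph_on :: "'a set \<Rightarrow> ('a \<Rightarrow> 'a) \<Rightarrow> ('a, 'a) op_graph" where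
  "graph_on N T = {(x, T x) | x. x \<in> N}"

(* the adjoint N' \<rightarrow> N of an operator T : N \<rightarrow> N' *)
definition adjoint_between ::
  "'a::complex_hilbert set \<Rightarrow> 'a set \<Rightarrow> ('a \<Rightarrow> 'a) \<Rightarrow> ('a, 'a) op_graph" where
  "adjoint_between N N' T =
     {(y, x). y \<in> N' \<and> x \<in> N \<and> (\<forall>u \<in> N. cinner (T u) y = cinner u x)}"

definition shtraus_resolvent ::
  "('a::complex_hilbert, 'a) op_graph \<Rightarrow> complex \<Rightarrow> (complex \<Rightarrow> 'a \<Rightarrow> 'a) \<Rightarrow>
     complex \<Rightarrow> ('a, 'a) op_graph" where
  "shtraus_resolvent A z0 F z =
     (if z \<in> half_plane z0
      then resolvent
             (quasi_selfadjoint_ext A (graph_on (defect_space A z0) (F z)) z0) z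
      else resolvent
             (quasi_selfadjoint_ext A
               (adjoint_between (defect_space A z0) (defect_space A (cnj z0)) (F (cnj z)))
               (cnj z0)) z)"

lemma single_valued_forbidden_operator:
  assumes A: "symmetric_operator A" and z: "z \<notin> \<real>"
  shows "single_valued (forbidden_operator A z)"
proof (rule single_valuedI)
  fix \<psi> \<phi> \<phi>'
  assume "(\<psi>, \<phi>) \<in> forbidden_operator A z" "(\<psi>, \<phi>') \<in> forbidden_operator A z"
  then have d: "\<phi> \<in> defect_space A (cnj z)" "\<phi>' \<in> defect_space A (cnj z)"
    and dom: "\<psi> - \<phi> \<in> Domain A" "\<psi> - \<phi>' \<in> Domain A"
    by (auto simp: forbidden_operator_def)
  have A_add: "\<And>x x' y y'. (x, x') \<in> A \<Longrightarrow> (y, y') \<in> A \<Longrightarrow> (x + y, x' + y') \<in> A"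
    and A_scale: "\<And>c x x'. (x, x') \<in> A \<Longrightarrow> (c *\<^sub>C x, c *\<^sub>C x') \<in> A"
    and A_sym: "\<And>f f' g g'. (f, f') \<in> A \<Longrightarrow> (g, g') \<in> A \<Longrightarrow> cinner f' g = cinner f g'"
    using A unfolding symmetric_operator_def linear_operator_def by blast+
  have minus: "(-1) *\<^sub>C x = - x" for x :: 'a
    using scaleR_eq_scaleC[of "-1" x] by simp
  obtain a b where ab: "(\<psi> - \<phi>, a) \<in> A" "(\<psi> - \<phi>', b) \<in> A"
    using dom by auto
  define x where "x = \<phi>' - \<phi>"
  define x' where "x' = a - b"
  have xA: "(x, x') \<in> A"
    using A_add[OF ab(1) A_scale[OF ab(2), of "-1"]] by (simp add: minus x_def x'_def)
  define g where "g = x' + (- cnj z) *\<^sub>C x"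
  have g: "g \<in> range_at A (cnj z)"
    using xA unfolding range_at_def add_scalar_def g_def by auto
  have neg: "cinner (- u) v = - cinner u v" for u v :: 'a
    using cinner_scaleC_left[of "-1" u v] by (simp add: minus)
  have sub: "cinner (u - w) v = cinner u v - cinner w v" for u w v :: 'a
    using cinner_add_left[of u "- w" v] by (simp add: neg)
  have "cinner x g = 0"
    using d g by (simp add: x_def sub defect_space_def)
  then have "cinner g x = 0"
    by (subst cinner_commute) simp
  then have e: "cinner x' x = cnj z * cinner x x"
    by (simp add: g_def cinner_add_left cinner_scaleC_left)
  have "Im (cinner x' x) = 0"
    using arg_cong[OF A_sym[OF xA xA], of Im] arg_cong[OF cinner_commute[of x' x], of Im]
    by (simp only: cnj.sel)
  moreover have "Im (cinner x x) = 0"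
    using arg_cong[OF cinner_commute[of x x], of Im] by (simp only: cnj.sel)
  moreover have "Im z \<noteq> 0"
    using z by (simp add: complex_is_Real_iff)
  ultimately have "Re (cinner x x) = 0"
    using arg_cong[OF e, of Im] by simp
  then show "\<phi> = \<phi>'"
    using inner_eq_zero_iff[of x] by (simp add: inner_eq_Re_cinner x_def)
qed

section \<open>The Hilbert space of square-summable complex sequences\<close>

(* The larger space of a constructed generalized resolvent can always be taken to be ell2: a
   separable space embeds isometrically onto a closed subspace K of ell2, and a self-adjoint
   operator in K, extended by 0 on the complement of K, gives the same compressed resolvent. *)

typedef ell2 = "{f :: nat \<Rightarrow> complex. summable (\<lambda>n. (cmod (f n))\<^sup>2)}"
  morphisms coord Abs_ell2
  by (rule exI[of _ "\<lambda>_. 0"]) simp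

setup_lifting type_definition_ell2

lemma summable_coord: "summable (\<lambda>n. (cmod (coord x n))\<^sup>2)"
  using coord by auto

lemma ell2_eqI: "(\<And>n. coord x n = coord y n) \<Longrightarrow> x = y"
  by (meson coord_inject ext)

lemma summable_sq_add:
  fixes f g :: "nat \<Rightarrow> complex"
  assumes f: "summable (\<lambda>n. (cmod (f n))\<^sup>2)" and g: "summable (\<lambda>n. (cmod (g n))\<^sup>2)"
  shows "summable (\<lambda>n. (cmod (f n + g n))\<^sup>2)"
proof (rule summable_comparison_test'[of "\<lambda>n. 2 * (cmod (f n))\<^sup>2 + 2 * (cmod (g n))\<^sup>2" 0])
  show "summable (\<lambda>n. 2 * (cmod (f n))\<^sup>2 + 2 * (cmod (g n))\<^sup>2)"
    by (intro summable_add summable_mult f g)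
  fix n
  have "(cmod (f n + g n))\<^sup>2 \<le> (cmod (f n) + cmod (g n))\<^sup>2"
    by (intro power_mono norm_triangle_ineq) auto
  also have "\<dots> \<le> 2 * (cmod (f n))\<^sup>2 + 2 * (cmod (g n))\<^sup>2"
    using sum_squares_bound[of "cmod (f n)" "cmod (g n)"] by (simp add: power2_sum)
  finally show "norm ((cmod (f n + g n))\<^sup>2) \<le> 2 * (cmod (f n))\<^sup>2 + 2 * (cmod (g n))\<^sup>2"
    by simp
qed

lemma summable_sq_mult:
  fixes f :: "nat \<Rightarrow> complex"
  assumes "summable (\<lambda>n. (cmod (f n))\<^sup>2)"
  shows "summable (\<lambda>n. (cmod (c * f n))\<^sup>2)"
  using summable_mult[OF assms, of "(cmod c)\<^sup>2"] by (simp add: norm_mult power_mult_distrib)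

lemma summable_coord_cnj: "summable (\<lambda>n. coord x n * cnj (coord y n))"
proof (rule summable_comparison_test'[of "\<lambda>n. (cmod (coord x n))\<^sup>2 + (cmod (coord y n))\<^sup>2" 0])
  show "summable (\<lambda>n. (cmod (coord x n))\<^sup>2 + (cmod (coord y n))\<^sup>2)"
    by (intro summable_add summable_coord)
  fix n
  have "0 \<le> cmod (coord x n) * cmod (coord y n)" by simp
  then show "norm (coord x n * cnj (coord y n)) \<le> (cmod (coord x n))\<^sup>2 + (cmod (coord y n))\<^sup>2"
    using sum_squares_bound[of "cmod (coord x n)" "cmod (coord y n)"]
    by (simp only: norm_mult complex_mod_cnj mult.assoc)
qed

instantiation ell2 :: real_vector
begin
lift_definition zero_ell2 :: ell2 is "\<lambda>_. 0" by simp
lift_definition plus_ell2 :: "ell2 \<Rightarrow> ell2 \<Rightarrow> ell2" is "\<lambda>f g n. f n + g n"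
  by (rule summable_sq_add)
lift_definition uminus_ell2 :: "ell2 \<Rightarrow> ell2" is "\<lambda>f n. - f n" by simp
lift_definition minus_ell2 :: "ell2 \<Rightarrow> ell2 \<Rightarrow> ell2" is "\<lambda>f g n. f n - g n"
  using summable_sq_add[where g = "\<lambda>n. - _ n"] by simp
lift_definition scaleR_ell2 :: "real \<Rightarrow> ell2 \<Rightarrow> ell2" is "\<lambda>r f n. complex_of_real r * f n"
  by (rule summable_sq_mult)
instance
  by standard (transfer; simp add: algebra_simps)+
end

lemmas coord_simps [simp] =
  zero_ell2.rep_eq plus_ell2.rep_eq uminus_ell2.rep_eq minus_ell2.rep_eq scaleR_ell2.rep_eq

definition cinner_seq :: "ell2 \<Rightarrow> ell2 \<Rightarrow> complex" where
  "cinner_seq x y = (\<Sum>n. coord x n * cnj (coord y n))"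

lemma cinner_seq_self: "cinner_seq x x = complex_of_real (\<Sum>n. (cmod (coord x n))\<^sup>2)"
  unfolding cinner_seq_def
  by (subst suminf_of_real[OF summable_coord]) (simp only: complex_norm_square)

lemma cinner_seq_commute: "cinner_seq x y = cnj (cinner_seq y x)"
proof -
  have "(\<lambda>n. cnj (coord y n * cnj (coord x n))) sums cnj (cinner_seq y x)"
    unfolding sums_cnj cinner_seq_def by (rule summable_sums[OF summable_coord_cnj])
  then show ?thesis
    by (simp add: sums_iff cinner_seq_def mult.commute)
qed

lemma cinner_seq_add_left: "cinner_seq (x + y) z = cinner_seq x z + cinner_seq y z"
  unfolding cinner_seq_def
  by (subst suminf_add[OF summable_coord_cnj summable_coord_cnj]) (simp add: algebra_simps)

lemma cinner_seq_scale_left: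
  assumes "\<And>n. coord w n = c * coord x n"
  shows "cinner_seq w y = c * cinner_seq x y"
  unfolding cinner_seq_def assms
  by (subst suminf_mult[OF summable_coord_cnj, symmetric]) (simp add: mult.assoc)

instantiation ell2 :: real_inner
begin
definition inner_ell2 :: "ell2 \<Rightarrow> ell2 \<Rightarrow> real" where
  "inner_ell2 x y = Re (cinner_seq x y)"
definition norm_ell2 :: "ell2 \<Rightarrow> real" where
  "norm_ell2 x = sqrt (inner x x)"
definition sgn_ell2 :: "ell2 \<Rightarrow> ell2" where
  "sgn_ell2 x = x /\<^sub>R norm x"
definition dist_ell2 :: "ell2 \<Rightarrow> ell2 \<Rightarrow> real" where
  "dist_ell2 x y = norm (x - y)"
definition uniformity_ell2 :: "(ell2 \<times> ell2) filter" where
  "uniformity_ell2 = (INF e\<in>{0<..}. principal {(x, y). dist x y < e})"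
definition open_ell2 :: "ell2 set \<Rightarrow> bool" where
  "open_ell2 U = (\<forall>x\<in>U. \<forall>\<^sub>F (x', y) in uniformity. x' = x \<longrightarrow> y \<in> U)"
instance
proof
  fix x y z :: ell2 and r :: real
  show "dist x y = norm (x - y)" "sgn x = x /\<^sub>R norm x"
    "(uniformity :: (ell2 \<times> ell2) filter) = (INF e\<in>{0<..}. principal {(x, y). dist x y < e})"
    "norm x = sqrt (inner x x)"
    by (simp_all add: dist_ell2_def sgn_ell2_def uniformity_ell2_def norm_ell2_def)
  show "open U = (\<forall>x\<in>U. \<forall>\<^sub>F (x', y) in uniformity. x' = x \<longrightarrow> y \<in> U)" for U :: "ell2 set"
    by (simp add: open_ell2_def)
  show "inner x y = inner y x"
    unfolding inner_ell2_def by (subst cinner_seq_commute) simp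
  show "inner (x + y) z = inner x z + inner y z"
    by (simp add: inner_ell2_def cinner_seq_add_left)
  show "inner (r *\<^sub>R x) y = r * inner x y"
    by (simp add: inner_ell2_def cinner_seq_scale_left[of "r *\<^sub>R x" "complex_of_real r" x])
  show "0 \<le> inner x x"
    by (simp add: inner_ell2_def cinner_seq_self suminf_nonneg summable_coord)
  show "inner x x = 0 \<longleftrightarrow> x = 0"
  proof
    assume "inner x x = 0"
    then have "(\<Sum>n. (cmod (coord x n))\<^sup>2) = 0"
      by (simp add: inner_ell2_def cinner_seq_self)
    then have "\<forall>n. (cmod (coord x n))\<^sup>2 = 0"
      by (subst (asm) suminf_eq_zero_iff[OF summable_coord]) auto
    then show "x = 0"
      by (intro ell2_eqI) simp
  next
    assume "x = 0"
    then show "inner x x = 0"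
      by (simp add: inner_ell2_def cinner_seq_def)
  qed
qed
end

lemma norm_ell2_sq: "(norm x)\<^sup>2 = (\<Sum>n. (cmod (coord x n))\<^sup>2)" for x :: ell2
  unfolding norm_ell2_def inner_ell2_def cinner_seq_self
  by (simp add: suminf_nonneg summable_coord)

lemma sum_coord_le_norm: "(\<Sum>n<N. (cmod (coord x n))\<^sup>2) \<le> (norm x)\<^sup>2" for x :: ell2
  unfolding norm_ell2_sq by (rule sum_le_suminf[OF summable_coord]) auto

lemma coord_le_norm: "cmod (coord x n) \<le> norm x" for x :: ell2
proof (rule power2_le_imp_le)
  have "(cmod (coord x n))\<^sup>2 \<le> (\<Sum>n<Suc n. (cmod (coord x n))\<^sup>2)"
    by (simp add: sum_nonneg)
  then show "(cmod (coord x n))\<^sup>2 \<le> (norm x)\<^sup>2"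
    using sum_coord_le_norm[where N = "Suc n" and x = x] by linarith
qed simp

instance ell2 :: complete_space
proof
  fix X :: "nat \<Rightarrow> ell2"
  assume X: "Cauchy X"
  have CX: "\<exists>M. \<forall>m\<ge>M. \<forall>k\<ge>M. norm (X m - X k) < e" if "0 < e" for e
    using CauchyD[OF X that] .
  have "Cauchy (\<lambda>k. coord (X k) n)" for n
  proof (rule CauchyI)
    fix e :: real assume "0 < e"
    from CX[OF this] obtain M where M: "\<forall>m\<ge>M. \<forall>k\<ge>M. norm (X m - X k) < e" ..
    show "\<exists>M. \<forall>m\<ge>M. \<forall>k\<ge>M. norm (coord (X m) n - coord (X k) n) < e"
    proof (intro exI[of _ M] allI impI)
      fix m k assume "m \<ge> M" "k \<ge> M"
      then have "norm (X m - X k) < e" using M by simp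
      then show "norm (coord (X m) n - coord (X k) n) < e"
        using coord_le_norm[of "X m - X k" n] by simp
    qed
  qed
  then have lim: "(\<lambda>k. coord (X k) n) \<longlonglongrightarrow> lim (\<lambda>k. coord (X k) n)" for n
    by (simp add: Cauchy_convergent_iff convergent_LIMSEQ_iff)
  define l where "l = (\<lambda>n. lim (\<lambda>k. coord (X k) n))"
  have l: "(\<lambda>k. coord (X k) n) \<longlonglongrightarrow> l n" for n
    unfolding l_def by (rule lim)
  have bound: "(\<Sum>n<N. (cmod (coord (X m) n - l n))\<^sup>2) \<le> e\<^sup>2"
    if M: "\<forall>m\<ge>M. \<forall>k\<ge>M. norm (X m - X k) < e" and "m \<ge> M" for M m N e
  proof (rule tendsto_upperbound)
    show "(\<lambda>k. \<Sum>n<N. (cmod (coord (X m) n - coord (X k) n))\<^sup>2) \<longlonglongrightarrow>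
      (\<Sum>n<N. (cmod (coord (X m) n - l n))\<^sup>2)"
      by (intro tendsto_sum tendsto_power tendsto_norm tendsto_diff tendsto_const l)
    show "\<forall>\<^sub>F k in sequentially. (\<Sum>n<N. (cmod (coord (X m) n - coord (X k) n))\<^sup>2) \<le> e\<^sup>2"
    proof (rule eventually_sequentiallyI[of M])
      fix k assume "M \<le> k"
      then have "norm (X m - X k) < e"
        using M \<open>m \<ge> M\<close> by simp
      then have "(norm (X m - X k))\<^sup>2 \<le> e\<^sup>2" by (intro power_mono) auto
      moreover have "(\<Sum>n<N. (cmod (coord (X m) n - coord (X k) n))\<^sup>2) \<le> (norm (X m - X k))\<^sup>2"
        using sum_coord_le_norm[where x = "X m - X k" and N = N] by simp
      ultimately show "(\<Sum>n<N. (cmod (coord (X m) n - coord (X k) n))\<^sup>2) \<le> e\<^sup>2"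
        by (rule order_trans[rotated])
    qed
  qed simp
  have sm: "summable (\<lambda>n. (cmod (coord (X m) n - l n))\<^sup>2)"
    if M: "\<forall>m\<ge>M. \<forall>k\<ge>M. norm (X m - X k) < e" and "m \<ge> M" for M m e
  proof (rule bounded_imp_summable)
    show "(\<Sum>n\<le>k. (cmod (coord (X m) n - l n))\<^sup>2) \<le> e\<^sup>2" for k
      using bound[OF that, of "Suc k"] by (simp only: lessThan_Suc_atMost)
  qed simp
  from CX[OF zero_less_one]
  obtain M1 where M1: "\<forall>m\<ge>M1. \<forall>k\<ge>M1. norm (X m - X k) < 1" ..
  have "summable (\<lambda>n. (cmod (- (coord (X M1) n - l n) + coord (X M1) n))\<^sup>2)"
  proof (rule summable_sq_add[OF _ summable_coord])
    show "summable (\<lambda>n. (cmod (- (coord (X M1) n - l n)))\<^sup>2)"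
      using sm[OF M1 order_refl] by (simp only: norm_minus_cancel)
  qed
  then have ls: "summable (\<lambda>n. (cmod (l n))\<^sup>2)" by simp
  define x where "x = Abs_ell2 l"
  have x: "coord x n = l n" for n
    using ls by (simp add: x_def Abs_ell2_inverse)
  have "X \<longlonglongrightarrow> x"
    unfolding LIMSEQ_def
  proof (intro allI impI)
    fix e :: real assume e: "0 < e"
    from CX[OF half_gt_zero[OF e]]
    obtain M where M: "\<forall>m\<ge>M. \<forall>k\<ge>M. norm (X m - X k) < e / 2" ..
    have "dist (X m) x < e" if "m \<ge> M" for m
    proof -
      have "(norm (X m - x))\<^sup>2 \<le> (e / 2)\<^sup>2"
        unfolding norm_ell2_sq
        by (rule suminf_le_const[OF summable_coord]) (use bound[OF M that] in \<open>simp add: x\<close>)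
      then have "norm (X m - x) \<le> e / 2"
        by (rule power2_le_imp_le) (use e in simp)
      then show ?thesis using e by (simp add: dist_norm)
    qed
    then show "\<exists>M. \<forall>m\<ge>M. dist (X m) x < e" by blast
  qed
  then show "convergent X" by (rule convergentI)
qed

lemma ell2_countable_dense:
  obtains D :: "ell2 set" where "countable D" "\<And>x e. 0 < e \<Longrightarrow> \<exists>d\<in>D. dist x d < e"
proof -
  obtain Q :: "complex set" where Q: "countable Q" "\<And>U. open U \<Longrightarrow> U \<noteq> {} \<Longrightarrow> \<exists>q\<in>Q. q \<in> U"
    using countable_dense_exists by metis
  define s where "s = (\<lambda>(qs :: complex list) n. if n < length qs then qs ! n else 0)"
  define D where "D = (\<lambda>qs. Abs_ell2 (s qs)) ` lists Q"
  have s: "summable (\<lambda>n. (cmod (s qs n))\<^sup>2)" for qs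
    by (rule summable_finite[of "{..<length qs}"]) (auto simp: s_def)
  have coord_s: "coord (Abs_ell2 (s qs)) = s qs" for qs
    using s by (simp add: Abs_ell2_inverse)
  have "\<exists>d\<in>D. dist x d < e" if e: "0 < e" for x e
  proof -
    let ?f = "\<lambda>n. (cmod (coord x n))\<^sup>2"
    have "0 < e\<^sup>2 / 2" using e by simp
    then obtain N where N: "norm (\<Sum>n. ?f (n + N)) < e\<^sup>2 / 2"
      using suminf_exist_split[OF _ summable_coord] by blast
    define r where "r = e / sqrt (2 * (real N + 1))"
    have r: "0 < r" using e by (simp add: r_def)
    have "\<exists>q\<in>Q. cmod (coord x n - q) < r" for n
    proof -
      have "ball (coord x n) r \<noteq> {}" using r by simp
      then obtain q where "q \<in> Q" "q \<in> ball (coord x n) r"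
        using Q(2)[OF open_ball] by blast
      then show ?thesis by (auto simp: dist_norm)
    qed
    then obtain q where q: "\<And>n. q n \<in> Q" "\<And>n. cmod (coord x n - q n) < r" by metis
    define qs where "qs = map q [0..<N]"
    define d where "d = Abs_ell2 (s qs)"
    have d: "coord d n = (if n < N then q n else 0)" for n
      unfolding d_def coord_s by (simp add: s_def qs_def)
    have split: "(norm (x - d))\<^sup>2 =
      (\<Sum>n. (cmod (coord (x - d) (n + N)))\<^sup>2) + (\<Sum>n<N. (cmod (coord (x - d) n))\<^sup>2)"
      unfolding norm_ell2_sq by (rule suminf_split_initial_segment[OF summable_coord])
    have tail: "(\<Sum>n. (cmod (coord (x - d) (n + N)))\<^sup>2) < e\<^sup>2 / 2"
      using N by (simp add: d)
    have r_sq: "r\<^sup>2 * (2 * (real N + 1)) = e\<^sup>2"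
      by (simp add: r_def power_divide)
    have "(\<Sum>n<N. (cmod (coord (x - d) n))\<^sup>2) \<le> (\<Sum>n<N. r\<^sup>2)"
      by (intro sum_mono) (simp add: d power_mono less_imp_le[OF q(2)])
    also have "(\<Sum>n<N. r\<^sup>2) = real N * r\<^sup>2"
      by simp
    finally have "(\<Sum>n<N. (cmod (coord (x - d) n))\<^sup>2) \<le> real N * r\<^sup>2" .
    moreover have "real N * r\<^sup>2 \<le> e\<^sup>2 / 2"
    proof -
      have "e\<^sup>2 = 2 * (real N * r\<^sup>2) + 2 * r\<^sup>2"
        unfolding r_sq[symmetric] by (simp only: distrib_left distrib_right mult_1_right ac_simps)
      then show ?thesis
        using zero_le_power2[of r] by linarith
    qed
    ultimately have "(norm (x - d))\<^sup>2 < e\<^sup>2"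
      using split tail by linarith
    then have "norm (x - d) < e"
      by (rule power2_less_imp_less) (use e in simp)
    moreover have "d \<in> D"
      unfolding D_def d_def
      by (rule image_eqI[OF refl]) (use q(1) in \<open>auto simp: qs_def in_lists_conv_set\<close>)
    ultimately show ?thesis by (auto simp: dist_norm)
  qed
  moreover have "countable D"
    unfolding D_def using Q(1) by (intro countable_image countable_lists)
  ultimately show ?thesis using that by blast
qed

instance ell2 :: polish_space
proof
  obtain D :: "ell2 set" where D: "countable D" "\<And>x e. 0 < e \<Longrightarrow> \<exists>d\<in>D. dist x d < e"
    using ell2_countable_dense by blast
  define B where "B = (\<lambda>(d, n). ball d (1 / real (Suc n))) ` (D \<times> (UNIV :: nat set))"
  have "countable B"
    unfolding B_def using D(1) by (intro countable_image countable_SIGMA) auto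
  moreover have "topological_basis B"
  proof (rule topological_basisI)
    show "open U" if "U \<in> B" for U
      using that by (auto simp: B_def)
    fix U :: "ell2 set" and x
    assume "open U" "x \<in> U"
    then obtain e where e: "0 < e" "ball x e \<subseteq> U"
      using open_contains_ball by blast
    obtain n where n: "1 / real (Suc n) < e / 2"
      by (rule nat_approx_posE[of "e / 2"]) (use e in simp_all)
    obtain d where d: "d \<in> D" "dist x d < 1 / real (Suc n)"
      using D(2)[of "1 / real (Suc n)" x] by auto
    have "ball d (1 / real (Suc n)) \<subseteq> ball x e"
    proof
      fix y assume "y \<in> ball d (1 / real (Suc n))"
      then show "y \<in> ball x e"
        using d n dist_triangle[of x y d] by simp
    qed
    moreover have "x \<in> ball d (1 / real (Suc n))"
      using d by (simp add: dist_commute)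
    ultimately show "\<exists>B'\<in>B. x \<in> B' \<and> B' \<subseteq> U"
      using d(1) e(2) unfolding B_def by blast
  qed
  ultimately show "\<exists>B :: ell2 set set. countable B \<and> open = generate_topology B"
    using topological_basis_imp_subbasis by blast
qed

instantiation ell2 :: complex_hilbert
begin
lift_definition scaleC_ell2 :: "complex \<Rightarrow> ell2 \<Rightarrow> ell2" is "\<lambda>c f n. c * f n"
  by (rule summable_sq_mult)
definition cinner_ell2 :: "ell2 \<Rightarrow> ell2 \<Rightarrow> complex" where
  "cinner_ell2 = cinner_seq"
instance
proof
  fix c d :: complex and r :: real and x y z :: ell2
  show "c *\<^sub>C (x + y) = c *\<^sub>C x + c *\<^sub>C y" "(c + d) *\<^sub>C x = c *\<^sub>C x + d *\<^sub>C x"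
    "c *\<^sub>C d *\<^sub>C x = (c * d) *\<^sub>C x" "r *\<^sub>R x = complex_of_real r *\<^sub>C x"
    by (transfer; simp add: algebra_simps)+
  show "cinner x y = cnj (cinner y x)" "cinner (x + y) z = cinner x z + cinner y z"
    "inner x y = Re (cinner x y)"
    unfolding cinner_ell2_def
    by (rule cinner_seq_commute, rule cinner_seq_add_left, rule inner_ell2_def)
  show "cinner (c *\<^sub>C x) y = c * cinner x y"
    unfolding cinner_ell2_def by (rule cinner_seq_scale_left) (simp add: scaleC_ell2.rep_eq)
qed
end

end

theory Submission
  imports Defs "HOL-Complex_Analysis.Complex_Analysis"
begin

text \<open>
  A self-adjoint extension in a larger space is the inverse Cayley transform of a unitary operator
  \<open>S\<close>, and with \<open>\<zeta> = (\<lambda> - z0) / (\<lambda> - cnj z0)\<close> the compressed resolvent at \<open>\<lambda>\<close> is the resolvent of the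
  inverse Cayley transform of \<open>W \<zeta>\<close>, where \<open>W\<close> is the characteristic function of \<open>S\<close> relative to \<open>H\<close>:
  \<open>W \<zeta> x = w\<close> iff \<open>S (x + \<zeta> h) = w + h\<close> for some \<open>h\<close> orthogonal to \<open>H\<close>. Since \<open>S\<close> is unitary,
  \<open>norm x ^ 2 - norm w ^ 2 = (1 - cmod \<zeta> ^ 2) * norm h ^ 2\<close>. So \<open>W \<zeta>\<close> is a contraction; it extends
  the Cayley transform of \<open>A\<close>, hence splits as its orthogonal sum with a Schur function \<open>F\<close>. The
  lower half-plane follows by taking adjoints, and \<open>F\<close> is recovered from the resolvents by algebra.

  Conversely, \<open>G = (1 - \<zeta> W)^(-1)\<close> satisfies \<open>2 Re G - 1 \<ge> 0\<close>, so its Taylor coefficients form a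
  positive Toeplitz kernel, and the bilateral shift on the resulting space is a unitary operator with
  characteristic function \<open>W\<close>. It comes from a self-adjoint operator iff \<open>1\<close> is not an eigenvalue. By
  the energy identity, the second limit in the definition of admissibility says that \<open>h\<close> stays
  bounded along a sequence tending to infinity in the sector, so a vector violating admissibility and
  a fixed vector of \<open>S\<close> are the same thing.
\<close>

section \<open>Hilbert space preliminaries\<close>

text \<open>The domain of \<open>A\<close> need not be dense, so no adjoint operator of
  \<open>A\<close> is at hand, and domains of extensions are awkward to compare. Everything is
  therefore expressed by contractions defined on the whole space, and equalities of resolvents are
  proved for relations, before it is known whether these are operators. In the converse direction
  the limit condition of admissibility enters only at the end, to exclude fixed vectors of the
  dilation. The parameter \<zeta> is the ratio for which the component h drops out of (z0 -
  \<lambda>) S u - (cnj z0 - \<lambda>) u at u = x + \<zeta> h. It sends infinity to 1 and sectors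
  into nontangential approach regions at 1; this is how the limits at infinity become boundary
  behaviour of a characteristic function. The dilation has to live in \<open>ell2\<close>, so its
  kernel is factorized there explicitly, along a countable dense set of indices and then by
  limits.\<close>

instance complex_hilbert \<subseteq> banach ..

lemma scaleC_one [simp]: "1 *\<^sub>C x = x" for x :: "'a::complex_hilbert"
  using scaleR_eq_scaleC[of 1 x] by simp

lemma scaleC_zero_left [simp]: "0 *\<^sub>C x = 0" for x :: "'a::complex_hilbert"
  using scaleR_eq_scaleC[of 0 x] by simp

lemma scaleC_zero_right [simp]: "c *\<^sub>C (0 :: 'a::complex_hilbert) = 0"
  using scaleC_add_right[of c 0 0] by simp

lemma scaleC_minus_left [simp]: "(- c) *\<^sub>C x = - (c *\<^sub>C x)" for x :: "'a::complex_hilbert"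
  using scaleC_add_left[of "- c" c x] by (simp add: eq_neg_iff_add_eq_0)

lemma scaleC_minus_right [simp]: "c *\<^sub>C (- x) = - (c *\<^sub>C x)" for x :: "'a::complex_hilbert"
  using scaleC_add_right[of c "- x" x] by (simp add: eq_neg_iff_add_eq_0)

lemma scaleC_diff_left: "(c - d) *\<^sub>C x = c *\<^sub>C x - d *\<^sub>C x" for x :: "'a::complex_hilbert"
  using scaleC_add_left[of c "- d" x] by simp

lemma scaleC_diff_right: "c *\<^sub>C (x - y) = c *\<^sub>C x - c *\<^sub>C y" for x :: "'a::complex_hilbert"
  using scaleC_add_right[of c x "- y"] by simp

lemmas scaleC_algebra =
  scaleC_add_left scaleC_add_right scaleC_diff_left scaleC_diff_right scaleC_scaleC

lemma cinner_zero_left [simp]: "cinner (0 :: 'a::complex_hilbert) y = 0"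
  using cinner_scaleC_left[of 0 0 y] by simp

lemma cinner_minus_left [simp]: "cinner (- x) y = - cinner x y" for x :: "'a::complex_hilbert"
  using cinner_scaleC_left[of "- 1" x y] by simp

lemma cinner_diff_left: "cinner (x - y) z = cinner x z - cinner y z"
  for x :: "'a::complex_hilbert"
  using cinner_add_left[of x "- y" z] by simp

lemma cinner_add_right: "cinner x (y + z) = cinner x y + cinner x z"
  for x :: "'a::complex_hilbert"
  by (subst (1 2 3) cinner_commute) (simp add: cinner_add_left)

lemma cinner_scaleC_right: "cinner x (c *\<^sub>C y) = cnj c * cinner x y"
  for x :: "'a::complex_hilbert"
  by (subst (1 2) cinner_commute) (simp add: cinner_scaleC_left)

lemma cinner_zero_right [simp]: "cinner x (0 :: 'a::complex_hilbert) = 0"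
  by (subst cinner_commute) simp

lemma cinner_minus_right [simp]: "cinner x (- y) = - cinner x y" for x :: "'a::complex_hilbert"
  by (subst (1 2) cinner_commute) simp

lemma cinner_diff_right: "cinner x (y - z) = cinner x y - cinner x z"
  for x :: "'a::complex_hilbert"
  using cinner_add_right[of x y "- z"] by simp

lemmas cinner_algebra = cinner_add_left cinner_add_right cinner_diff_left cinner_diff_right
  cinner_scaleC_left cinner_scaleC_right

lemma cinner_self: "cinner x x = complex_of_real ((norm x)\<^sup>2)" for x :: "'a::complex_hilbert"
proof (rule complex_eqI)
  show "Re (cinner x x) = Re (complex_of_real ((norm x)\<^sup>2))"
    by (simp add: power2_norm_eq_inner inner_eq_Re_cinner)
  show "Im (cinner x x) = Im (complex_of_real ((norm x)\<^sup>2))"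
    using arg_cong[OF cinner_commute[of x x], of Im] by (simp only: cnj.sel Im_complex_of_real)
qed

lemma norm_sq_cinner: "(norm x)\<^sup>2 = Re (cinner x x)" for x :: "'a::complex_hilbert"
  by (simp add: cinner_self)

lemma cinner_self_eq_zero [simp]: "cinner x x = 0 \<longleftrightarrow> x = 0" for x :: "'a::complex_hilbert"
  by (simp add: cinner_self)

lemma cinner_eq_zero_commute: "cinner x y = 0 \<longleftrightarrow> cinner y x = 0" for x :: "'a::complex_hilbert"
  by (subst cinner_commute) simp

lemma cinner_eqI: "(\<And>y. cinner x y = cinner x' y) \<Longrightarrow> x = x'" for x :: "'a::complex_hilbert"
  using cinner_self_eq_zero[of "x - x'"] by (simp add: cinner_diff_left)

lemma norm_scaleC [simp]: "norm (c *\<^sub>C x) = cmod c * norm x" for x :: "'a::complex_hilbert"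
proof -
  have "complex_of_real ((norm (c *\<^sub>C x))\<^sup>2) = complex_of_real ((cmod c * norm x)\<^sup>2)"
    by (simp only: cinner_self[symmetric] cinner_scaleC_left cinner_scaleC_right)
      (simp add: cinner_self power_mult_distrib complex_norm_square del: of_real_power)
  then have "(norm (c *\<^sub>C x))\<^sup>2 = (cmod c * norm x)\<^sup>2"
    by (simp only: of_real_eq_iff)
  then show ?thesis by (simp add: power2_eq_iff_nonneg)
qed

text \<open>Multiplying \<open>x\<close> by a phase makes the inner product real and nonnegative,
  which reduces the claim to the real Cauchy-Schwarz inequality.\<close>

lemma norm_cinner_le: "cmod (cinner x y) \<le> norm x * norm y" for x :: "'a::complex_hilbert"
proof -
  define w where "w = (if cinner x y = 0 then 0 else cnj (cinner x y) / cmod (cinner x y))"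
  have w: "cmod w \<le> 1" by (simp add: w_def norm_divide)
  have "w * cinner x y = complex_of_real (cmod (cinner x y))"
    by (simp add: w_def field_simps complex_norm_square[symmetric] power2_eq_square)
  then have "cmod (cinner x y) = inner (w *\<^sub>C x) y"
    by (simp add: inner_eq_Re_cinner cinner_scaleC_left)
  also have "\<dots> \<le> norm (w *\<^sub>C x) * norm y" by (rule norm_cauchy_schwarz)
  also have "\<dots> \<le> norm x * norm y"
    using w by (simp add: mult_right_mono mult_left_le_one_le)
  finally show ?thesis .
qed

lemma norm_add_sq: "(norm (x + y))\<^sup>2 = (norm x)\<^sup>2 + 2 * Re (cinner x y) + (norm y)\<^sup>2"
  for x :: "'a::complex_hilbert"
  using arg_cong[OF cinner_commute[of x y], of Re]
  by (simp add: norm_sq_cinner cinner_algebra)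

lemma norm_diff_sq: "(norm (x - y))\<^sup>2 = (norm x)\<^sup>2 - 2 * Re (cinner x y) + (norm y)\<^sup>2"
  for x :: "'a::complex_hilbert"
  using norm_add_sq[of x "- y"] by simp

lemma pythagoras: "cinner x y = 0 \<Longrightarrow> (norm (x + y))\<^sup>2 = (norm x)\<^sup>2 + (norm y)\<^sup>2"
  for x :: "'a::complex_hilbert"
  by (simp add: norm_add_sq)

lemma bounded_bilinear_cinner:
  "bounded_bilinear (cinner :: 'a::complex_hilbert \<Rightarrow> 'a \<Rightarrow> complex)"
proof
  fix a a' b b' :: 'a and r :: real
  show "cinner (a + a') b = cinner a b + cinner a' b" "cinner a (b + b') = cinner a b + cinner a b'"
    by (simp_all add: cinner_algebra)
  show "cinner (r *\<^sub>R a) b = r *\<^sub>R cinner a b" "cinner a (r *\<^sub>R b) = r *\<^sub>R cinner a b"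
    by (simp_all add: scaleR_eq_scaleC cinner_algebra scaleR_conv_of_real)
  show "\<exists>K. \<forall>a b :: 'a. cmod (cinner a b) \<le> norm a * norm b * K"
    by (intro exI[of _ 1]) (simp add: norm_cinner_le)
qed

lemma bounded_bilinear_scaleC:
  "bounded_bilinear (scaleC :: complex \<Rightarrow> 'a::complex_hilbert \<Rightarrow> 'a)"
proof
  fix a a' :: complex and b b' :: 'a and r :: real
  show "(a + a') *\<^sub>C b = a *\<^sub>C b + a' *\<^sub>C b" "a *\<^sub>C (b + b') = a *\<^sub>C b + a *\<^sub>C b'"
    by (simp_all add: scaleC_algebra)
  show "(r *\<^sub>R a) *\<^sub>C b = r *\<^sub>R (a *\<^sub>C b)" "a *\<^sub>C (r *\<^sub>R b) = r *\<^sub>R (a *\<^sub>C b)"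
    by (simp_all add: scaleR_eq_scaleC scaleC_scaleC scaleR_conv_of_real mult.commute)
  show "\<exists>K. \<forall>(a::complex) (b::'a). norm (a *\<^sub>C b) \<le> norm a * norm b * K"
    by (intro exI[of _ 1]) simp
qed

lemmas tendsto_cinner = bounded_bilinear.tendsto[OF bounded_bilinear_cinner]
lemmas tendsto_scaleC = bounded_bilinear.tendsto[OF bounded_bilinear_scaleC]
lemmas continuous_on_cinner = bounded_bilinear.continuous_on[OF bounded_bilinear_cinner]
lemmas continuous_on_scaleC = bounded_bilinear.continuous_on[OF bounded_bilinear_scaleC]

section \<open>Closed subspaces, orthogonal projections, adjoints of contractions\<close>

definition csubspace :: "'a::complex_hilbert set \<Rightarrow> bool" where
  "csubspace S \<longleftrightarrow> 0 \<in> S \<and> (\<forall>x\<in>S. \<forall>y\<in>S. x + y \<in> S) \<and> (\<forall>c. \<forall>x\<in>S. c *\<^sub>C x \<in> S)"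

lemma csubspace_diff: "csubspace S \<Longrightarrow> x \<in> S \<Longrightarrow> y \<in> S \<Longrightarrow> x - y \<in> S"
  unfolding csubspace_def
  by (metis diff_conv_add_uminus scaleC_minus_left scaleC_one)

lemma csubspace_add: "csubspace S \<Longrightarrow> x \<in> S \<Longrightarrow> y \<in> S \<Longrightarrow> x + y \<in> S"
  and csubspace_scaleC: "csubspace S \<Longrightarrow> x \<in> S \<Longrightarrow> c *\<^sub>C x \<in> S"
  and csubspace_zero: "csubspace S \<Longrightarrow> 0 \<in> S"
  unfolding csubspace_def by blast+

definition orth :: "'a::complex_hilbert set \<Rightarrow> 'a set" where
  "orth S = {x. \<forall>s\<in>S. cinner x s = 0}"

lemma csubspace_orth: "csubspace (orth S)"
  by (simp add: csubspace_def orth_def cinner_algebra)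

lemma closed_orth: "closed (orth S)"
proof -
  have "orth S = (\<Inter>s\<in>S. {x. cinner x s = 0})" by (auto simp: orth_def)
  moreover have "closed {x. cinner x s = 0}" for s :: 'a
    by (intro closed_Collect_eq continuous_on_cinner continuous_intros)
  ultimately show ?thesis by auto
qed

text \<open>The point of \<open>S\<close> nearest to \<open>x\<close>: the parallelogram law makes a
  minimizing sequence Cauchy, and minimality along every direction of \<open>S\<close> forces
  orthogonality.\<close>

lemma proj_exists:
  fixes S :: "'a::complex_hilbert set"
  assumes cl: "closed S" and sub: "csubspace S"
  shows "\<exists>p\<in>S. x - p \<in> orth S"
proof -
  define d where "d = infdist x S"
  have ne: "S \<noteq> {}" using csubspace_zero[OF sub] by auto
  have dle: "d \<le> norm (x - s)" if "s \<in> S" for s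
    using infdist_le[OF that, of x] by (simp add: d_def dist_norm)
  have d0: "0 \<le> d" by (simp add: d_def infdist_nonneg)
  have "\<exists>s\<in>S. norm (x - s) < d + 1 / real (Suc n)" for n
  proof -
    have "infdist x S < d + 1 / real (Suc n)" by (simp add: d_def)
    then show ?thesis
      using cINF_less_iff[OF ne bdd_belowI2[of S 0 "dist x"]] ne unfolding infdist_def
      by (auto simp: dist_norm)
  qed
  then obtain s where s: "\<And>n. s n \<in> S" "\<And>n. norm (x - s n) < d + 1 / real (Suc n)" by metis
  \<comment> \<open>The midpoint of \<open>s m\<close> and \<open>s n\<close> lies in
    \<open>S\<close>, so its distance to \<open>x\<close> is at least \<open>d\<close>; the
    parallelogram law turns the excess of the two distances over \<open>d\<close> into a bound on
    the gap.\<close>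
  have gap: "(norm (s m - s n))\<^sup>2 \<le> 4 * (2 * d + 1) / real (Suc N)" if "N \<le> m" "N \<le> n" for m n N
  proof -
    have b: "(norm (x - s k))\<^sup>2 \<le> d\<^sup>2 + (2 * d + 1) / real (Suc N)" if "N \<le> k" for k
    proof -
      have "1 / real (Suc k) \<le> 1 / real (Suc N)" using that by (simp add: frac_le)
      then have "norm (x - s k) \<le> d + 1 / real (Suc N)" using s(2)[of k] by linarith
      then have "(norm (x - s k))\<^sup>2 \<le> (d + 1 / real (Suc N))\<^sup>2" by (intro power_mono) auto
      moreover have "(d + r)\<^sup>2 \<le> d\<^sup>2 + (2 * d + 1) * r" if "r = 1 / real (Suc N)" for r
      proof -
        have "0 \<le> r" "r \<le> 1" using that by simp_all
        then have "r * r \<le> 1 * r" by (intro mult_right_mono) auto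
        then show ?thesis unfolding that[symmetric] by (simp add: power2_eq_square algebra_simps)
      qed
      from this[OF refl] have "(d + 1 / real (Suc N))\<^sup>2 \<le> d\<^sup>2 + (2 * d + 1) / real (Suc N)" by simp
      ultimately show ?thesis by (rule order_trans)
    qed
    have "(1/2) *\<^sub>C (s m + s n) \<in> S"
      by (intro csubspace_scaleC csubspace_add sub s)
    then have "d \<le> norm (x - (1/2) *\<^sub>C (s m + s n))" by (rule dle)
    also have "\<dots> = norm ((1/2) *\<^sub>C ((x - s m) + (x - s n)))"
    proof -
      have "x = (1/2) *\<^sub>C x + (1/2) *\<^sub>C x" using scaleC_add_left[of "1/2" "1/2" x] by simp
      then show ?thesis by (simp add: scaleC_algebra algebra_simps)
    qed
    finally have "4 * d\<^sup>2 \<le> (norm ((x - s m) + (x - s n)))\<^sup>2"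
      using power_mono[of "2 * d" "norm ((x - s m) + (x - s n))" 2] d0
      by (simp add: power_mult_distrib)
    moreover have "(norm ((x - s m) - (x - s n)))\<^sup>2 + (norm ((x - s m) + (x - s n)))\<^sup>2
        = 2 * (norm (x - s m))\<^sup>2 + 2 * (norm (x - s n))\<^sup>2"
      using norm_add_sq[of "x - s m" "x - s n"] norm_diff_sq[of "x - s m" "x - s n"] by linarith
    moreover have "(norm ((x - s m) - (x - s n)))\<^sup>2 = (norm (s m - s n))\<^sup>2"
      by (simp add: norm_minus_commute)
    moreover have "4 * (2 * d + 1) / real (Suc N) = 4 * ((2 * d + 1) / real (Suc N))"
      by (rule times_divide_eq_right[symmetric])
    ultimately show ?thesis using b[OF that(1)] b[OF that(2)] by linarith
  qed
  have "Cauchy s"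
  proof (rule CauchyI)
    fix e :: real assume e: "0 < e"
    then obtain N where N: "4 * (2 * d + 1) / e\<^sup>2 < real N" using reals_Archimedean2 by blast
    then have "4 * (2 * d + 1) < e\<^sup>2 * real (Suc N)"
      using e by (simp add: field_simps) (smt (verit) zero_le_power2)
    then have "4 * (2 * d + 1) / real (Suc N) < e\<^sup>2"
      by (simp add: field_simps)
    then have "norm (s m - s n) < e" if "N \<le> m" "N \<le> n" for m n
      using gap[OF that] e by (meson le_less_trans less_imp_le power2_less_imp_less)
    then show "\<exists>M. \<forall>m\<ge>M. \<forall>n\<ge>M. norm (s m - s n) < e" by blast
  qed
  then obtain p where p: "s \<longlonglongrightarrow> p" using Cauchy_convergent convergent_def by blast
  have pS: "p \<in> S" using cl p s(1) closed_sequentially by blast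
  have "norm (x - p) \<le> d"
  proof (rule LIMSEQ_le)
    show "(\<lambda>n. norm (x - s n)) \<longlonglongrightarrow> norm (x - p)" by (intro tendsto_intros p)
    show "(\<lambda>n. d + 1 / real (Suc n)) \<longlonglongrightarrow> d"
      using tendsto_add[OF tendsto_const LIMSEQ_inverse_real_of_nat, of d]
      by (simp add: inverse_eq_divide)
    show "\<exists>N. \<forall>n\<ge>N. norm (x - s n) \<le> d + 1 / real (Suc n)" using s(2) less_imp_le by blast
  qed
  have "cinner (x - p) t = 0" if t: "t \<in> S" for t
  proof (rule ccontr)
    assume nz: "cinner (x - p) t \<noteq> 0"
    then have t0: "0 < (norm t)\<^sup>2" by auto
    \<comment> \<open>The coefficient of the projection of \<open>x - p\<close> on \<open>t\<close>:
      moving \<open>p\<close> by \<open>c *\<^sub>C t\<close> would strictly decrease the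
      distance.\<close>
    define c where "c = cinner (x - p) t / complex_of_real ((norm t)\<^sup>2)"
    have "p + c *\<^sub>C t \<in> S" by (intro csubspace_add csubspace_scaleC sub pS t)
    then have "d \<le> norm (x - (p + c *\<^sub>C t))" by (rule dle)
    then have "(norm (x - p))\<^sup>2 \<le> (norm ((x - p) - c *\<^sub>C t))\<^sup>2"
      using \<open>norm (x - p) \<le> d\<close> by (intro power_mono) (auto simp: algebra_simps)
    moreover have "Re (cinner (x - p) (c *\<^sub>C t)) = (cmod (cinner (x - p) t))\<^sup>2 / (norm t)\<^sup>2"
      by (simp add: c_def cinner_scaleC_right complex_norm_square[symmetric] mult.commute
          flip: of_real_power of_real_divide)
    moreover have "(norm (c *\<^sub>C t))\<^sup>2 = (cmod (cinner (x - p) t))\<^sup>2 / (norm t)\<^sup>2"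
      using t0 by (simp add: c_def norm_divide power_divide power_mult_distrib norm_power)
        (simp add: power2_eq_square power4_eq_xxxx field_simps)
    ultimately have "(cmod (cinner (x - p) t))\<^sup>2 / (norm t)\<^sup>2 \<le> 0"
      by (simp add: norm_diff_sq)
    then show False using nz t0 by (simp add: divide_le_0_iff)
  qed
  then show ?thesis using pS by (auto simp: orth_def)
qed

definition proj :: "'a::complex_hilbert set \<Rightarrow> 'a \<Rightarrow> 'a" where
  "proj S x = (SOME p. p \<in> S \<and> x - p \<in> orth S)"

lemma orth_cinner: "x \<in> orth S \<Longrightarrow> s \<in> S \<Longrightarrow> cinner x s = 0"
  and orth_cinner': "x \<in> orth S \<Longrightarrow> s \<in> S \<Longrightarrow> cinner s x = 0"
  by (auto simp: orth_def cinner_eq_zero_commute[of s])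

lemma orth_Int: "x \<in> S \<Longrightarrow> x \<in> orth S \<Longrightarrow> x = 0"
  using orth_cinner[of x S x] by simp

definition clinear :: "('a::complex_hilbert \<Rightarrow> 'b::complex_hilbert) \<Rightarrow> bool" where
  "clinear f \<longleftrightarrow> (\<forall>x y. f (x + y) = f x + f y) \<and> (\<forall>c x. f (c *\<^sub>C x) = c *\<^sub>C f x)"

lemma clinear_add: "clinear f \<Longrightarrow> f (x + y) = f x + f y"
  and clinear_scaleC: "clinear f \<Longrightarrow> f (c *\<^sub>C x) = c *\<^sub>C f x"
  by (simp_all add: clinear_def)

lemma clinear_zero: "clinear f \<Longrightarrow> f 0 = 0"
  using clinear_scaleC[of f 0 0] by simp

lemma clinear_minus: "clinear f \<Longrightarrow> f (- x) = - f x"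
  using clinear_scaleC[of f "-1" x] by simp

lemma clinear_diff: "clinear f \<Longrightarrow> f (x - y) = f x - f y"
  using clinear_add[of f x "- y"] clinear_minus[of f y] by simp

definition contraction :: "('a::complex_hilbert \<Rightarrow> 'b::complex_hilbert) \<Rightarrow> bool" where
  "contraction f \<longleftrightarrow> clinear f \<and> (\<forall>x. norm (f x) \<le> norm x)"

lemma contraction_clinear: "contraction f \<Longrightarrow> clinear f"
  and contraction_norm: "contraction f \<Longrightarrow> norm (f x) \<le> norm x"
  by (simp_all add: contraction_def)

lemma contraction_comp: "contraction f \<Longrightarrow> contraction g \<Longrightarrow> contraction (\<lambda>x. f (g x))"
  unfolding contraction_def clinear_def by (metis order_trans)

context
  fixes S :: "'a::complex_hilbert set"
  assumes cl: "closed S" and sub: "csubspace S"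
begin

lemma proj_mem: "proj S x \<in> S" and proj_orth: "x - proj S x \<in> orth S"
  using someI_ex[of "\<lambda>p. p \<in> S \<and> x - p \<in> orth S"] proj_exists[OF cl sub, of x]
  unfolding proj_def by blast+

lemma proj_eqI: assumes "p \<in> S" "x - p \<in> orth S" shows "proj S x = p"
proof -
  have "p - proj S x \<in> S" using assms proj_mem by (intro csubspace_diff[OF sub])
  moreover have "(x - proj S x) - (x - p) \<in> orth S"
    by (rule csubspace_diff[OF csubspace_orth proj_orth assms(2)])
  ultimately show ?thesis using orth_Int[of "p - proj S x" S] by simp
qed

lemma proj_id: "x \<in> S \<Longrightarrow> proj S x = x"
  by (rule proj_eqI) (simp_all add: orth_def)

lemma proj_zero: "x \<in> orth S \<Longrightarrow> proj S x = 0"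
  by (rule proj_eqI) (simp_all add: csubspace_zero[OF sub])

lemma contraction_proj: "contraction (proj S)"
proof -
  have "proj S (x + y) = proj S x + proj S y" for x y
    using csubspace_add[OF csubspace_orth proj_orth proj_orth, of x y]
    by (intro proj_eqI csubspace_add[OF sub] proj_mem) (simp add: algebra_simps)
  moreover have "proj S (c *\<^sub>C x) = c *\<^sub>C proj S x" for c x
    using csubspace_scaleC[OF csubspace_orth proj_orth, of c x]
    by (intro proj_eqI csubspace_scaleC[OF sub] proj_mem) (simp add: scaleC_algebra)
  moreover have "norm (proj S x) \<le> norm x" for x
  proof (rule power2_le_imp_le)
    have "(norm (proj S x + (x - proj S x)))\<^sup>2 = (norm (proj S x))\<^sup>2 + (norm (x - proj S x))\<^sup>2"
      by (intro pythagoras orth_cinner'[OF proj_orth proj_mem])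
    then show "(norm (proj S x))\<^sup>2 \<le> (norm x)\<^sup>2" by simp
  qed simp
  ultimately show ?thesis by (simp add: contraction_def clinear_def)
qed

lemma eq_UNIV_of_orth: "orth S \<subseteq> {0} \<Longrightarrow> S = UNIV"
proof -
  assume "orth S \<subseteq> {0}"
  then have "x = proj S x" for x using proj_orth[of x] by auto
  then show "S = UNIV" using proj_mem by (metis UNIV_eq_I)
qed

end

text \<open>With \<open>q\<close> a nonzero normal to the kernel,
  \<open>\<phi> q *\<^sub>C x - \<phi> x *\<^sub>C q\<close> lies in the kernel; pairing it with
  \<open>q\<close> gives the representing vector.\<close>

lemma riesz:
  fixes \<phi> :: "'a::complex_hilbert \<Rightarrow> complex"
  assumes add: "\<And>x y. \<phi> (x + y) = \<phi> x + \<phi> y" and scale: "\<And>c x. \<phi> (c *\<^sub>C x) = c * \<phi> x"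
    and bound: "\<And>x. cmod (\<phi> x) \<le> K * norm x"
  shows "\<exists>r. \<forall>x. \<phi> x = cinner x r"
proof -
  define S where "S = {x. \<phi> x = 0}"
  have bl: "bounded_linear \<phi>"
    by (rule bounded_linear_intro[of \<phi> K])
      (auto simp: add scale scaleR_eq_scaleC scaleR_conv_of_real bound mult.commute)
  have cl: "closed S" unfolding S_def
    by (intro closed_Collect_eq linear_continuous_on[OF bl] continuous_on_const)
  have zero: "\<phi> 0 = 0" using scale[of 0 0] by simp
  have minus: "\<phi> (- x) = - \<phi> x" for x using scale[of "-1" x] by simp
  have sub: "csubspace S" by (simp add: csubspace_def S_def add scale zero)
  show ?thesis
  proof (cases "S = UNIV")
    case True
    then show ?thesis by (intro exI[of _ 0]) (auto simp: S_def)
  next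
    case False
    then obtain q where q: "q \<in> orth S" "q \<noteq> 0" using eq_UNIV_of_orth[OF cl sub] by auto
    have "\<phi> x = cinner x ((cnj (\<phi> q) / cinner q q) *\<^sub>C q)" for x
    proof -
      have "\<phi> q *\<^sub>C x - \<phi> x *\<^sub>C q \<in> S"
        using add[of "\<phi> q *\<^sub>C x" "- (\<phi> x *\<^sub>C q)"] by (simp add: S_def scale minus)
      then have "cinner (\<phi> q *\<^sub>C x - \<phi> x *\<^sub>C q) q = 0" using orth_cinner' q(1) by blast
      then have "\<phi> q * cinner x q = \<phi> x * cinner q q" by (simp add: cinner_algebra)
      then show ?thesis using q(2) by (simp add: cinner_algebra cinner_self field_simps)
    qed
    then show ?thesis by blast
  qed
qed

lemma contraction_adjoint:
  fixes f :: "'a::complex_hilbert \<Rightarrow> 'b::complex_hilbert"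
  assumes f: "contraction f"
  obtains g where "contraction g" "\<And>x y. cinner (f x) y = cinner x (g y)"
proof -
  have "\<exists>r. \<forall>x. cinner (f x) y = cinner x r" for y
  proof (rule riesz)
    show "cmod (cinner (f x) y) \<le> norm y * norm x" for x
      using order_trans[OF norm_cinner_le mult_right_mono[OF contraction_norm[OF f] norm_ge_zero]]
      by (simp add: mult.commute)
  qed (use contraction_clinear[OF f] in \<open>simp_all add: clinear_add clinear_scaleC cinner_algebra\<close>)
  then obtain g where g: "\<And>x y. cinner (f x) y = cinner x (g y)" by metis
  have e: "cinner (g y) x = cinner y (f x)" for x y
    by (subst cinner_commute) (simp add: g[symmetric] cinner_commute[of y])
  have "g (x + y) = g x + g y" "g (c *\<^sub>C x) = c *\<^sub>C g x" for c x y
    by (rule cinner_eqI, simp add: e cinner_algebra)+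
  moreover have "norm (g y) \<le> norm y" for y
  proof -
    have "(norm (g y))\<^sup>2 = Re (cinner (f (g y)) y)" by (simp add: norm_sq_cinner g)
    also have "\<dots> \<le> norm (f (g y)) * norm y"
      using complex_Re_le_cmod norm_cinner_le order_trans by blast
    also have "\<dots> \<le> norm (g y) * norm y" by (intro mult_right_mono contraction_norm[OF f]) simp
    finally show ?thesis by (cases "g y = 0") (auto simp: power2_eq_square)
  qed
  ultimately show ?thesis using that[of g] g by (simp add: contraction_def clinear_def)
qed

text \<open>Along an isometric graph a Cauchy sequence of arguments has Cauchy values, so closedness
  of the graph descends to its domain. This serves for the Cayley transform and for the
  dilation.\<close>

lemma closed_Domain_isometric:
  fixes H :: "('a::real_normed_vector \<times> 'b::banach) set"
  assumes H: "closed H"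
    and iso: "\<And>a b a' b'. (a, b) \<in> H \<Longrightarrow> (a', b') \<in> H \<Longrightarrow> norm (b - b') = norm (a - a')"
  shows "closed (Domain H)"
  unfolding closed_sequential_limits
proof (intro allI impI, elim conjE)
  fix a l assume "\<forall>n. a n \<in> Domain H" and l: "a \<longlonglongrightarrow> l"
  then have "\<exists>b. \<forall>n. (a n, b n) \<in> H" by (intro choice) auto
  then obtain b where b: "\<And>n. (a n, b n) \<in> H" by blast
  have "Cauchy a" using l by (rule LIMSEQ_imp_Cauchy)
  then have "Cauchy b" unfolding Cauchy_iff using iso[OF b b] by simp
  then obtain m where m: "b \<longlonglongrightarrow> m" using Cauchy_convergent convergent_def by blast
  have "(l, m) \<in> H"
    using closed_sequentially[OF H, of "\<lambda>n. (a n, b n)"] b tendsto_Pair[OF l m] by blast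
  then show "l \<in> Domain H" by blast
qed

section \<open>Neumann series\<close>

text \<open>This is (1 - \<zeta> T)^(-1) y, taken as the fixed point of a strict contraction, so
  that no operator series has to be summed.\<close>

definition neumann :: "('a::complex_hilbert \<Rightarrow> 'a) \<Rightarrow> complex \<Rightarrow> 'a \<Rightarrow> 'a" where
  "neumann T \<zeta> y = (THE u. u = y + \<zeta> *\<^sub>C T u)"

context
  fixes T :: "'a::complex_hilbert \<Rightarrow> 'a"
  assumes T: "contraction T"
begin

lemma neumann_ex1: assumes "cmod \<zeta> < 1" shows "\<exists>!u. u = y + \<zeta> *\<^sub>C T u"
proof -
  have "\<exists>!u. (\<lambda>u. y + \<zeta> *\<^sub>C T u) u = u"
  proof (rule banach_fix_type[of "cmod \<zeta>"])
    show "\<forall>x x'. dist (y + \<zeta> *\<^sub>C T x) (y + \<zeta> *\<^sub>C T x') \<le> cmod \<zeta> * dist x x'"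
      using contraction_norm[OF T]
      by (auto simp: dist_norm scaleC_diff_right[symmetric] clinear_diff[OF contraction_clinear[OF T], symmetric]
          mult_left_mono)
  qed (use assms in auto)
  then show ?thesis by metis
qed

lemma neumann_eq: "cmod \<zeta> < 1 \<Longrightarrow> neumann T \<zeta> y = y + \<zeta> *\<^sub>C T (neumann T \<zeta> y)"
  unfolding neumann_def by (rule theI'[OF neumann_ex1])

lemma neumann_eqI: "cmod \<zeta> < 1 \<Longrightarrow> u = y + \<zeta> *\<^sub>C T u \<Longrightarrow> neumann T \<zeta> y = u"
  unfolding neumann_def by (rule the1_equality[OF neumann_ex1])

lemma clinear_neumann: assumes "cmod \<zeta> < 1" shows "clinear (neumann T \<zeta>)"
  unfolding clinear_def
proof (intro conjI allI)
  fix x y c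
  note eq = neumann_eq[OF assms] and lin = contraction_clinear[OF T]
  show "neumann T \<zeta> (x + y) = neumann T \<zeta> x + neumann T \<zeta> y"
    by (rule neumann_eqI[OF assms], subst (1) eq, subst (2) eq)
      (simp add: clinear_add[OF lin] scaleC_algebra)
  show "neumann T \<zeta> (c *\<^sub>C x) = c *\<^sub>C neumann T \<zeta> x"
    by (rule neumann_eqI[OF assms], subst (1) eq)
      (simp add: clinear_scaleC[OF lin] scaleC_algebra mult.commute)
qed

lemma norm_neumann: assumes "cmod \<zeta> < 1" shows "norm (neumann T \<zeta> y) \<le> norm y / (1 - cmod \<zeta>)"
proof -
  have "norm (neumann T \<zeta> y) \<le> norm y + cmod \<zeta> * norm (T (neumann T \<zeta> y))"
    by (subst neumann_eq[OF assms]) (metis norm_scaleC norm_triangle_ineq)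
  also have "\<dots> \<le> norm y + cmod \<zeta> * norm (neumann T \<zeta> y)"
    by (intro add_left_mono mult_left_mono contraction_norm[OF T]) simp
  finally show ?thesis using assms by (simp add: field_simps)
qed

text \<open>The resolvent identity, read off from the fixed point equation that the difference
  satisfies. The estimates of difference quotients of \<open>charfun\<close> rest on it.\<close>

lemma neumann_diff:
  assumes "cmod \<zeta> < 1" "cmod \<omega> < 1"
  shows "neumann T \<zeta> y - neumann T \<omega> y = (\<zeta> - \<omega>) *\<^sub>C neumann T \<zeta> (T (neumann T \<omega> y))"
proof -
  let ?d = "neumann T \<zeta> y - neumann T \<omega> y"
  have "?d = (\<zeta> - \<omega>) *\<^sub>C T (neumann T \<omega> y) + \<zeta> *\<^sub>C T ?d"
    by (subst neumann_eq[OF assms(1)], subst neumann_eq[OF assms(2)])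
      (simp add: clinear_diff[OF contraction_clinear[OF T]] scaleC_algebra)
  from neumann_eqI[OF assms(1) this] show ?thesis
    by (simp add: clinear_scaleC[OF clinear_neumann[OF assms(1)]])
qed

end

section \<open>The characteristic function of a unitary operator relative to a subspace\<close>

lemma isometric_clinear: "isometric_embedding V \<Longrightarrow> clinear V"
  and isometric_cinner: "isometric_embedding V \<Longrightarrow> cinner (V x) (V y) = cinner x y"
  by (simp_all add: isometric_embedding_def clinear_def)

lemma isometric_norm: "isometric_embedding V \<Longrightarrow> norm (V x) = norm x"
  by (rule power2_eq_imp_eq) (simp_all add: norm_sq_cinner isometric_cinner)

lemma isometric_eq_iff: "isometric_embedding V \<Longrightarrow> V x = V y \<longleftrightarrow> x = y"
  using isometric_norm[of V "x - y"] isometric_clinear[of V]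
  by (auto simp: clinear_diff)

lemma contraction_isometric: "isometric_embedding V \<Longrightarrow> contraction V"
  by (simp add: contraction_def isometric_clinear isometric_norm)

lemma csubspace_range: "clinear V \<Longrightarrow> csubspace (range V)"
  unfolding csubspace_def
  by (auto simp: clinear_add[symmetric] clinear_scaleC[symmetric]
      intro: range_eqI[OF clinear_zero[symmetric]])

lemma closed_range_isometric:
  assumes V: "isometric_embedding (V :: 'a::complex_hilbert \<Rightarrow> 'b::complex_hilbert)"
  shows "closed (range V)"
proof (rule complete_imp_closed, rule complete_isometric_image[of 1])
  show "bounded_linear V"
    using isometric_clinear[OF V] isometric_norm[OF V]
    by (intro bounded_linear_intro[of _ 1]) (auto simp: clinear_def scaleR_eq_scaleC)
  show "subspace (UNIV :: 'a set)" "complete (UNIV :: 'a set)"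
    by (simp_all add: complete_UNIV)
qed (simp_all add: isometric_norm[OF V])

lemma isometric_inv:
  assumes S: "isometric_embedding (S :: 'a::complex_hilbert \<Rightarrow> 'a)" and "surj S"
  shows "isometric_embedding (inv S)"
proof -
  have i: "S (inv S x) = x" for x using \<open>surj S\<close> by (rule surj_f_inv_f)
  have eq: "S x = S y \<Longrightarrow> x = y" for x y using isometric_eq_iff[OF S] by blast
  note lin = isometric_clinear[OF S]
  have "inv S (x + y) = inv S x + inv S y" "inv S (c *\<^sub>C x) = c *\<^sub>C inv S x" for x y c
    by (rule eq, simp add: i clinear_add[OF lin] clinear_scaleC[OF lin])+
  moreover have "cinner (inv S x) (inv S y) = cinner x y" for x y
    using isometric_cinner[OF S, of "inv S x" "inv S y"] by (simp add: i)
  ultimately show ?thesis by (simp add: isometric_embedding_def)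
qed

locale unitary_dilation =
  fixes V :: "'h::complex_hilbert \<Rightarrow> 'k::complex_hilbert" and S :: "'k \<Rightarrow> 'k"
  assumes V: "isometric_embedding V" and S: "isometric_embedding S" and surj: "surj S"
begin

lemmas contraction_S = contraction_isometric[OF S]
lemmas linV = isometric_clinear[OF V] and linS = isometric_clinear[OF S]
lemmas cinner_V = isometric_cinner[OF V] and cinner_S = isometric_cinner[OF S]
lemmas norm_V = isometric_norm[OF V] and norm_S = isometric_norm[OF S]
lemmas range_V = closed_range_isometric[OF V] csubspace_range[OF linV]

text \<open>This is the adjoint of \<open>V\<close>; followed by \<open>V\<close> it is the
  projection onto the copy of H in the larger space.\<close>

definition compr :: "'k \<Rightarrow> 'h" where
  "compr k = inv V (proj (range V) k)"

definition rest :: "'k \<Rightarrow> 'k" where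
  "rest k = k - V (compr k)"

lemma V_compr: "V (compr k) = proj (range V) k"
  using proj_mem[OF range_V]
  unfolding compr_def by (metis f_inv_into_f)

lemma rest_orth: "cinner (rest k) (V g) = 0"
  using proj_orth[OF range_V]
  unfolding rest_def V_compr by (auto simp: orth_def)

lemma compr_eqI: assumes "\<And>g. cinner (k - V p) (V g) = 0" shows "compr k = p"
proof -
  have "proj (range V) k = V p"
    using assms by (intro proj_eqI range_V)
      (auto simp: orth_def)
  then show ?thesis by (simp add: compr_def isometric_eq_iff[OF V] inj_def)
qed

lemma contraction_compr: "contraction compr"
proof -
  let ?P = "proj (range V)"
  have P: "contraction ?P"
    by (intro contraction_proj range_V)
  have eq: "V x = V y \<Longrightarrow> x = y" for x y using isometric_eq_iff[OF V] by blast
  have "norm (compr k) = norm (?P k)" for k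
    by (simp flip: V_compr add: norm_V)
  moreover have "compr (x + y) = compr x + compr y" "compr (c *\<^sub>C x) = c *\<^sub>C compr x" for x y c
    using contraction_clinear[OF P] linV
    by (auto intro!: eq simp: V_compr clinear_add clinear_scaleC)
  ultimately show ?thesis
    using contraction_norm[OF P] by (simp add: contraction_def clinear_def)
qed

lemma contraction_rest: "contraction rest"
proof -
  have "clinear rest"
    using contraction_clinear[OF contraction_compr] linV
    by (simp add: clinear_def rest_def scaleC_algebra)
  moreover have "norm (rest k) \<le> norm k" for k
  proof (rule power2_le_imp_le)
    have "(norm (rest k + V (compr k)))\<^sup>2 = (norm (rest k))\<^sup>2 + (norm (V (compr k)))\<^sup>2"
      by (rule pythagoras[OF rest_orth])
    then show "(norm (rest k))\<^sup>2 \<le> (norm k)\<^sup>2" by (simp add: rest_def)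
  qed simp
  ultimately show ?thesis by (simp add: contraction_def)
qed

text \<open>\<open>S\<close> followed by the projection onto the complement of H, kept on the whole
  space: on \<open>V x\<close> it is the input of a linear system, on vectors orthogonal to H its
  state transition.\<close>

abbreviation T where "T \<equiv> \<lambda>k. rest (S k)"

lemma contraction_T: "contraction T"
  by (intro contraction_comp[OF contraction_rest] contraction_S)

lemmas linT = contraction_clinear[OF contraction_T]

text \<open>The vector h of the dilation equation: projecting that equation onto the complement of H
  gives h = T (V x) + \<zeta> T h, a Neumann equation. In system language h is the state and
  \<open>charfun\<close> the transfer function.\<close>

definition state :: "complex \<Rightarrow> 'h \<Rightarrow> 'k" where
  "state \<zeta> x = neumann T \<zeta> (T (V x))"

definition charfun :: "complex \<Rightarrow> 'h \<Rightarrow> 'h" where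
  "charfun \<zeta> x = compr (S (V x + \<zeta> *\<^sub>C state \<zeta> x))"

lemma state_eq: assumes "cmod \<zeta> < 1" shows "state \<zeta> x = rest (S (V x + \<zeta> *\<^sub>C state \<zeta> x))"
  using neumann_eq[OF contraction_T assms, of "T (V x)"] linT
  by (simp add: state_def clinear_def)

lemma state_orth: "cmod \<zeta> < 1 \<Longrightarrow> cinner (state \<zeta> x) (V g) = 0"
  by (subst state_eq) (simp_all add: rest_orth)

lemma unitary_state:
  assumes "cmod \<zeta> < 1" shows "S (V x + \<zeta> *\<^sub>C state \<zeta> x) = V (charfun \<zeta> x) + state \<zeta> x"
  using state_eq[OF assms, of x] by (simp add: charfun_def rest_def algebra_simps)

text \<open>The component off H of any solution of the dilation equation solves the Neumann
  equation, hence is the state. So \<open>charfun\<close> can be identified by exhibiting a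
  solution.\<close>

lemma charfun_eqI:
  assumes "cmod \<zeta> < 1" and eq: "S (V x + \<zeta> *\<^sub>C k) = V w + k" and k: "\<And>g. cinner k (V g) = 0"
  shows "state \<zeta> x = k" "charfun \<zeta> x = w"
proof -
  have "compr (V w + k) = w" by (rule compr_eqI) (simp add: k)
  then have "rest (S (V x + \<zeta> *\<^sub>C k)) = k" by (simp add: eq rest_def)
  then have "k = T (V x) + \<zeta> *\<^sub>C T k"
    using linT by (simp add: clinear_def)
  then show st: "state \<zeta> x = k"
    unfolding state_def by (rule neumann_eqI[OF contraction_T assms(1)])
  show "charfun \<zeta> x = w" using \<open>compr (V w + k) = w\<close> by (simp add: charfun_def st eq)
qed

lemma energy:
  assumes "cmod \<zeta> < 1"
  shows "(norm x)\<^sup>2 - (norm (charfun \<zeta> x))\<^sup>2 = (1 - (cmod \<zeta>)\<^sup>2) * (norm (state \<zeta> x))\<^sup>2"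
proof -
  have "cinner (V w) (state \<zeta> x) = 0" for w
    using state_orth[OF assms, of x w] by (simp add: cinner_eq_zero_commute)
  then have "(norm (V x + \<zeta> *\<^sub>C state \<zeta> x))\<^sup>2 = (norm x)\<^sup>2 + (cmod \<zeta>)\<^sup>2 * (norm (state \<zeta> x))\<^sup>2"
    "(norm (V (charfun \<zeta> x) + state \<zeta> x))\<^sup>2 = (norm (charfun \<zeta> x))\<^sup>2 + (norm (state \<zeta> x))\<^sup>2"
    by (simp_all add: pythagoras cinner_scaleC_right norm_V power_mult_distrib)
  then show ?thesis
    using arg_cong[OF unitary_state[OF assms, of x], of norm] norm_S
    by (simp add: algebra_simps)
qed

lemma norm_state: assumes "cmod \<zeta> < 1" shows "norm (state \<zeta> x) \<le> norm x / (1 - cmod \<zeta>)"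
proof -
  have "norm (state \<zeta> x) \<le> norm (T (V x)) / (1 - cmod \<zeta>)"
    unfolding state_def by (rule norm_neumann[OF contraction_T assms])
  also have "\<dots> \<le> norm x / (1 - cmod \<zeta>)"
    using contraction_norm[OF contraction_T, of "V x"] assms
    by (intro divide_right_mono) (auto simp: norm_V)
  finally show ?thesis .
qed

lemma contraction_charfun: assumes "cmod \<zeta> < 1" shows "contraction (charfun \<zeta>)"
proof -
  have "clinear (state \<zeta>)"
    using clinear_neumann[OF contraction_T assms] linT
      linV by (simp add: state_def clinear_def)
  then have "clinear (charfun \<zeta>)"
    using contraction_clinear[OF contraction_compr] linV
      linS
    by (simp add: charfun_def clinear_def scaleC_algebra mult.commute)
  moreover have "norm (charfun \<zeta> x) \<le> norm x" for x
  proof (rule power2_le_imp_le)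
    have "0 \<le> (1 - (cmod \<zeta>)\<^sup>2) * (norm (state \<zeta> x))\<^sup>2"
      using assms by (intro mult_nonneg_nonneg) (simp_all add: abs_square_le_1)
    then show "(norm (charfun \<zeta> x))\<^sup>2 \<le> (norm x)\<^sup>2"
      using energy[OF assms, of x] by linarith
  qed simp
  ultimately show ?thesis by (simp add: contraction_def)
qed

text \<open>Altogether \<open>charfun \<zeta>\<close> is V* S (1 - \<zeta> T)^(-1) V, and the
  resolvent identity lets the factor \<zeta> - \<omega> come out exactly.\<close>

lemma charfun_diff:
  assumes "cmod \<zeta> < 1" "cmod \<omega> < 1"
  shows "charfun \<zeta> x - charfun \<omega> x = (\<zeta> - \<omega>) *\<^sub>C compr (S (neumann T \<zeta> (state \<omega> x)))"
proof -
  have st: "state \<zeta> x = state \<omega> x + (\<zeta> - \<omega>) *\<^sub>C neumann T \<zeta> (T (state \<omega> x))"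
    using neumann_diff[OF contraction_T assms, of "T (V x)"] by (simp add: state_def algebra_simps)
  have "\<zeta> *\<^sub>C state \<zeta> x - \<omega> *\<^sub>C state \<omega> x
      = (\<zeta> - \<omega>) *\<^sub>C (state \<omega> x + \<zeta> *\<^sub>C neumann T \<zeta> (T (state \<omega> x)))"
    by (simp add: st scaleC_algebra algebra_simps)
  also have "state \<omega> x + \<zeta> *\<^sub>C neumann T \<zeta> (T (state \<omega> x)) = neumann T \<zeta> (state \<omega> x)"
  proof (rule sym, rule neumann_eqI[OF contraction_T assms(1)])
    let ?n = "neumann T \<zeta> (T (state \<omega> x))"
    show "state \<omega> x + \<zeta> *\<^sub>C ?n = state \<omega> x + \<zeta> *\<^sub>C T (state \<omega> x + \<zeta> *\<^sub>C ?n)"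
      by (subst (1) neumann_eq[OF contraction_T assms(1)])
        (use linT in \<open>simp add: clinear_def\<close>)
  qed
  finally have e: "(V x + \<zeta> *\<^sub>C state \<zeta> x) - (V x + \<omega> *\<^sub>C state \<omega> x)
      = (\<zeta> - \<omega>) *\<^sub>C neumann T \<zeta> (state \<omega> x)" by simp
  have lin: "clinear (\<lambda>k. compr (S k))"
    by (rule contraction_clinear[OF contraction_comp[OF contraction_compr contraction_S]])
  show ?thesis
    unfolding charfun_def clinear_diff[OF lin, symmetric] e by (rule clinear_scaleC[OF lin])
qed

text \<open>The factor left over in \<open>charfun_diff\<close> when \<zeta> = \<omega>, that is V*
  S (1 - \<omega> T)^(-2) T V.\<close>

definition charfun_deriv :: "complex \<Rightarrow> 'h \<Rightarrow> 'h" where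
  "charfun_deriv \<omega> x = compr (S (neumann T \<omega> (state \<omega> x)))"

lemma charfun_deriv_bound:
  assumes "cmod \<omega> < 1"
  shows "norm (charfun_deriv \<omega> x) \<le> norm x / (1 - cmod \<omega>)\<^sup>2"
proof -
  have "norm (charfun_deriv \<omega> x) \<le> norm (neumann T \<omega> (state \<omega> x))"
    unfolding charfun_deriv_def
    by (rule contraction_norm[OF contraction_comp[OF contraction_compr contraction_S]])
  also have "\<dots> \<le> norm (state \<omega> x) / (1 - cmod \<omega>)" by (rule norm_neumann[OF contraction_T assms])
  also have "\<dots> \<le> (norm x / (1 - cmod \<omega>)) / (1 - cmod \<omega>)"
    using assms by (intro divide_right_mono norm_state) auto
  finally show ?thesis by (simp add: power2_eq_square)
qed

text \<open>The bound is linear in the distance of the two points and uniform over the unit ball,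
  which amounts to differentiability in operator norm.\<close>

lemma charfun_quotient_bound:
  assumes "cmod \<zeta> < 1" "cmod \<omega> < 1"
  shows "norm (compr (S (neumann T \<zeta> (state \<omega> x))) - charfun_deriv \<omega> x)
    \<le> cmod (\<zeta> - \<omega>) * norm x / ((1 - cmod \<zeta>) * (1 - cmod \<omega>)\<^sup>2)"
proof -
  have lin: "contraction (\<lambda>k. compr (S k))"
    by (rule contraction_comp[OF contraction_compr contraction_S])
  have "norm (compr (S (neumann T \<zeta> (state \<omega> x))) - charfun_deriv \<omega> x)
      \<le> norm (neumann T \<zeta> (state \<omega> x) - neumann T \<omega> (state \<omega> x))"
    unfolding charfun_deriv_def clinear_diff[OF contraction_clinear[OF lin], symmetric]
    by (rule contraction_norm[OF lin])
  also have "\<dots> = cmod (\<zeta> - \<omega>) * norm (neumann T \<zeta> (T (neumann T \<omega> (state \<omega> x))))"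
    by (subst neumann_diff[OF contraction_T assms]) simp
  also have "\<dots> \<le> cmod (\<zeta> - \<omega>) * (norm x / (1 - cmod \<omega>)\<^sup>2 / (1 - cmod \<zeta>))"
  proof (intro mult_left_mono)
    have "norm (T (neumann T \<omega> (state \<omega> x))) \<le> norm (neumann T \<omega> (state \<omega> x))"
      by (rule contraction_norm[OF contraction_T])
    also have "\<dots> \<le> norm (state \<omega> x) / (1 - cmod \<omega>)" by (rule norm_neumann[OF contraction_T assms(2)])
    also have "\<dots> \<le> norm x / (1 - cmod \<omega>) / (1 - cmod \<omega>)"
      using assms by (intro divide_right_mono norm_state) auto
    finally have "norm (T (neumann T \<omega> (state \<omega> x))) / (1 - cmod \<zeta>)
        \<le> norm x / (1 - cmod \<omega>)\<^sup>2 / (1 - cmod \<zeta>)"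
      using assms by (intro divide_right_mono) (simp_all add: power2_eq_square)
    with norm_neumann[OF contraction_T assms(1)]
    show "norm (neumann T \<zeta> (T (neumann T \<omega> (state \<omega> x))))
        \<le> norm x / (1 - cmod \<omega>)\<^sup>2 / (1 - cmod \<zeta>)"
      by (rule order_trans)
  qed simp
  finally show ?thesis by (simp add: mult.commute)
qed

end

section \<open>Inverse Cayley transforms and their resolvents\<close>

definition disc_map :: "complex \<Rightarrow> complex \<Rightarrow> complex" where
  "disc_map z0 z = (z - z0) / (z - cnj z0)"

lemma half_plane_cnj [simp]: "cnj z \<in> half_plane z0 \<longleftrightarrow> z \<in> half_plane (cnj z0)"
  by (simp add: half_plane_def)

lemma half_plane_cases: "z0 \<notin> \<real> \<Longrightarrow> z \<notin> \<real> \<Longrightarrow> z \<in> half_plane z0 \<or> z \<in> half_plane (cnj z0)"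
  by (auto simp: half_plane_def complex_is_Real_iff zero_less_mult_iff mult_less_0_iff linorder_neq_iff)

lemma half_plane_not_Reals: "z \<in> half_plane z0 \<Longrightarrow> z \<notin> \<real>" "z \<in> half_plane z0 \<Longrightarrow> z0 \<notin> \<real>"
  by (auto simp: half_plane_def complex_is_Real_iff)

lemma half_plane_neq_cnj: "z \<in> half_plane z0 \<Longrightarrow> z - cnj z0 \<noteq> 0"
proof
  assume "z \<in> half_plane z0" "z - cnj z0 = 0"
  then have "Im z * Im z0 > 0" "Im z = - Im z0" by (auto simp: half_plane_def)
  then show False by (simp add: zero_less_mult_iff)
qed

lemma not_Reals_diff_cnj: "z0 \<notin> \<real> \<Longrightarrow> z0 - cnj z0 \<noteq> 0"
  by (simp add: complex_is_Real_iff complex_eq_iff)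

lemma disc_map_defect:
  assumes "z \<in> half_plane z0"
  shows "1 - (cmod (disc_map z0 z))\<^sup>2 = 4 * (Im z * Im z0) / (cmod (z - cnj z0))\<^sup>2"
proof -
  have "(cmod (z - cnj z0))\<^sup>2 - (cmod (z - z0))\<^sup>2 = 4 * (Im z * Im z0)"
    unfolding cmod_power2 by (simp add: power2_eq_square algebra_simps)
  moreover have "(cmod (z - cnj z0))\<^sup>2 \<noteq> 0" using half_plane_neq_cnj[OF assms] by simp
  ultimately have "(cmod (z - z0))\<^sup>2 / (cmod (z - cnj z0))\<^sup>2
      = 1 - 4 * (Im z * Im z0) / (cmod (z - cnj z0))\<^sup>2"
    by (metis add_diff_cancel_left' diff_add_cancel diff_divide_distrib div_self)
  then show ?thesis
    by (simp add: disc_map_def norm_divide power_divide)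
qed

lemma norm_disc_map: assumes "z \<in> half_plane z0" shows "cmod (disc_map z0 z) < 1"
proof -
  have "0 < 1 - (cmod (disc_map z0 z))\<^sup>2"
    unfolding disc_map_defect[OF assms]
    using assms half_plane_neq_cnj[OF assms] by (intro divide_pos_pos) (auto simp: half_plane_def)
  then show ?thesis by (simp add: abs_square_less_1)
qed

lemma one_minus_disc_map:
  "z \<in> half_plane z0 \<Longrightarrow> 1 - disc_map z0 z = (z0 - cnj z0) / (z - cnj z0)"
  using half_plane_neq_cnj[of z z0] by (simp add: disc_map_def field_simps)

lemma disc_map_mult: "z \<in> half_plane z0 \<Longrightarrow> (cnj z0 - z) * disc_map z0 z = z0 - z"
  using half_plane_neq_cnj[of z z0] by (simp add: disc_map_def field_simps)

text \<open>The pairs are parametrized by the graph instead of inverting G - 1. For non-real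
  \<open>z\<close>, a nonzero fixed vector u of a linear G contributes the pair (0, (z - cnj z) u):
  this spoils single-valuedness, not the resolvent formula.\<close>

definition cayley_inverse :: "('a::complex_hilbert, 'a) op_graph \<Rightarrow> complex \<Rightarrow> ('a, 'a) op_graph" where
  "cayley_inverse G z = {(w - u, z *\<^sub>C w - cnj z *\<^sub>C u) | u w. (u, w) \<in> G}"

lemma quasi_selfadjoint_ext_eq:
  "quasi_selfadjoint_ext A T z = cayley_inverse (op_sum (cayley A z) T) z"
proof (intro equalityI subrelI)
  let ?G = "op_sum (cayley A z) T"
  have eq: "(z - cnj z) *\<^sub>C u + z *\<^sub>C (w - u) = z *\<^sub>C w - cnj z *\<^sub>C u" for u w :: 'a
    by (simp add: scaleC_algebra)
  fix x y
  {
    assume "(x, y) \<in> quasi_selfadjoint_ext A T z"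
    then obtain u w where "(u, w) \<in> ?G" "x = w - u" "y = (z - cnj z) *\<^sub>C u + z *\<^sub>C x"
      by (auto simp: quasi_selfadjoint_ext_def add_scalar_def mult_scalar_def resolvent_def)
    then show "(x, y) \<in> cayley_inverse ?G z"
      by (auto simp: cayley_inverse_def eq)
  next
    assume "(x, y) \<in> cayley_inverse ?G z"
    then obtain u w where uw: "(u, w) \<in> ?G" "x = w - u" "y = (z - cnj z) *\<^sub>C u + z *\<^sub>C x"
      by (auto simp: cayley_inverse_def eq)
    then have "(x, u) \<in> resolvent ?G 1"
      by (force simp: resolvent_def add_scalar_def)
    then have "(x, (z - cnj z) *\<^sub>C u) \<in> mult_scalar (z - cnj z) (resolvent ?G 1)"
      by (auto simp: mult_scalar_def)
    then show "(x, y) \<in> quasi_selfadjoint_ext A T z"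
      by (auto simp: quasi_selfadjoint_ext_def add_scalar_def uw(3))
  }
qed

lemma resolvent_cayley_inverse:
  "resolvent (cayley_inverse G z0) z =
    {((z0 - z) *\<^sub>C w - (cnj z0 - z) *\<^sub>C u, w - u) | u w. (u, w) \<in> G}"
proof -
  have "z0 *\<^sub>C w - cnj z0 *\<^sub>C u + (- z) *\<^sub>C (w - u) = (z0 - z) *\<^sub>C w - (cnj z0 - z) *\<^sub>C u" for w u :: 'a
    by (simp add: scaleC_algebra algebra_simps)
  then show ?thesis
    unfolding resolvent_def cayley_inverse_def add_scalar_def by (auto; metis)
qed

text \<open>A resolvent pair consists of two linear combinations of u and w whose determinant is, up
  to sign, \<open>z0 - cnj z0\<close>; so u and w can be solved for, whatever \<open>z\<close>
  is.\<close>

lemma resolvent_cayley_inverse_inj: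
  assumes z0: "z0 \<notin> \<real>"
    and eq: "resolvent (cayley_inverse G z0) z = resolvent (cayley_inverse G' z0) z"
  shows "G = G'"
proof -
  have "G \<subseteq> G'"
    if eq: "resolvent (cayley_inverse G z0) z \<subseteq> resolvent (cayley_inverse G' z0) z" for G G' :: "('a, 'a) op_graph"
  proof (rule subrelI)
    fix u w assume "(u, w) \<in> G"
    then obtain u' w' where uw: "(u', w') \<in> G'" "w - u = w' - u'"
      "(z0 - z) *\<^sub>C w - (cnj z0 - z) *\<^sub>C u = (z0 - z) *\<^sub>C w' - (cnj z0 - z) *\<^sub>C u'"
      using eq unfolding resolvent_cayley_inverse by blast
    have w: "w = u + (w' - u')" using uw(2) by (simp add: algebra_simps)
    have "(z0 - cnj z0) *\<^sub>C (u - u') = 0"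
      using uw(3) unfolding w by (simp add: scaleC_algebra algebra_simps)
    then have "inverse (z0 - cnj z0) *\<^sub>C (z0 - cnj z0) *\<^sub>C (u - u') = 0" by simp
    then have "u = u'" using not_Reals_diff_cnj[OF z0] by (simp add: scaleC_scaleC del: scaleC_diff_right)
    then show "(u, w) \<in> G'" using uw(1,2) by simp
  qed
  from this[of G G'] this[of G' G] eq show ?thesis by blast
qed

lemma graph_on_UNIV_iff [simp]: "(u, w) \<in> graph_on UNIV g \<longleftrightarrow> w = g u"
  by (auto simp: graph_on_def)

text \<open>Division by \<open>cnj z0 - z\<close> turns the equation for u into a Neumann equation
  with the parameter \<open>disc_map z0 z\<close> of modulus less than 1.\<close>

lemma
  assumes g: "contraction g" and z: "z \<in> half_plane z0"
  shows resolvent_contraction_total: "Domain (resolvent (cayley_inverse (graph_on UNIV g) z0) z) = UNIV"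
    and resolvent_contraction_single: "single_valued (resolvent (cayley_inverse (graph_on UNIV g) z0) z)"
proof -
  let ?c = "cnj z0 - z" and ?\<zeta> = "disc_map z0 z"
  have c: "?c \<noteq> 0" using half_plane_neq_cnj[OF z] by auto
  have iff: "(z0 - z) *\<^sub>C g u - ?c *\<^sub>C u = x \<longleftrightarrow> u = (- inverse ?c) *\<^sub>C x + ?\<zeta> *\<^sub>C g u" for u x
  proof -
    have "(z0 - z) *\<^sub>C g u = ?c *\<^sub>C ?\<zeta> *\<^sub>C g u" by (simp add: scaleC_scaleC disc_map_mult[OF z])
    then have "(z0 - z) *\<^sub>C g u - ?c *\<^sub>C u = x \<longleftrightarrow> ?c *\<^sub>C (?\<zeta> *\<^sub>C g u - u) = x"
      by (simp only: scaleC_diff_right)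
    also have "\<dots> \<longleftrightarrow> ?\<zeta> *\<^sub>C g u - u = inverse ?c *\<^sub>C x"
      using c by (auto simp: scaleC_scaleC)
    also have "\<dots> \<longleftrightarrow> u = (- inverse ?c) *\<^sub>C x + ?\<zeta> *\<^sub>C g u"
      by (auto simp: algebra_simps)
    finally show ?thesis .
  qed
  have ex1: "\<exists>!u. (z0 - z) *\<^sub>C g u - ?c *\<^sub>C u = x" for x
    unfolding iff by (rule neumann_ex1[OF g norm_disc_map[OF z]])
  then show "Domain (resolvent (cayley_inverse (graph_on UNIV g) z0) z) = UNIV"
    unfolding resolvent_cayley_inverse by (auto simp: Domain_iff; metis)
  show "single_valued (resolvent (cayley_inverse (graph_on UNIV g) z0) z)"
    unfolding resolvent_cayley_inverse using ex1 by (auto simp: single_valued_def; metis)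
qed

lemma total_single_valued_eqI:
  assumes "R \<subseteq> R'" "Domain R = UNIV" "single_valued R'" shows "R = R'"
  using assms unfolding single_valued_def by (auto simp: set_eq_iff Domain_iff) (metis subsetD)

text \<open>A totally defined \<open>R0\<close> determines its adjoint. This carries equality of
  resolvents from one half-plane to the other.\<close>

lemma adjoint_pairing_unique:
  fixes R0 R R' :: "('a::complex_hilbert, 'a) op_graph"
  assumes "Domain R0 = UNIV" "Domain R = UNIV" "Domain R' = UNIV"
    and R: "\<And>x p y q. (x, p) \<in> R0 \<Longrightarrow> (y, q) \<in> R \<Longrightarrow> cinner p y = cinner x q"
    and R': "\<And>x p y q. (x, p) \<in> R0 \<Longrightarrow> (y, q) \<in> R' \<Longrightarrow> cinner p y = cinner x q"
  shows "R = R'"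
proof -
  have eq: "q = q'" if "(y, q) \<in> R" "(y, q') \<in> R'" for y q q'
  proof (rule cinner_eqI)
    fix x
    obtain p where "(x, p) \<in> R0" using assms(1) by blast
    then have "cinner x q = cinner x q'" using R R' that by metis
    then show "cinner q x = cinner q' x" by (metis cinner_commute)
  qed
  show ?thesis
  proof (intro equalityI subrelI)
    fix y q assume "(y, q) \<in> R"
    moreover obtain q' where "(y, q') \<in> R'" using assms(3) by blast
    ultimately show "(y, q) \<in> R'" using eq by blast
  next
    fix y q assume "(y, q) \<in> R'"
    moreover obtain q' where "(y, q') \<in> R" using assms(2) by blast
    ultimately show "(y, q) \<in> R" using eq by blast
  qed
qed

lemma resolvent_adjoint_pairing:
  assumes adj: "\<And>x y. cinner (g x) y = cinner x (g' y)"
    and "(x, p) \<in> resolvent (cayley_inverse (graph_on UNIV g) z0) (cnj z)"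
    and "(y, q) \<in> resolvent (cayley_inverse (graph_on UNIV g') (cnj z0)) z"
  shows "cinner p y = cinner x q"
proof -
  obtain u where u: "x = (z0 - cnj z) *\<^sub>C g u - (cnj z0 - cnj z) *\<^sub>C u" "p = g u - u"
    using assms(2) unfolding resolvent_cayley_inverse by auto
  obtain v where v: "y = (cnj z0 - z) *\<^sub>C g' v - (z0 - z) *\<^sub>C v" "q = g' v - v"
    using assms(3) unfolding resolvent_cayley_inverse by auto
  show ?thesis
    unfolding u v by (simp add: cinner_algebra adj) (simp add: algebra_simps)
qed

lemma compression_single_valued:
  assumes V: "isometric_embedding V" and S: "single_valued R"
  shows "single_valued (compression V R)"
proof (rule single_valuedI)
  fix x p p' assume "(x, p) \<in> compression V R" "(x, p') \<in> compression V R"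
  then obtain k where k: "\<And>g. cinner (k - V p) (V g) = 0" "\<And>g. cinner (k - V p') (V g) = 0"
    using S unfolding compression_def single_valued_def by blast
  have "cinner (V p - V p') (V g) = 0" for g
    using k[of g] by (simp add: cinner_algebra)
  then have "cinner p g = cinner p' g" for g
    by (simp add: cinner_algebra isometric_cinner[OF V])
  then show "p = p'" by (rule cinner_eqI)
qed

lemma compression_adjoint_pairing:
  assumes sym: "\<And>f f' g g'. (f, f') \<in> B \<Longrightarrow> (g, g') \<in> B \<Longrightarrow> cinner f' g = cinner f g'"
    and x: "(x, p) \<in> compression V (resolvent B (cnj z))" and y: "(y, q) \<in> compression V (resolvent B z)"
    and V: "isometric_embedding V"
  shows "cinner p y = cinner x q"
proof -
  obtain k a where k: "(k, a) \<in> B" "V x = a - cnj z *\<^sub>C k" "\<And>g. cinner (k - V p) (V g) = 0"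
    using x by (auto simp: compression_def resolvent_def add_scalar_def)
  obtain l b where l: "(l, b) \<in> B" "V y = b - z *\<^sub>C l" "\<And>g. cinner (l - V q) (V g) = 0"
    using y by (auto simp: compression_def resolvent_def add_scalar_def)
  have "cinner p y = cinner k (V y)"
    using k(3)[of y] by (simp add: cinner_algebra isometric_cinner[OF V])
  also have "\<dots> = cinner (V x) l"
    using sym[OF k(1) l(1)] by (simp add: k(2) l(2) cinner_algebra)
  also have "\<dots> = cinner x q"
  proof -
    have "cinner (V x) (l - V q) = 0" using l(3)[of x] by (simp add: cinner_eq_zero_commute)
    then show ?thesis by (simp add: cinner_algebra isometric_cinner[OF V])
  qed
  finally show ?thesis .
qed

section \<open>Compressed resolvents in both half-planes\<close>

context unitary_dilation
begin

lemma resolvent_charfun: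
  assumes z: "z \<in> half_plane z0"
  shows "compression V (resolvent (cayley_inverse (graph_on UNIV S) z0) z)
    = resolvent (cayley_inverse (graph_on UNIV (charfun (disc_map z0 z))) z0) z"
proof (rule sym, rule total_single_valued_eqI)
  let ?\<zeta> = "disc_map z0 z"
  note \<zeta> = norm_disc_map[OF z]
  show "Domain (resolvent (cayley_inverse (graph_on UNIV (charfun ?\<zeta>)) z0) z) = UNIV"
    by (rule resolvent_contraction_total[OF contraction_charfun[OF \<zeta>] z])
  show "single_valued (compression V (resolvent (cayley_inverse (graph_on UNIV S) z0) z))"
    by (rule compression_single_valued[OF V resolvent_contraction_single[OF contraction_S z]])
  show "resolvent (cayley_inverse (graph_on UNIV (charfun ?\<zeta>)) z0) z
    \<subseteq> compression V (resolvent (cayley_inverse (graph_on UNIV S) z0) z)"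
  proof (rule subrelI)
    fix y p assume "(y, p) \<in> resolvent (cayley_inverse (graph_on UNIV (charfun ?\<zeta>)) z0) z"
    then obtain x where x: "y = (z0 - z) *\<^sub>C charfun ?\<zeta> x - (cnj z0 - z) *\<^sub>C x" "p = charfun ?\<zeta> x - x"
      unfolding resolvent_cayley_inverse by auto
    \<comment> \<open>At this \<open>u\<close> the state cancels in
      \<open>(z0 - z) *\<^sub>C S u - (cnj z0 - z) *\<^sub>C u\<close>: by
      \<open>disc_map_mult\<close>, \<open>disc_map z0 z\<close> is exactly the cancelling
      ratio.\<close>
    define u where "u = V x + ?\<zeta> *\<^sub>C state ?\<zeta> x"
    have Su: "S u = V (charfun ?\<zeta> x) + state ?\<zeta> x" unfolding u_def by (rule unitary_state[OF \<zeta>])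
    note lin = linV
    have "(z0 - z) *\<^sub>C S u - (cnj z0 - z) *\<^sub>C u = V y"
      unfolding Su x(1) unfolding u_def
      by (simp add: clinear_diff[OF lin] clinear_scaleC[OF lin] scaleC_add_right scaleC_scaleC disc_map_mult[OF z])
    then have "(V y, S u - u) \<in> resolvent (cayley_inverse (graph_on UNIV S) z0) z"
      unfolding resolvent_cayley_inverse by (auto intro!: exI[of _ u])
    moreover have "S u - u - V p = (1 - ?\<zeta>) *\<^sub>C state ?\<zeta> x"
      unfolding Su x(2) unfolding u_def by (simp add: clinear_diff[OF lin] scaleC_algebra)
    then have "cinner (S u - u - V p) (V g) = 0" for g
      by (simp add: cinner_scaleC_left state_orth[OF \<zeta>])
    ultimately show "(y, p) \<in> compression V (resolvent (cayley_inverse (graph_on UNIV S) z0) z)"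
      unfolding compression_def by blast
  qed
qed

text \<open>Replacing \<open>S\<close> by its inverse exchanges u and S u, and so does conjugating
  \<open>z0\<close>; the two exchanges cancel. So the same relation is available with a base point
  in either half-plane.\<close>

lemma cayley_inverse_inv:
  "cayley_inverse (graph_on UNIV (inv S)) (cnj z0) = cayley_inverse (graph_on UNIV S) z0"
proof -
  note lin = linS
    and lin' = isometric_clinear[OF isometric_inv[OF S surj]]
  have i: "S (inv S x) = x" "inv S (S x) = x" for x
    using surj by (auto simp: surj_f_inv_f inj_def isometric_eq_iff[OF S])
  \<comment> \<open>The minus sign in the witness repairs the orientation: the exchange alone would
    turn w - u into u - w.\<close>
  have "\<exists>v. inv S u - u = S v - v \<and> cnj z0 *\<^sub>C inv S u - z0 *\<^sub>C u = z0 *\<^sub>C S v - cnj z0 *\<^sub>C v" for u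
    by (rule exI[of _ "- inv S u"]) (simp add: clinear_minus[OF lin] i)
  moreover have "\<exists>v. S u - u = inv S v - v \<and> z0 *\<^sub>C S u - cnj z0 *\<^sub>C u = cnj z0 *\<^sub>C inv S v - z0 *\<^sub>C v" for u
    by (rule exI[of _ "- S u"]) (simp add: clinear_minus[OF lin'] i)
  ultimately show ?thesis unfolding cayley_inverse_def by (auto; metis)
qed

lemma cayley_inverse_symmetric:
  assumes "(f, f') \<in> cayley_inverse (graph_on UNIV S) z0" "(g, g') \<in> cayley_inverse (graph_on UNIV S) z0"
  shows "cinner f' g = cinner f g'"
proof -
  obtain u where u: "f = S u - u" "f' = z0 *\<^sub>C S u - cnj z0 *\<^sub>C u"
    using assms(1) unfolding cayley_inverse_def by auto
  obtain v where v: "g = S v - v" "g' = z0 *\<^sub>C S v - cnj z0 *\<^sub>C v"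
    using assms(2) unfolding cayley_inverse_def by auto
  show ?thesis
    unfolding u v by (simp add: cinner_algebra cinner_S) (simp add: algebra_simps)
qed

text \<open>Both sides are adjoint to the resolvent at \<open>cnj z\<close>, which
  \<open>resolvent_charfun\<close> describes, hence they agree. Totality of the compression comes
  from \<open>inv S\<close>, whose base point \<open>cnj z0\<close> lies in the half-plane of
  \<open>z\<close>.\<close>

lemma resolvent_charfun_adjoint:
  assumes z: "z \<in> half_plane (cnj z0)" and g: "contraction g"
    and adj: "\<And>x y. cinner (charfun (disc_map z0 (cnj z)) x) y = cinner x (g y)"
  shows "compression V (resolvent (cayley_inverse (graph_on UNIV S) z0) z)
    = resolvent (cayley_inverse (graph_on UNIV g) (cnj z0)) z"
proof (rule adjoint_pairing_unique)
  have z': "cnj z \<in> half_plane z0" using z by simp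
  let ?R0 = "resolvent (cayley_inverse (graph_on UNIV (charfun (disc_map z0 (cnj z)))) z0) (cnj z)"
  show "Domain ?R0 = UNIV"
    by (rule resolvent_contraction_total[OF contraction_charfun[OF norm_disc_map[OF z']] z'])
  show "Domain (resolvent (cayley_inverse (graph_on UNIV g) (cnj z0)) z) = UNIV"
    by (rule resolvent_contraction_total[OF g z])
  interpret inv: unitary_dilation V "inv S"
  proof
    show "isometric_embedding (inv S)" by (rule isometric_inv[OF S surj])
    show "surj (inv S)" using isometric_eq_iff[OF S] by (metis inj_def inj_imp_surj_inv)
  qed (rule V)
  show "Domain (compression V (resolvent (cayley_inverse (graph_on UNIV S) z0) z)) = UNIV"
    unfolding cayley_inverse_inv[symmetric] inv.resolvent_charfun[OF z]
    by (rule resolvent_contraction_total[OF inv.contraction_charfun[OF norm_disc_map[OF z]] z])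
  fix x p y q assume 0: "(x, p) \<in> ?R0"
  show "cinner p y = cinner x q" if "(y, q) \<in> resolvent (cayley_inverse (graph_on UNIV g) (cnj z0)) z"
    by (rule resolvent_adjoint_pairing[OF adj 0 that])
  show "cinner p y = cinner x q" if "(y, q) \<in> compression V (resolvent (cayley_inverse (graph_on UNIV S) z0) z)"
    by (rule compression_adjoint_pairing[OF _ 0[unfolded resolvent_charfun[OF z', symmetric]] that V])
      (rule cayley_inverse_symmetric)
qed

end

section \<open>The Cayley transform of a closed symmetric operator\<close>

lemma range_at_eq: "range_at A z = {f' - z *\<^sub>C f | f f'. (f, f') \<in> A}"
  unfolding range_at_def add_scalar_def by (auto simp: Range_iff; metis)

lemma defect_space_orth: "defect_space A z = orth (range_at A z)"
  by (simp add: defect_space_def orth_def)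

definition cayley_map :: "('a::complex_hilbert, 'a) op_graph \<Rightarrow> complex \<Rightarrow> 'a \<Rightarrow> 'a" where
  "cayley_map A z m = (THE w. (m, w) \<in> cayley A z)"

definition cayley_extension ::
  "('a::complex_hilbert, 'a) op_graph \<Rightarrow> complex \<Rightarrow> ('a \<Rightarrow> 'a) \<Rightarrow> 'a \<Rightarrow> 'a" where
  "cayley_extension A z T x =
    cayley_map A z (proj (range_at A z) x) + T (x - proj (range_at A z) x)"

locale closed_symmetric =
  fixes A :: "('h::complex_hilbert, 'h) op_graph" and z0 :: complex
  assumes sym: "symmetric_operator A" and closed: "closed A" and z0: "z0 \<notin> \<real>"
begin

lemma A_single: "(x, y) \<in> A \<Longrightarrow> (x, y') \<in> A \<Longrightarrow> y = y'"
  and A_zero: "(0, 0) \<in> A"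
  and A_add: "(x, x') \<in> A \<Longrightarrow> (y, y') \<in> A \<Longrightarrow> (x + y, x' + y') \<in> A"
  and A_scaleC: "(x, x') \<in> A \<Longrightarrow> (c *\<^sub>C x, c *\<^sub>C x') \<in> A"
  and A_sym: "(f, f') \<in> A \<Longrightarrow> (g, g') \<in> A \<Longrightarrow> cinner f' g = cinner f g'"
proof -
  have lin: "linear_operator A"
    and sy: "\<forall>f f' g g'. (f, f') \<in> A \<longrightarrow> (g, g') \<in> A \<longrightarrow> cinner f' g = cinner f g'"
    using sym unfolding symmetric_operator_def by (rule conjunct1, rule conjunct2)
  show "(f, f') \<in> A \<Longrightarrow> (g, g') \<in> A \<Longrightarrow> cinner f' g = cinner f g'" using sy by blast
  show "(x, y) \<in> A \<Longrightarrow> (x, y') \<in> A \<Longrightarrow> y = y'"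
    using lin unfolding linear_operator_def by (meson single_valuedD)
  show "(0, 0) \<in> A" "(x, x') \<in> A \<Longrightarrow> (y, y') \<in> A \<Longrightarrow> (x + y, x' + y') \<in> A"
    "(x, x') \<in> A \<Longrightarrow> (c *\<^sub>C x, c *\<^sub>C x') \<in> A"
    using lin unfolding linear_operator_def by simp_all
qed

lemma cayley_iff:
  "(m, w) \<in> cayley A z \<longleftrightarrow> (\<exists>f f'. (f, f') \<in> A \<and> m = f' - z *\<^sub>C f \<and> w = f' - cnj z *\<^sub>C f)"
proof
  assume "(m, w) \<in> cayley A z"
  then obtain f f' f'' where "(f, f') \<in> A" "(f, f'') \<in> A" "m = f' - z *\<^sub>C f" "w = f'' - cnj z *\<^sub>C f"
    by (auto simp: cayley_def resolvent_def add_scalar_def)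
  then show "\<exists>f f'. (f, f') \<in> A \<and> m = f' - z *\<^sub>C f \<and> w = f' - cnj z *\<^sub>C f"
    using A_single by blast
next
  assume "\<exists>f f'. (f, f') \<in> A \<and> m = f' - z *\<^sub>C f \<and> w = f' - cnj z *\<^sub>C f"
  then obtain f f' where f: "(f, f') \<in> A" "m = f' - z *\<^sub>C f" "w = f' - cnj z *\<^sub>C f" by blast
  then have "(m, f) \<in> resolvent A z" "(f, w) \<in> add_scalar A (- cnj z)"
    by (force simp: resolvent_def add_scalar_def)+
  then show "(m, w) \<in> cayley A z" unfolding cayley_def by blast
qed

lemma cayley_isometry:
  assumes "(m, w) \<in> cayley A z" "(m', w') \<in> cayley A z" shows "cinner w w' = cinner m m'"
proof -
  obtain f f' where f: "(f, f') \<in> A" "m = f' - z *\<^sub>C f" "w = f' - cnj z *\<^sub>C f"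
    using assms(1) unfolding cayley_iff by blast
  obtain g g' where g: "(g, g') \<in> A" "m' = g' - z *\<^sub>C g" "w' = g' - cnj z *\<^sub>C g"
    using assms(2) unfolding cayley_iff by blast
  show ?thesis
    unfolding f g by (simp add: cinner_algebra A_sym[OF f(1) g(1)]) (simp add: algebra_simps)
qed

lemma cayley_add:
  assumes "(m, w) \<in> cayley A z" "(m', w') \<in> cayley A z" shows "(m + m', w + w') \<in> cayley A z"
proof -
  obtain f f' where f: "(f, f') \<in> A" "m = f' - z *\<^sub>C f" "w = f' - cnj z *\<^sub>C f"
    using assms(1) unfolding cayley_iff by blast
  obtain g g' where g: "(g, g') \<in> A" "m' = g' - z *\<^sub>C g" "w' = g' - cnj z *\<^sub>C g"
    using assms(2) unfolding cayley_iff by blast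
  show ?thesis unfolding cayley_iff f g
    by (rule exI[of _ "f + g"], rule exI[of _ "f' + g'"])
      (simp add: A_add[OF f(1) g(1)] scaleC_algebra)
qed

lemma cayley_scaleC:
  assumes "(m, w) \<in> cayley A z" shows "(c *\<^sub>C m, c *\<^sub>C w) \<in> cayley A z"
proof -
  obtain f f' where f: "(f, f') \<in> A" "m = f' - z *\<^sub>C f" "w = f' - cnj z *\<^sub>C f"
    using assms(1) unfolding cayley_iff by blast
  show ?thesis unfolding cayley_iff f
    by (rule exI[of _ "c *\<^sub>C f"], rule exI[of _ "c *\<^sub>C f'"])
      (simp add: A_scaleC[OF f(1)] scaleC_algebra mult.commute)
qed

lemma cayley_diff:
  "(m, w) \<in> cayley A z \<Longrightarrow> (m', w') \<in> cayley A z \<Longrightarrow> (m - m', w - w') \<in> cayley A z"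
  using cayley_add[OF _ cayley_scaleC[of m' w' z "-1"], of m w] by simp

lemma cayley_norm: "(m, w) \<in> cayley A z \<Longrightarrow> norm w = norm m"
  using cayley_isometry[of m w z m w] by (simp add: cinner_self power2_eq_iff_nonneg flip: of_real_power)

lemma cayley_single: assumes "(m, w) \<in> cayley A z" "(m, w') \<in> cayley A z" shows "w = w'"
  using cayley_isometry[OF cayley_diff[OF assms] cayley_diff[OF assms]] by simp

lemma cayley_map_eq: "(m, w) \<in> cayley A z \<Longrightarrow> cayley_map A z m = w"
  unfolding cayley_map_def by (rule the_equality) (auto intro: cayley_single)

lemma range_at_iff: "m \<in> range_at A z \<longleftrightarrow> (\<exists>w. (m, w) \<in> cayley A z)"
  unfolding range_at_eq cayley_iff by blast

lemma cayley_converse: "(m, w) \<in> cayley A (cnj z) \<longleftrightarrow> (w, m) \<in> cayley A z"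
  unfolding cayley_iff by auto

lemma cayley_map: "m \<in> range_at A z \<Longrightarrow> (m, cayley_map A z m) \<in> cayley A z"
  unfolding range_at_iff using cayley_map_eq by auto

lemma cayley_map_mem: "m \<in> range_at A z \<Longrightarrow> cayley_map A z m \<in> range_at A (cnj z)"
  using cayley_map cayley_converse range_at_iff by blast

lemma csubspace_range_at: "csubspace (range_at A z)"
proof -
  have "(0, 0) \<in> cayley A z" unfolding cayley_iff by (intro exI[of _ 0]) (simp add: A_zero)
  then show ?thesis
    unfolding csubspace_def Ball_def range_at_iff by (meson cayley_add cayley_scaleC)
qed

text \<open>The Cayley graph is the preimage of \<open>A\<close> under the continuous linear map
  that recovers (f, f') from (m, w), hence closed; being isometric, it has a closed domain.\<close>

lemma closed_range_at: assumes z: "z \<notin> \<real>" shows "closed (range_at A z)"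
proof -
  let ?c = "inverse (z - cnj z)"
  let ?f = "\<lambda>p :: 'h \<times> 'h. ?c *\<^sub>C (snd p - fst p)"
  let ?g = "\<lambda>p. (?f p, fst p + z *\<^sub>C ?f p)"
  have c: "z - cnj z \<noteq> 0" by (rule not_Reals_diff_cnj[OF z])
  have "p \<in> cayley A z \<longleftrightarrow> ?g p \<in> A" for p
  proof
    assume "p \<in> cayley A z"
    then obtain f f' where f: "(f, f') \<in> A" "p = (f' - z *\<^sub>C f, f' - cnj z *\<^sub>C f)"
      by (cases p) (auto simp: cayley_iff)
    have "?f p = ?c *\<^sub>C (z - cnj z) *\<^sub>C f" by (simp add: f(2) scaleC_diff_left)
    then have "?f p = f" using c by (simp add: scaleC_scaleC)
    then show "?g p \<in> A" using f by simp
  next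
    assume p: "?g p \<in> A"
    have "(z - cnj z) *\<^sub>C ?f p = snd p - fst p" using c by (simp add: scaleC_scaleC)
    then have "fst p = (fst p + z *\<^sub>C ?f p) - z *\<^sub>C ?f p" "snd p = (fst p + z *\<^sub>C ?f p) - cnj z *\<^sub>C ?f p"
      by (simp_all add: scaleC_diff_left algebra_simps)
    with p have "(fst p, snd p) \<in> cayley A z" unfolding cayley_iff by blast
    then show "p \<in> cayley A z" by simp
  qed
  then have "cayley A z = ?g -` A" by auto
  also have "closed (?g -` A)"
    by (intro closed_vimage closed continuous_on_Pair continuous_on_scaleC continuous_intros)
  finally have "closed (Domain (cayley A z))"
    by (rule closed_Domain_isometric) (rule cayley_norm[OF cayley_diff])
  moreover have "Domain (cayley A z) = range_at A z" using range_at_iff by blast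
  ultimately show ?thesis by simp
qed

abbreviation "M \<equiv> range_at A z0"
abbreviation "M' \<equiv> range_at A (cnj z0)"
abbreviation "N \<equiv> defect_space A z0"
abbreviation "N' \<equiv> defect_space A (cnj z0)"
abbreviation "U \<equiv> cayley_map A z0"
abbreviation "P \<equiv> proj M"

lemma cnj_z0: "cnj z0 \<notin> \<real>" using z0 by (simp add: complex_is_Real_iff)

lemmas M_props = closed_range_at[OF z0] csubspace_range_at[of z0]
lemmas M'_props = closed_range_at[OF cnj_z0] csubspace_range_at[of "cnj z0"]

lemma P_mem: "P x \<in> M" and P_defect: "x - P x \<in> N"
  using proj_mem[OF M_props] proj_orth[OF M_props] by (simp_all add: defect_space_orth)

lemma clinear_P: "clinear P"
  using contraction_clinear[OF contraction_proj[OF M_props]] .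

lemma P_add: "m \<in> M \<Longrightarrow> \<psi> \<in> N \<Longrightarrow> P (m + \<psi>) = m"
  by (rule proj_eqI[OF M_props]) (simp_all add: defect_space_orth)

lemma csubspace_defect: "csubspace (defect_space A z)"
  unfolding defect_space_orth by (rule csubspace_orth)

lemma U_add: "m \<in> M \<Longrightarrow> m' \<in> M \<Longrightarrow> U (m + m') = U m + U m'"
  and U_scaleC: "m \<in> M \<Longrightarrow> U (c *\<^sub>C m) = c *\<^sub>C U m"
  and U_cinner: "m \<in> M \<Longrightarrow> m' \<in> M \<Longrightarrow> cinner (U m) (U m') = cinner m m'"
  by (auto intro: cayley_map_eq cayley_add cayley_scaleC cayley_map cayley_isometry)

lemma U_norm: "m \<in> M \<Longrightarrow> norm (U m) = norm m"
  using U_cinner[of m m] by (simp add: cinner_self power2_eq_iff_nonneg flip: of_real_power)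

lemma op_sum_cayley_graph:
  "op_sum (cayley A z0) (graph_on N T) = graph_on UNIV (cayley_extension A z0 T)"
proof (intro equalityI subrelI)
  fix x w assume "(x, w) \<in> op_sum (cayley A z0) (graph_on N T)"
  then obtain m m' \<psi> where m: "(m, m') \<in> cayley A z0" and \<psi>: "\<psi> \<in> N" "x = m + \<psi>" "w = m' + T \<psi>"
    by (auto simp: op_sum_def graph_on_def)
  have "P x = m" using P_add[OF _ \<psi>(1)] m \<psi>(2) range_at_iff by blast
  then show "(x, w) \<in> graph_on UNIV (cayley_extension A z0 T)"
    using \<psi> cayley_map_eq[OF m] by (simp add: cayley_extension_def)
next
  fix x w assume "(x, w) \<in> graph_on UNIV (cayley_extension A z0 T)"
  then have w: "w = U (P x) + T (x - P x)" by (simp add: cayley_extension_def)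
  have "(P x + (x - P x), U (P x) + T (x - P x)) \<in> op_sum (cayley A z0) (graph_on N T)"
    unfolding op_sum_def graph_on_def using cayley_map[OF P_mem] P_defect by blast
  then show "(x, w) \<in> op_sum (cayley A z0) (graph_on N T)" by (simp add: w)
qed

lemma cayley_extension_range: "m \<in> M \<Longrightarrow> contraction_between N N' T \<Longrightarrow> cayley_extension A z0 T m = U m"
  unfolding cayley_extension_def contraction_between_def
  using proj_id[OF M_props, of m] csubspace_zero[OF csubspace_defect, of z0]
  by (metis add.right_neutral diff_self scaleC_zero_left)

lemma U_zero: "U 0 = 0"
  using U_scaleC[of 0 0] csubspace_zero[OF M_props(2)] by simp

lemma cayley_extension_defect: "\<psi> \<in> N \<Longrightarrow> cayley_extension A z0 T \<psi> = T \<psi>"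
  using proj_zero[OF M_props, of \<psi>] by (simp add: cayley_extension_def defect_space_orth U_zero)

lemma contraction_cayley_extension:
  assumes T: "contraction_between N N' T" shows "contraction (cayley_extension A z0 T)"
  unfolding contraction_def clinear_def
proof (intro conjI allI)
  fix x y c
  have "x + y - P (x + y) = (x - P x) + (y - P y)" by (simp add: clinear_add[OF clinear_P])
  then have "T (x + y - P (x + y)) = T (x - P x) + T (y - P y)"
    using T P_defect by (simp only: contraction_between_def)
  then show "cayley_extension A z0 T (x + y) = cayley_extension A z0 T x + cayley_extension A z0 T y"
    unfolding cayley_extension_def
    by (simp only: U_add[OF P_mem P_mem] clinear_add[OF clinear_P]) (simp add: algebra_simps)
  have "T (c *\<^sub>C (x - P x)) = c *\<^sub>C T (x - P x)"
    using T P_defect by (simp add: contraction_between_def)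
  moreover have "c *\<^sub>C x - P (c *\<^sub>C x) = c *\<^sub>C (x - P x)"
    by (simp add: clinear_scaleC[OF clinear_P] scaleC_diff_right)
  ultimately show "cayley_extension A z0 T (c *\<^sub>C x) = c *\<^sub>C cayley_extension A z0 T x"
    unfolding cayley_extension_def by (simp add: clinear_scaleC[OF clinear_P] U_scaleC P_mem scaleC_add_right)
  show "norm (cayley_extension A z0 T x) \<le> norm x"
  proof (rule power2_le_imp_le)
    have "T (x - P x) \<in> N'" "norm (T (x - P x)) \<le> norm (x - P x)"
      using T P_defect by (auto simp: contraction_between_def)
    then have "(norm (cayley_extension A z0 T x))\<^sup>2 = (norm (U (P x)))\<^sup>2 + (norm (T (x - P x)))\<^sup>2"
      unfolding cayley_extension_def
      by (intro pythagoras) (auto simp: defect_space_orth intro!: orth_cinner' cayley_map_mem P_mem)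
    also have "\<dots> \<le> (norm (P x))\<^sup>2 + (norm (x - P x))\<^sup>2"
      using \<open>norm (T (x - P x)) \<le> _\<close> by (intro add_mono power_mono) (simp_all add: U_norm P_mem)
    also have "\<dots> = (norm (P x + (x - P x)))\<^sup>2"
      using P_defect P_mem by (intro pythagoras[symmetric]) (auto simp: defect_space_orth intro: orth_cinner')
    finally show "(norm (cayley_extension A z0 T x))\<^sup>2 \<le> (norm x)\<^sup>2" by simp
  qed simp
qed

text \<open>The Cayley transform at \<open>cnj z0\<close> inverts the isometry \<open>U\<close> of
  \<open>M\<close> onto \<open>M'\<close>, hence is its adjoint; adding the adjoint of
  \<open>T\<close> gives the adjoint of the orthogonal sum.\<close>

lemma op_sum_cayley_adjoint:
  assumes T: "contraction_between N N' T"
    and adj: "\<And>x y. cinner (cayley_extension A z0 T x) y = cinner x (g y)"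
  shows "op_sum (cayley A (cnj z0)) (adjoint_between N N' T) = graph_on UNIV g"
proof -
  have sub: "v = g u" if uv: "(u, v) \<in> op_sum (cayley A (cnj z0)) (adjoint_between N N' T)" for u v
  proof -
    obtain m m' y x where m: "(m, m') \<in> cayley A z0" and "u = m' + y" "v = m + x"
      and yx: "(y, x) \<in> adjoint_between N N' T"
      using uv by (auto simp: op_sum_def cayley_converse)
    have mM: "m \<in> M" "m' \<in> M'" "m' = U m"
      using m cayley_map_eq[OF m] by (auto simp: range_at_iff cayley_converse)
    have y: "y \<in> N'" "x \<in> N" "\<And>b. b \<in> N \<Longrightarrow> cinner (T b) y = cinner b x"
      using yx by (auto simp: adjoint_between_def)
    have "cinner a v = cinner a (g u)" for a
    proof -
      have Ta: "T (a - P a) \<in> N'" using T P_defect by (simp add: contraction_between_def)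
      have o: "cinner (U (P a)) y = 0" "cinner (T (a - P a)) m' = 0"
          "cinner (P a) x = 0" "cinner (a - P a) m = 0"
        using y mM Ta P_mem[of a] P_defect[of a] cayley_map_mem[OF P_mem[of a]]
        by (auto simp: defect_space_orth intro: orth_cinner orth_cinner')
      have "cinner a (g u) = cinner (U (P a) + T (a - P a)) (m' + y)"
        by (simp add: adj[symmetric] cayley_extension_def \<open>u = _\<close>)
      also have "\<dots> = cinner (U (P a)) (U m) + cinner (T (a - P a)) y"
        using o by (simp add: cinner_add_left cinner_add_right mM(3)[symmetric])
      also have "\<dots> = cinner (P a) m + cinner (a - P a) x"
        by (simp add: U_cinner P_mem mM(1) y(3)[OF P_defect])
      also have "\<dots> = cinner (P a + (a - P a)) (m + x)"
        using o by (simp only: cinner_add_left cinner_add_right) simp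
      finally show ?thesis by (simp add: \<open>v = _\<close>)
    qed
    then show "v = g u" by (metis cinner_eqI cinner_commute)
  qed
  show ?thesis
  proof (intro equalityI subrelI)
    fix u v assume "(u, v) \<in> op_sum (cayley A (cnj z0)) (adjoint_between N N' T)"
    then show "(u, v) \<in> graph_on UNIV g" using sub by simp
  next
    fix u v assume "(u, v) \<in> graph_on UNIV g"
    then have v: "v = g u" by simp
    define m' where "m' = proj M' u"
    define y where "y = u - m'"
    have m': "m' \<in> M'" and y: "y \<in> N'"
      unfolding m'_def y_def defect_space_orth using proj_mem[OF M'_props] proj_orth[OF M'_props] by auto
    \<comment> \<open>The product of \<open>a\<close> in \<open>M\<close> with \<open>g y\<close> is
      that of \<open>U a\<close> with \<open>y\<close>, and \<open>U a\<close> lies in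
      \<open>M'\<close>.\<close>
    have "g y \<in> N"
      unfolding defect_space_orth orth_def
    proof safe
      fix a assume a: "a \<in> M"
      have "cinner a (g y) = cinner (U a) y"
        unfolding adj[symmetric] cayley_extension_range[OF a T] ..
      also have "\<dots> = 0"
        using y cayley_map_mem[OF a] by (auto simp: defect_space_orth intro: orth_cinner')
      finally show "cinner (g y) a = 0" by (simp add: cinner_eq_zero_commute)
    qed
    moreover have "cinner (T b) y = cinner b (g y)" if "b \<in> N" for b
      using adj[of b y] by (simp add: cayley_extension_defect[OF that])
    ultimately have "(y, g y) \<in> adjoint_between N N' T"
      using y by (auto simp: adjoint_between_def)
    then have "(m' + y, cayley_map A (cnj z0) m' + g y) \<in> op_sum (cayley A (cnj z0)) (adjoint_between N N' T)"
      unfolding op_sum_def using cayley_map[OF m'] by blast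
    then have "(u, cayley_map A (cnj z0) m' + g y) \<in> op_sum (cayley A (cnj z0)) (adjoint_between N N' T)"
      by (simp add: y_def)
    with sub[OF this] v show "(u, v) \<in> op_sum (cayley A (cnj z0)) (adjoint_between N N' T)" by simp
  qed
qed

lemma shtraus_resolvent_upper:
  assumes "z \<in> half_plane z0"
  shows "shtraus_resolvent A z0 F z
    = resolvent (cayley_inverse (graph_on UNIV (cayley_extension A z0 (F z))) z0) z"
  using assms by (simp add: shtraus_resolvent_def quasi_selfadjoint_ext_eq op_sum_cayley_graph)

lemma shtraus_resolvent_lower:
  assumes "z \<in> half_plane (cnj z0)" "contraction_between N N' (F (cnj z))"
    and "\<And>x y. cinner (cayley_extension A z0 (F (cnj z)) x) y = cinner x (g y)"
  shows "shtraus_resolvent A z0 F z = resolvent (cayley_inverse (graph_on UNIV g) (cnj z0)) z"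
proof -
  have "z \<notin> half_plane z0" using assms(1) by (auto simp: half_plane_def)
  then show ?thesis
    using op_sum_cayley_adjoint[OF assms(2,3)]
    by (simp add: shtraus_resolvent_def quasi_selfadjoint_ext_eq)
qed

theorem shtraus_resolvent_inj:
  assumes z: "z \<in> half_plane z0" and \<psi>: "\<psi> \<in> N" and "F z \<psi> \<noteq> G z \<psi>"
  shows "shtraus_resolvent A z0 F z \<noteq> shtraus_resolvent A z0 G z"
proof
  assume "shtraus_resolvent A z0 F z = shtraus_resolvent A z0 G z"
  then have "graph_on UNIV (cayley_extension A z0 (F z)) = graph_on UNIV (cayley_extension A z0 (G z))"
    unfolding shtraus_resolvent_upper[OF z] by (rule resolvent_cayley_inverse_inj[OF z0])
  then have "cayley_extension A z0 (F z) \<psi> = cayley_extension A z0 (G z) \<psi>"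
    by (metis graph_on_UNIV_iff)
  then show False using assms(3) by (simp add: cayley_extension_defect[OF \<psi>])
qed

text \<open>A contraction that is isometric on \<open>M\<close> respects orthogonality to
  \<open>M\<close>: its adjoint inverts it there, so for \<psi> in \<open>N\<close> the vector
  \<open>W \<psi>\<close> is orthogonal to \<open>M'\<close>, the image of \<open>M\<close> under
  \<open>U\<close>.\<close>

lemma contraction_extending_cayley:
  assumes W: "contraction W" and WU: "\<And>m. m \<in> M \<Longrightarrow> W m = U m"
  shows "contraction_between N N' W" and "cayley_extension A z0 W = W"
proof -
  note lin = contraction_clinear[OF W]
  obtain W' where W': "contraction W'" "\<And>x y. cinner (W x) y = cinner x (W' y)"
    using contraction_adjoint[OF W] by blast
  \<comment> \<open>The equality case of Cauchy-Schwarz: the product of \<open>W' (U m)\<close> with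
    \<open>m\<close> is the squared norm of \<open>m\<close>, while \<open>W' (U m)\<close> is no
    longer than \<open>m\<close>.\<close>
  have W'_U: "W' (U m) = m" if m: "m \<in> M" for m
  proof -
    have "cinner (W' (U m)) m = cinner (U m) (W m)"
      using W'(2)[of m "U m"] by (metis cinner_commute)
    then have "Re (cinner (W' (U m)) m) = (norm m)\<^sup>2"
      by (simp add: WU[OF m] U_cinner[OF m m] norm_sq_cinner)
    moreover have "(norm (W' (U m)))\<^sup>2 \<le> (norm m)\<^sup>2"
      using contraction_norm[OF W'(1), of "U m"] by (intro power_mono) (simp_all add: U_norm[OF m])
    ultimately have "(norm (W' (U m) - m))\<^sup>2 \<le> 0" by (simp add: norm_diff_sq)
    then show ?thesis by simp
  qed
  have "W \<psi> \<in> N'" if \<psi>: "\<psi> \<in> N" for \<psi>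
    unfolding defect_space_orth orth_def
  proof safe
    fix m' assume "m' \<in> M'"
    then obtain m where "(m', m) \<in> cayley A (cnj z0)" using range_at_iff by blast
    then have m: "m \<in> M" "m' = U m" by (auto simp: cayley_converse range_at_iff cayley_map_eq)
    have "cinner (W \<psi>) m' = cinner \<psi> m" by (simp add: W'(2) m(2) W'_U[OF m(1)])
    also have "\<dots> = 0" using \<psi> m(1) by (auto simp: defect_space_orth intro: orth_cinner)
    finally show "cinner (W \<psi>) m' = 0" .
  qed
  then show "contraction_between N N' W"
    using contraction_norm[OF W] lin by (simp add: contraction_between_def clinear_def)
  show "cayley_extension A z0 W = W"
  proof
    fix x
    have "W (P x + (x - P x)) = U (P x) + W (x - P x)"
      by (subst clinear_add[OF lin]) (simp add: WU[OF P_mem])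
    then show "cayley_extension A z0 W x = W x" by (simp add: cayley_extension_def)
  qed
qed

end

section \<open>Asymptotics in a sector\<close>

lemma sector_half_plane: "z \<in> sector z0 \<epsilon> \<Longrightarrow> z \<in> half_plane z0"
  by (simp add: sector_def)

lemma sector_Im:
  assumes "z \<in> sector z0 \<epsilon>" "0 < \<epsilon>" "\<epsilon> < pi / 2"
  shows "sin \<epsilon> * cmod z \<le> \<bar>Im z\<bar>"
proof -
  let ?a = "\<bar>Arg z\<bar>"
  have a: "\<epsilon> < ?a" "?a < pi - \<epsilon>" using assms(1) by (auto simp: sector_def)
  have "sin \<epsilon> \<le> sin ?a"
  proof (cases "?a \<le> pi / 2")
    case True
    then show ?thesis using a assms by (subst sin_mono_le_eq) auto
  next
    case False
    then have "sin \<epsilon> \<le> sin (pi - ?a)" using a assms by (subst sin_mono_le_eq) auto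
    then show ?thesis by simp
  qed
  also have "sin ?a \<le> \<bar>sin (Arg z)\<bar>" by (cases "Arg z \<ge> 0") auto
  finally have "sin \<epsilon> * cmod z \<le> \<bar>sin (Arg z)\<bar> * cmod z" by (rule mult_right_mono) simp
  also have "\<dots> = \<bar>cmod z * sin (Arg z)\<bar>" by (simp add: abs_mult)
  also have "cmod z * sin (Arg z) = Im z"
    by (metis Im_rcis rcis_cmod_Arg)
  finally show ?thesis .
qed

lemma half_plane_abs: "z \<in> half_plane z0 \<Longrightarrow> Im z * Im z0 = \<bar>Im z\<bar> * \<bar>Im z0\<bar>"
  by (simp add: half_plane_def flip: abs_mult)

text \<open>From |z - cnj z0| \<le> 2 |z| and |Im z| \<ge> sin \<epsilon> |z|. Together with the
  energy identity it turns the second limit condition of admissibility into a bound on the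
  state.\<close>

lemma sector_defect_lower:
  assumes z: "z \<in> sector z0 \<epsilon>" and \<epsilon>: "0 < \<epsilon>" "\<epsilon> < pi / 2" and large: "cmod z0 \<le> cmod z"
  shows "sin \<epsilon> * \<bar>Im z0\<bar> \<le> cmod z * (1 - (cmod (disc_map z0 z))\<^sup>2)"
proof -
  note hp = sector_half_plane[OF z]
  let ?d = "cmod (z - cnj z0)"
  have d: "0 < ?d" using half_plane_neq_cnj[OF hp] by simp
  have "?d \<le> 2 * cmod z"
    using norm_triangle_ineq4[of z "cnj z0"] large by simp
  then have "?d\<^sup>2 \<le> 4 * (cmod z)\<^sup>2"
    using power_mono[of ?d "2 * cmod z" 2] by (simp add: power_mult_distrib)
  then have "(sin \<epsilon> * \<bar>Im z0\<bar>) * ?d\<^sup>2 \<le> (sin \<epsilon> * \<bar>Im z0\<bar>) * (4 * (cmod z)\<^sup>2)"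
    using \<epsilon> by (intro mult_left_mono mult_nonneg_nonneg sin_ge_zero) auto
  also have "\<dots> = 4 * cmod z * ((sin \<epsilon> * cmod z) * \<bar>Im z0\<bar>)"
    by (simp add: power2_eq_square)
  also have "\<dots> \<le> 4 * cmod z * (\<bar>Im z\<bar> * \<bar>Im z0\<bar>)"
    using sector_Im[OF z \<epsilon>] by (intro mult_left_mono mult_right_mono) auto
  finally show ?thesis
    unfolding disc_map_defect[OF hp] half_plane_abs[OF hp] using d by (simp add: field_simps)
qed

text \<open>The 16 is 4 times the square of 2, from |z| \<le> 2 |z - cnj z0|. This direction turns a
  bounded state into a finite lower limit.\<close>

lemma sector_defect_upper:
  assumes hp: "z \<in> half_plane z0" and large: "2 * cmod z0 \<le> cmod z"
  shows "cmod z * (1 - (cmod (disc_map z0 z))\<^sup>2) \<le> 16 * \<bar>Im z0\<bar>"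
proof -
  let ?d = "cmod (z - cnj z0)"
  have d: "0 < ?d" using half_plane_neq_cnj[OF hp] by simp
  have "cmod z \<le> 2 * ?d"
    using norm_triangle_ineq2[of z "cnj z0"] large by simp
  then have "(cmod z)\<^sup>2 \<le> 4 * ?d\<^sup>2"
    using power_mono[of "cmod z" "2 * ?d" 2] by (simp add: power_mult_distrib)
  then have "4 * (cmod z * cmod z * \<bar>Im z0\<bar>) \<le> 16 * \<bar>Im z0\<bar> * ?d\<^sup>2"
    using mult_right_mono[of "(cmod z)\<^sup>2" "4 * ?d\<^sup>2" "4 * \<bar>Im z0\<bar>"] by (simp add: power2_eq_square mult_ac)
  moreover have "cmod z * (\<bar>Im z\<bar> * \<bar>Im z0\<bar>) \<le> cmod z * (cmod z * \<bar>Im z0\<bar>)"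
    by (intro mult_left_mono mult_right_mono abs_Im_le_cmod) auto
  ultimately have "cmod z * (4 * (\<bar>Im z\<bar> * \<bar>Im z0\<bar>)) \<le> 16 * \<bar>Im z0\<bar> * ?d\<^sup>2"
    by (simp add: mult_ac)
  then show ?thesis
    unfolding disc_map_defect[OF hp] half_plane_abs[OF hp] using d by (simp add: field_simps)
qed

text \<open>The image of the sector is contained near 1 in a Stolz region: sin \<epsilon> |1 -
  \<zeta>| is at most 1 - |\<zeta>|^2, and the 2 bounds the factor 1 + |\<zeta>|.\<close>

lemma sector_nontangential:
  assumes z: "z \<in> sector z0 \<epsilon>" and \<epsilon>: "0 < \<epsilon>" "\<epsilon> < pi / 2" and large: "cmod z0 \<le> cmod z"
  shows "cmod (1 - disc_map z0 z) \<le> 2 / sin \<epsilon> * (1 - cmod (disc_map z0 z))"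
proof -
  note hp = sector_half_plane[OF z]
  let ?d = "cmod (z - cnj z0)" and ?r = "cmod (disc_map z0 z)"
  have d: "0 < ?d" using half_plane_neq_cnj[OF hp] by simp
  have s: "0 < sin \<epsilon>" using \<epsilon> by (intro sin_gt_zero) auto
  have "?d \<le> 2 * cmod z"
    using norm_triangle_ineq4[of z "cnj z0"] large by simp
  then have "sin \<epsilon> * ?d \<le> 2 * \<bar>Im z\<bar>"
    using mult_left_mono[of ?d "2 * cmod z" "sin \<epsilon>"] sector_Im[OF z \<epsilon>] s by linarith
  then have "sin \<epsilon> * ?d * (2 * \<bar>Im z0\<bar>) \<le> 2 * \<bar>Im z\<bar> * (2 * \<bar>Im z0\<bar>)"
    by (rule mult_right_mono) simp
  moreover have "cmod (z0 - cnj z0) = 2 * \<bar>Im z0\<bar>"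
  proof -
    have "z0 - cnj z0 = complex_of_real (2 * Im z0) * \<i>" by (simp add: complex_eq_iff)
    then show ?thesis by (simp add: norm_mult)
  qed
  ultimately have "sin \<epsilon> * cmod (1 - disc_map z0 z) \<le> 1 - ?r\<^sup>2"
    unfolding disc_map_defect[OF hp] half_plane_abs[OF hp] one_minus_disc_map[OF hp]
    using d by (simp add: norm_divide field_simps power2_eq_square)
  also have "\<dots> = (1 + ?r) * (1 - ?r)" by (simp add: power2_eq_square algebra_simps)
  also have "\<dots> \<le> 2 * (1 - ?r)"
    using norm_disc_map[OF hp] by (intro mult_right_mono) auto
  finally show ?thesis using s by (simp add: field_simps)
qed

lemma disc_map_tendsto: "((\<lambda>z. disc_map z0 z) \<longlongrightarrow> 1) at_infinity"
proof -
  have "((\<lambda>z. (z0 - cnj z0) / (z - cnj z0)) \<longlongrightarrow> 0) at_infinity"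
    by (intro tendsto_divide_0[OF tendsto_const])
      (use tendsto_add_filterlim_at_infinity'[OF filterlim_ident tendsto_const, of "- cnj z0"] in simp)
  from tendsto_diff[OF tendsto_const[of 1] this]
  have "((\<lambda>z. 1 - (z0 - cnj z0) / (z - cnj z0)) \<longlongrightarrow> 1) at_infinity" by simp
  moreover have "eventually (\<lambda>z. 1 - (z0 - cnj z0) / (z - cnj z0) = disc_map z0 z) at_infinity"
    unfolding eventually_at_infinity
  proof (intro exI allI impI)
    fix z assume "cmod z0 + 1 \<le> cmod z"
    then have "z - cnj z0 \<noteq> 0" by (auto dest: arg_cong[of _ _ cmod])
    then show "1 - (z0 - cnj z0) / (z - cnj z0) = disc_map z0 z"
      by (simp add: disc_map_def field_simps)
  qed
  ultimately show ?thesis by (rule Lim_transform_eventually)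
qed

lemma disc_map_deriv:
  assumes "z \<in> half_plane z0"
  shows "\<exists>d. (disc_map z0 has_field_derivative d) (at z)"
proof -
  have "((\<lambda>z. (z - z0) / (z - cnj z0)) has_field_derivative
      (1 * (z - cnj z0) - (z - z0) * 1) / ((z - cnj z0) * (z - cnj z0))) (at z)"
    using half_plane_neq_cnj[OF assms] by (intro DERIV_divide) (auto intro!: derivative_eq_intros)
  then show ?thesis unfolding disc_map_def[abs_def] by blast
qed

lemma open_half_plane: "open (half_plane z0)"
  unfolding half_plane_def by (intro open_Collect_less continuous_intros)

section \<open>Self-adjoint operators and unitary operators\<close>

lemma csubspace_closure: assumes sub: "csubspace S" shows "csubspace (closure S)"
  unfolding csubspace_def
proof (intro conjI ballI allI)
  show "0 \<in> closure S" using csubspace_zero[OF sub] closure_subset by blast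
  fix x c assume "x \<in> closure S"
  then obtain a where a: "\<forall>n. a n \<in> S" "a \<longlonglongrightarrow> x" by (auto simp: closure_sequential)
  show "c *\<^sub>C x \<in> closure S"
    unfolding closure_sequential
    by (intro exI[of _ "\<lambda>n. c *\<^sub>C a n"] conjI allI tendsto_scaleC tendsto_const a(2) csubspace_scaleC[OF sub] a(1)[rule_format])
  fix y assume "y \<in> closure S"
  then obtain b where b: "\<forall>n. b n \<in> S" "b \<longlonglongrightarrow> y" by (auto simp: closure_sequential)
  show "x + y \<in> closure S"
    unfolding closure_sequential
    by (intro exI[of _ "\<lambda>n. a n + b n"] conjI allI tendsto_add a(2) b(2) csubspace_add[OF sub] a(1)[rule_format] b(1)[rule_format])
qed

lemma closed_adjoint_graph: "closed (adjoint_graph B)"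
proof -
  have "adjoint_graph B = (\<Inter>(f, f')\<in>B. {p. cinner f' (fst p) = cinner f (snd p)})"
    by (auto simp: adjoint_graph_def)
  moreover have "closed {p :: 'a \<times> 'a. cinner f' (fst p) = cinner f (snd p)}" for f f' :: 'a
    by (intro closed_Collect_eq continuous_on_cinner continuous_intros)
  ultimately show ?thesis by (auto intro!: closed_INT)
qed

text \<open>A nonzero vector orthogonal to the range of B - z would be an eigenvector of the
  adjoint, that is of \<open>B\<close>, for the non-real eigenvalue \<open>cnj z\<close>, against
  symmetry. So the Cayley transform and its inverse are defined everywhere.\<close>

lemma selfadjoint_unitary:
  fixes B :: "('k::complex_hilbert, 'k) op_graph"
  assumes B: "selfadjoint_operator B" and z0: "z0 \<notin> \<real>"
  obtains S where "isometric_embedding S" "surj S" "B = cayley_inverse (graph_on UNIV S) z0"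
    "\<And>f f'. (f, f') \<in> B \<Longrightarrow> S (f' - z0 *\<^sub>C f) = f' - cnj z0 *\<^sub>C f"
proof -
  have adj: "adjoint_graph B = B" using B by (simp add: selfadjoint_operator_def)
  interpret closed_symmetric B z0
  proof
    have "cinner f' g = cinner f g'" if "(f, f') \<in> B" "(g, g') \<in> B" for f f' g g'
      using that adj unfolding adjoint_graph_def by blast
    then show "symmetric_operator B"
      using B by (simp add: symmetric_operator_def selfadjoint_operator_def)
    show "closed B" using closed_adjoint_graph[of B] by (simp add: adj)
  qed (rule z0)
  have range_UNIV: "range_at B z = UNIV" if z: "z \<notin> \<real>" for z
  proof (rule eq_UNIV_of_orth[OF closed_range_at[OF z] csubspace_range_at], safe)
    fix g assume g: "g \<in> orth (range_at B z)"
    have "cinner f' g = cinner f (cnj z *\<^sub>C g)" if "(f, f') \<in> B" for f f'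
    proof -
      have "cinner (f' - z *\<^sub>C f) g = 0"
        using that by (intro orth_cinner'[OF g]) (auto simp: range_at_eq)
      then show ?thesis by (simp add: cinner_algebra)
    qed
    then have "(g, cnj z *\<^sub>C g) \<in> adjoint_graph B" by (simp add: adjoint_graph_def)
    then have "cinner (cnj z *\<^sub>C g) g = cinner g (cnj z *\<^sub>C g)" unfolding adj using A_sym by blast
    then have "cnj z * cinner g g = z * cinner g g"
      by (simp only: cinner_scaleC_left cinner_scaleC_right complex_cnj_cnj)
    then have "(z - cnj z) * cinner g g = 0" by (metis left_diff_distrib eq_iff_diff_eq_0)
    then show "g = 0" using not_Reals_diff_cnj[OF z] by (metis mult_eq_0_iff cinner_self_eq_zero)
  qed
  have dom: "m \<in> M" and dom': "m \<in> M'" for m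
    using range_UNIV[OF z0] range_UNIV[OF cnj_z0] by auto
  show ?thesis
  proof (rule that)
    show "isometric_embedding U"
      unfolding isometric_embedding_def using U_add[OF dom dom] U_scaleC[OF dom] U_cinner[OF dom dom] by simp
    show "surj U"
    proof (rule surjI)
      fix w
      show "U (cayley_map B (cnj z0) w) = w"
        using cayley_map[OF dom'[of w]] unfolding cayley_converse by (rule cayley_map_eq)
    qed
    show 1: "U (f' - z0 *\<^sub>C f) = f' - cnj z0 *\<^sub>C f" if "(f, f') \<in> B" for f f'
      using that by (intro cayley_map_eq) (auto simp: cayley_iff)
    let ?k = "z0 - cnj z0"
    have k: "?k \<noteq> 0" by (rule not_Reals_diff_cnj[OF z0])
    show "B = cayley_inverse (graph_on UNIV U) z0"
    proof (intro equalityI subrelI)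
      fix f f' assume f: "(f, f') \<in> B"
      \<comment> \<open>The factor 1 / (z0 - cnj z0) normalizes \<open>u\<close> so that
        \<open>U u - u\<close> is \<open>f\<close> itself.\<close>
      define u where "u = inverse ?k *\<^sub>C (f' - z0 *\<^sub>C f)"
      have Uu: "U u = inverse ?k *\<^sub>C (f' - cnj z0 *\<^sub>C f)"
        unfolding u_def U_scaleC[OF dom] 1[OF f] ..
      have "U u - u = inverse ?k *\<^sub>C ?k *\<^sub>C f" "z0 *\<^sub>C U u - cnj z0 *\<^sub>C u = inverse ?k *\<^sub>C ?k *\<^sub>C f'"
        unfolding Uu unfolding u_def by (simp_all add: scaleC_algebra algebra_simps)
      then have "U u - u = f" "z0 *\<^sub>C U u - cnj z0 *\<^sub>C u = f'" using k by (simp_all add: scaleC_scaleC)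
      then show "(f, f') \<in> cayley_inverse (graph_on UNIV U) z0"
        unfolding cayley_inverse_def by force
    next
      fix f f' assume "(f, f') \<in> cayley_inverse (graph_on UNIV U) z0"
      then obtain u where u: "f = U u - u" "f' = z0 *\<^sub>C U u - cnj z0 *\<^sub>C u"
        unfolding cayley_inverse_def by auto
      obtain g g' where g: "(g, g') \<in> B" "u = g' - z0 *\<^sub>C g" using dom[of u] unfolding range_at_eq by blast
      have "f = ?k *\<^sub>C g" "f' = ?k *\<^sub>C g'"
        unfolding u g(2) 1[OF g(1)] by (simp_all add: scaleC_algebra algebra_simps)
      then show "(f, f') \<in> B" using A_scaleC[OF g(1)] by simp
    qed
  qed
qed

text \<open>The absence of fixed vectors acts twice: it makes the relation single-valued, and it
  makes the domain dense, because a vector orthogonal to the range of S - 1 is fixed by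
  \<open>S\<close>.\<close>

lemma unitary_selfadjoint:
  fixes S :: "'k::complex_hilbert \<Rightarrow> 'k"
  assumes S: "isometric_embedding S" and surj: "surj S" and fixed: "\<And>u. S u = u \<Longrightarrow> u = 0"
    and z0: "z0 \<notin> \<real>"
  shows "selfadjoint_operator (cayley_inverse (graph_on UNIV S) z0)"
proof -
  interpret unitary_dilation id S
    by standard (use S surj in \<open>simp_all add: isometric_embedding_def\<close>)
  note lin = isometric_clinear[OF S]
  let ?B = "cayley_inverse (graph_on UNIV S) z0" and ?k = "z0 - cnj z0"
  have k: "?k \<noteq> 0" by (rule not_Reals_diff_cnj[OF z0])
  have B: "(f, f') \<in> ?B \<longleftrightarrow> (\<exists>u. f = S u - u \<and> f' = z0 *\<^sub>C S u - cnj z0 *\<^sub>C u)" for f f'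
    unfolding cayley_inverse_def by auto
  have "single_valued ?B"
  proof (rule single_valuedI)
    fix x y y' assume "(x, y) \<in> ?B" "(x, y') \<in> ?B"
    then obtain u v where u: "x = S u - u" "y = z0 *\<^sub>C S u - cnj z0 *\<^sub>C u"
      and v: "x = S v - v" "y' = z0 *\<^sub>C S v - cnj z0 *\<^sub>C v" unfolding B by blast
    then have "S (u - v) = u - v" by (simp add: clinear_diff[OF lin] algebra_simps)
    then have "u = v" using fixed[of "u - v"] by simp
    then show "y = y'" using u v by simp
  qed
  moreover have "(0, 0) \<in> ?B" unfolding B by (rule exI[of _ 0]) (simp add: clinear_zero[OF lin])
  moreover have "(x + y, x' + y') \<in> ?B" if xy: "(x, x') \<in> ?B" "(y, y') \<in> ?B" for x x' y y'
  proof -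
    obtain u v where "x = S u - u" "x' = z0 *\<^sub>C S u - cnj z0 *\<^sub>C u"
      "y = S v - v" "y' = z0 *\<^sub>C S v - cnj z0 *\<^sub>C v" using xy unfolding B by blast
    then show ?thesis unfolding B
      by (intro exI[of _ "u + v"]) (simp add: clinear_add[OF lin] scaleC_algebra)
  qed
  moreover have "(c *\<^sub>C x, c *\<^sub>C x') \<in> ?B" if x: "(x, x') \<in> ?B" for c x x'
  proof -
    obtain u where "x = S u - u" "x' = z0 *\<^sub>C S u - cnj z0 *\<^sub>C u" using x unfolding B by blast
    then show ?thesis unfolding B
      by (intro exI[of _ "c *\<^sub>C u"]) (simp add: clinear_scaleC[OF lin] scaleC_algebra mult.commute)
  qed
  ultimately have linear: "linear_operator ?B" unfolding linear_operator_def by blast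
  have dom: "Domain ?B = range (\<lambda>u. S u - u)" using B by (auto simp: Domain_iff)
  have "closure (Domain ?B) = UNIV"
  proof (rule eq_UNIV_of_orth)
    have sub: "csubspace (Domain ?B)"
      unfolding dom by (rule csubspace_range)
        (simp add: clinear_def clinear_add[OF lin] clinear_scaleC[OF lin] scaleC_algebra)
    show "csubspace (closure (Domain ?B))"
      by (rule csubspace_closure[OF sub])
    show "orth (closure (Domain ?B)) \<subseteq> {0}"
    proof safe
      fix g assume g: "g \<in> orth (closure (Domain ?B))"
      have "cinner (S u) g = cinner (S u) (S g)" for u
      proof -
        have "S u - u \<in> closure (Domain ?B)" unfolding dom by (rule subsetD[OF closure_subset]) blast
        then have "cinner (S u - u) g = 0" by (rule orth_cinner'[OF g])
        then show ?thesis by (simp add: cinner_diff_left isometric_cinner[OF S])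
      qed
      then have "cinner y g = cinner y (S g)" for y using surj by (metis surjD)
      then have "S g = g" by (metis cinner_eqI cinner_commute)
      then show "g = 0" by (rule fixed)
    qed
  qed simp
  moreover have "adjoint_graph ?B = ?B"
  proof (intro equalityI subrelI)
    fix g h assume gh: "(g, h) \<in> adjoint_graph ?B"
    \<comment> \<open>Membership in the adjoint, tested on all \<open>u\<close>, says that
      \<open>S\<close> maps \<open>z0 *\<^sub>C g - h\<close> to
      \<open>cnj z0 *\<^sub>C g - h\<close>; a multiple of the former is the parameter of (g,
      h).\<close>
    have "cinner (S u) (cnj z0 *\<^sub>C g - h) = cinner (S u) (S (z0 *\<^sub>C g - h))" for u
    proof -
      have "cinner (z0 *\<^sub>C S u - cnj z0 *\<^sub>C u) g = cinner (S u - u) h"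
        using gh B by (auto simp: adjoint_graph_def)
      then show ?thesis unfolding isometric_cinner[OF S]
        by (simp add: cinner_algebra algebra_simps)
    qed
    then have "cinner y (cnj z0 *\<^sub>C g - h) = cinner y (S (z0 *\<^sub>C g - h))" for y using surj by (metis surjD)
    then have Sgh: "S (z0 *\<^sub>C g - h) = cnj z0 *\<^sub>C g - h" by (metis cinner_eqI cinner_commute)
    define u where "u = (- inverse ?k) *\<^sub>C (z0 *\<^sub>C g - h)"
    have Su: "S u = (- inverse ?k) *\<^sub>C (cnj z0 *\<^sub>C g - h)"
      unfolding u_def clinear_scaleC[OF lin] Sgh ..
    have "S u - u = inverse ?k *\<^sub>C ?k *\<^sub>C g" "z0 *\<^sub>C S u - cnj z0 *\<^sub>C u = inverse ?k *\<^sub>C ?k *\<^sub>C h"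
      unfolding Su unfolding u_def by (simp_all add: scaleC_algebra algebra_simps)
    then have "S u - u = g" "z0 *\<^sub>C S u - cnj z0 *\<^sub>C u = h" using k by (simp_all add: scaleC_scaleC)
    then show "(g, h) \<in> ?B" unfolding B by metis
  next
    fix g h assume "(g, h) \<in> ?B"
    then show "(g, h) \<in> adjoint_graph ?B"
      unfolding adjoint_graph_def using cayley_inverse_symmetric by blast
  qed
  ultimately show ?thesis using linear by (simp add: selfadjoint_operator_def)
qed

section \<open>Every generalized resolvent is given by the formula\<close>

context unitary_dilation
begin

text \<open>The chain rule with an error \<open>e \<mu>\<close> independent of \<psi>: the quotient
  of \<open>disc_map\<close> times the quotient of \<open>charfun\<close>, each compared with its
  limit.\<close>

lemma charfun_disc_map_differentiable:
  assumes z: "z \<in> half_plane z0"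
  shows "\<exists>L. uniform_limit {\<psi> \<in> X. norm \<psi> \<le> 1}
    (\<lambda>\<mu> \<psi>. inverse (\<mu> - z) *\<^sub>C (charfun (disc_map z0 \<mu>) \<psi> - charfun (disc_map z0 z) \<psi>)) L (at z)"
proof -
  let ?\<zeta> = "disc_map z0"
  obtain d where d: "(?\<zeta> has_field_derivative d) (at z)" using disc_map_deriv[OF z] by blast
  define a where "a \<mu> = (?\<zeta> \<mu> - ?\<zeta> z) / (\<mu> - z)" for \<mu>
  have a: "(a \<longlongrightarrow> d) (at z)" using d unfolding has_field_derivative_iff a_def .
  have \<zeta>: "(?\<zeta> \<longlongrightarrow> ?\<zeta> z) (at z)" using DERIV_isCont[OF d] by (simp add: isCont_def)
  define r where "r = 1 - cmod (?\<zeta> z)"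
  have r: "0 < r" using norm_disc_map[OF z] by (simp add: r_def)
  define e where "e \<mu> = cmod (a \<mu>) * (cmod (?\<zeta> \<mu> - ?\<zeta> z) / ((1 - cmod (?\<zeta> \<mu>)) * r\<^sup>2)) + cmod (a \<mu> - d) / r\<^sup>2" for \<mu>
  have "(e \<longlongrightarrow> cmod d * (cmod (?\<zeta> z - ?\<zeta> z) / ((1 - cmod (?\<zeta> z)) * r\<^sup>2)) + cmod (d - d) / r\<^sup>2) (at z)"
    unfolding e_def using r norm_disc_map[OF z] by (intro tendsto_intros a \<zeta>) auto
  then have e: "(e \<longlongrightarrow> 0) (at z)" by simp
  have bound: "norm (inverse (\<mu> - z) *\<^sub>C (charfun (?\<zeta> \<mu>) \<psi> - charfun (?\<zeta> z) \<psi>) - d *\<^sub>C charfun_deriv (?\<zeta> z) \<psi>) \<le> e \<mu>"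
    if \<mu>: "\<mu> \<in> half_plane z0" and \<psi>: "norm \<psi> \<le> 1" for \<mu> \<psi>
  proof -
    let ?Q = "compr (S (neumann T (?\<zeta> \<mu>) (state (?\<zeta> z) \<psi>)))" and ?D = "charfun_deriv (?\<zeta> z) \<psi>"
    note lt = norm_disc_map[OF \<mu>] norm_disc_map[OF z]
    have "inverse (\<mu> - z) *\<^sub>C (charfun (?\<zeta> \<mu>) \<psi> - charfun (?\<zeta> z) \<psi>) = a \<mu> *\<^sub>C ?Q"
      unfolding charfun_diff[OF lt] by (simp add: a_def scaleC_scaleC field_simps)
    then have "inverse (\<mu> - z) *\<^sub>C (charfun (?\<zeta> \<mu>) \<psi> - charfun (?\<zeta> z) \<psi>) - d *\<^sub>C ?D
        = a \<mu> *\<^sub>C (?Q - ?D) + (a \<mu> - d) *\<^sub>C ?D" by (simp add: scaleC_algebra)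
    then have "norm (inverse (\<mu> - z) *\<^sub>C (charfun (?\<zeta> \<mu>) \<psi> - charfun (?\<zeta> z) \<psi>) - d *\<^sub>C ?D)
        \<le> cmod (a \<mu>) * norm (?Q - ?D) + cmod (a \<mu> - d) * norm ?D"
      using norm_triangle_ineq[of "a \<mu> *\<^sub>C (?Q - ?D)" "(a \<mu> - d) *\<^sub>C ?D"] by simp
    also have "\<dots> \<le> e \<mu>"
      unfolding e_def
    proof (intro add_mono mult_left_mono)
      have "norm (?Q - ?D) \<le> cmod (?\<zeta> \<mu> - ?\<zeta> z) * norm \<psi> / ((1 - cmod (?\<zeta> \<mu>)) * r\<^sup>2)"
        unfolding r_def by (rule charfun_quotient_bound[OF lt])
      also have "\<dots> \<le> cmod (?\<zeta> \<mu> - ?\<zeta> z) / ((1 - cmod (?\<zeta> \<mu>)) * r\<^sup>2)"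
        using \<psi> lt r by (intro divide_right_mono mult_left_le) auto
      finally show "norm (?Q - ?D) \<le> cmod (?\<zeta> \<mu> - ?\<zeta> z) / ((1 - cmod (?\<zeta> \<mu>)) * r\<^sup>2)" .
      have "norm ?D \<le> norm \<psi> / r\<^sup>2"
        unfolding r_def by (rule charfun_deriv_bound[OF lt(2)])
      also have "\<dots> \<le> 1 / r\<^sup>2" using \<psi> by (intro divide_right_mono) auto
      finally have "cmod (a \<mu> - d) * norm ?D \<le> cmod (a \<mu> - d) * (1 / r\<^sup>2)"
        by (rule mult_left_mono) simp
      then show "cmod (a \<mu> - d) * norm ?D \<le> cmod (a \<mu> - d) / r\<^sup>2" by simp
    qed simp
    finally show ?thesis .
  qed
  have "uniform_limit {\<psi> \<in> X. norm \<psi> \<le> 1}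
    (\<lambda>\<mu> \<psi>. inverse (\<mu> - z) *\<^sub>C (charfun (?\<zeta> \<mu>) \<psi> - charfun (?\<zeta> z) \<psi>))
    (\<lambda>\<psi>. d *\<^sub>C charfun_deriv (?\<zeta> z) \<psi>) (at z)"
  proof (rule uniform_limitI)
    fix \<epsilon> :: real assume "0 < \<epsilon>"
    with e have "eventually (\<lambda>\<mu>. e \<mu> < \<epsilon>) (at z)" by (rule order_tendstoD)
    moreover have "eventually (\<lambda>\<mu>. \<mu> \<in> half_plane z0) (at z)"
      by (rule eventually_at_in_open'[OF open_half_plane z])
    ultimately show "eventually (\<lambda>\<mu>. \<forall>\<psi>\<in>{\<psi> \<in> X. norm \<psi> \<le> 1}.
        dist (inverse (\<mu> - z) *\<^sub>C (charfun (?\<zeta> \<mu>) \<psi> - charfun (?\<zeta> z) \<psi>)) (d *\<^sub>C charfun_deriv (?\<zeta> z) \<psi>) < \<epsilon>) (at z)"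
      by eventually_elim (use bound in \<open>auto simp: dist_norm intro: le_less_trans\<close>)
  qed
  then show ?thesis by blast
qed

text \<open>The vectors \<open>V (\<psi> - m) + state \<zeta> \<psi>\<close> stay bounded along the filter while \<open>S - 1\<close> sends them
  to \<open>0\<close>; as \<open>S - 1\<close> has dense range they tend weakly to \<open>0\<close>, although their inner product with
  \<open>V \<psi>\<close> is constant. This replaces the extraction of a weakly convergent subsequence.\<close>
lemma boundary_value_trivial:
  assumes dense: "closure (range (\<lambda>u. S u - u)) = UNIV"
    and Vm: "S (V m) = V w" and m: "cinner m \<psi> = 0"
    and disc: "eventually (\<lambda>z. cmod (\<zeta> z) < 1) F"
    and lim: "(\<zeta> \<longlongrightarrow> 1) F" "((\<lambda>z. charfun (\<zeta> z) \<psi>) \<longlongrightarrow> \<psi> + (w - m)) F"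
    and bounded: "frequently (\<lambda>z. norm (state (\<zeta> z) \<psi>) \<le> B) F"
  shows "\<psi> = 0"
proof (rule ccontr)
  assume "\<psi> \<noteq> 0"
  then have pos: "0 < (norm \<psi>)\<^sup>2" by simp
  \<comment> \<open>A bound for the vector \<open>x\<close> below; the summand 1 keeps it
    positive.\<close>
  define K where "K = norm (\<psi> - m) + \<bar>B\<bar> + 1"
  have K: "0 < K" unfolding K_def using norm_ge_zero[of "\<psi> - m"] by linarith
  have "V \<psi> \<in> closure (range (\<lambda>u. S u - u))" by (simp add: dense)
  moreover have "0 < (norm \<psi>)\<^sup>2 / (2 * K)" using pos K by simp
  ultimately obtain y where "y \<in> range (\<lambda>u. S u - u)" "dist y (V \<psi>) < (norm \<psi>)\<^sup>2 / (2 * K)"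
    unfolding closure_approachable by blast
  then obtain t where t: "norm (V \<psi> - (S t - t)) < (norm \<psi>)\<^sup>2 / (2 * K)"
    by (auto simp: dist_norm norm_minus_commute)
  define g where "g z = norm (charfun (\<zeta> z) \<psi> - (\<psi> + (w - m))) + cmod (1 - \<zeta> z) * \<bar>B\<bar>" for z
  have "(g \<longlongrightarrow> norm ((\<psi> + (w - m)) - (\<psi> + (w - m))) + cmod (1 - 1) * \<bar>B\<bar>) F"
    unfolding g_def by (intro tendsto_intros lim)
  then have "((\<lambda>z. g z * norm t) \<longlongrightarrow> 0 * norm t) F" by (intro tendsto_mult tendsto_const) simp
  then have "eventually (\<lambda>z. g z * norm t < (norm \<psi>)\<^sup>2 / 2) F"
    by (rule order_tendstoD) (use pos in simp)
  then obtain z where z: "cmod (\<zeta> z) < 1" "norm (state (\<zeta> z) \<psi>) \<le> B" "g z * norm t < (norm \<psi>)\<^sup>2 / 2"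
    using frequently_ex[OF frequently_eventually_frequently[OF bounded eventually_conj[OF disc]]] by blast
  let ?h = "state (\<zeta> z) \<psi>"
  define x where "x = V (\<psi> - m) + ?h"
  have "S (V \<psi>) = V (charfun (\<zeta> z) \<psi>) + ?h - \<zeta> z *\<^sub>C S ?h"
    using unitary_state[OF z(1), of \<psi>]
    by (simp add: clinear_add[OF linS] clinear_scaleC[OF linS] algebra_simps)
  \<comment> \<open>Because \<open>S (V m) = V w\<close>, the constant parts combine into the limit
    of \<open>charfun\<close>, and what remains is small.\<close>
  then have "S x - x = V (charfun (\<zeta> z) \<psi> - (\<psi> + (w - m))) + (1 - \<zeta> z) *\<^sub>C S ?h"
    by (simp add: x_def clinear_add[OF linS] clinear_diff[OF linS] clinear_add[OF linV] clinear_diff[OF linV]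
        Vm scaleC_algebra)
  then have "norm (S x - x) \<le> norm (charfun (\<zeta> z) \<psi> - (\<psi> + (w - m))) + cmod (1 - \<zeta> z) * norm ?h"
    using norm_triangle_ineq[of "V (charfun (\<zeta> z) \<psi> - (\<psi> + (w - m)))" "(1 - \<zeta> z) *\<^sub>C S ?h"]
    by (simp add: norm_V norm_S)
  also have "\<dots> \<le> g z" unfolding g_def using z(2) by (intro add_left_mono mult_left_mono) auto
  finally have "norm (S x - x) * norm t < (norm \<psi>)\<^sup>2 / 2"
    using z(3) by (meson le_less_trans mult_right_mono norm_ge_zero)
  then have small: "norm (S x - x) * norm (S t) < (norm \<psi>)\<^sup>2 / 2" by (simp add: norm_S)
  have "norm x \<le> K"
    using norm_triangle_ineq[of "V (\<psi> - m)" ?h] z(2) unfolding x_def K_def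
    by (simp add: norm_V)
  \<comment> \<open>Unitarity moves S - 1 from \<open>t\<close> to \<open>x\<close>: the product of
    \<open>x\<close> with \<open>S t - t\<close> is minus that of \<open>S x - x\<close> with
    \<open>S t\<close>.\<close>
  have "cinner x (V \<psi>) = cinner x (V \<psi> - (S t - t)) - cinner (S x - x) (S t)"
    by (simp add: cinner_algebra cinner_S)
  moreover have "cinner x (V \<psi>) = complex_of_real ((norm \<psi>)\<^sup>2)"
    unfolding x_def by (simp add: cinner_add_left cinner_V cinner_diff_left m
        state_orth[OF z(1)] cinner_self)
  ultimately have "(norm \<psi>)\<^sup>2 = cmod (cinner x (V \<psi> - (S t - t)) - cinner (S x - x) (S t))"
    by (metis abs_of_nonneg norm_of_real zero_le_power2)
  also have "\<dots> \<le> norm x * norm (V \<psi> - (S t - t)) + norm (S x - x) * norm (S t)"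
    by (rule order_trans[OF norm_triangle_ineq4 add_mono]) (rule norm_cinner_le)+
  also have "\<dots> < (norm \<psi>)\<^sup>2 / 2 + (norm \<psi>)\<^sup>2 / 2"
  proof (rule add_le_less_mono[OF _ small])
    have "norm x * norm (V \<psi> - (S t - t)) \<le> K * ((norm \<psi>)\<^sup>2 / (2 * K))"
      using \<open>norm x \<le> K\<close> t K by (intro mult_mono) auto
    then show "norm x * norm (V \<psi> - (S t - t)) \<le> (norm \<psi>)\<^sup>2 / 2" using K by simp
  qed
  finally show False by simp
qed

end

section \<open>The admissible function of a self-adjoint extension\<close>

context closed_symmetric
begin

theorem generalized_resolvent_shtraus:
  fixes R :: "complex \<Rightarrow> ('h, 'h) op_graph"
  assumes R: "generalized_resolvent TYPE('k::complex_hilbert) A R"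
  shows "\<exists>F\<in>admissible_functions A z0. \<forall>z. z \<notin> \<real> \<longrightarrow> R z = shtraus_resolvent A z0 F z"
proof -
  obtain V :: "'h \<Rightarrow> 'k" and B where V: "isometric_embedding V" and B: "selfadjoint_operator B"
    and AB: "\<And>f f'. (f, f') \<in> A \<Longrightarrow> (V f, V f') \<in> B"
    and Rz: "\<And>z. z \<notin> \<real> \<Longrightarrow> R z = compression V (resolvent B z)"
    using R unfolding generalized_resolvent_def by blast
  obtain S where S: "isometric_embedding S" "surj S" and BS: "B = cayley_inverse (graph_on UNIV S) z0"
    and SB: "\<And>f f'. (f, f') \<in> B \<Longrightarrow> S (f' - z0 *\<^sub>C f) = f' - cnj z0 *\<^sub>C f"
    using selfadjoint_unitary[OF B z0] by blast
  interpret unitary_dilation V S by standard (rule V S)+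
  note linV = isometric_clinear[OF V]
  have SU: "S (V m) = V (U m)" if m: "m \<in> M" for m
  proof -
    obtain f f' where f: "(f, f') \<in> A" "m = f' - z0 *\<^sub>C f" "U m = f' - cnj z0 *\<^sub>C f"
      using cayley_map[OF m] unfolding cayley_iff by blast
    show ?thesis
      using SB[OF AB[OF f(1)]] by (simp add: f(3)) (simp add: f(2) clinear_diff[OF linV] clinear_scaleC[OF linV])
  qed
  define F where "F z = charfun (disc_map z0 z)" for z
  have F: "contraction (F z)" if "z \<in> half_plane z0" for z
    unfolding F_def by (rule contraction_charfun[OF norm_disc_map[OF that]])
  \<comment> \<open>On \<open>M\<close> the dilation equation is solved with state 0, so every
    \<open>F z\<close> extends \<open>U\<close>.\<close>
  have FU: "F z m = U m" if "z \<in> half_plane z0" "m \<in> M" for z m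
    unfolding F_def by (rule charfun_eqI(2)[OF norm_disc_map[OF that(1)], of _ 0]) (simp_all add: SU[OF that(2)])
  have ext: "cayley_extension A z0 (F z) = F z" and bet: "contraction_between N N' (F z)"
    if "z \<in> half_plane z0" for z
    using contraction_extending_cayley[OF F[OF that] FU[OF that]] by blast+
  have resolvents: "R z = shtraus_resolvent A z0 F z" if z: "z \<notin> \<real>" for z
  proof (cases "z \<in> half_plane z0")
    case True
    show ?thesis
      unfolding Rz[OF z] shtraus_resolvent_upper[OF True] ext[OF True]
      unfolding F_def BS by (rule resolvent_charfun[OF True])
  next
    case False
    then have lower: "z \<in> half_plane (cnj z0)" using half_plane_cases[OF z0 z] by blast
    then have up: "cnj z \<in> half_plane z0" by simp
    obtain g where g: "contraction g" "\<And>x y. cinner (F (cnj z) x) y = cinner x (g y)"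
      using contraction_adjoint[OF F[OF up]] by blast
    have "shtraus_resolvent A z0 F z = resolvent (cayley_inverse (graph_on UNIV g) (cnj z0)) z"
      by (rule shtraus_resolvent_lower[where F = F, OF lower bet[OF up]]) (simp add: ext[OF up] g(2))
    then show ?thesis
      unfolding Rz[OF z] BS
      using resolvent_charfun_adjoint[OF lower g(1)] g(2) by (simp add: F_def)
  qed
  have dense: "closure (range (\<lambda>u. S u - u)) = UNIV"
  proof -
    have "Domain B = range (\<lambda>u. S u - u)" unfolding BS cayley_inverse_def by (auto simp: Domain_iff)
    then show ?thesis using B by (simp add: selfadjoint_operator_def)
  qed
  have "F \<in> admissible_functions A z0"
    unfolding admissible_functions_def
  proof (intro CollectI conjI ballI, safe)
    show "F \<in> schur_class (half_plane z0) N N'"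
      unfolding schur_class_def using bet charfun_disc_map_differentiable by (auto simp: F_def)
    fix \<psi> \<phi> \<epsilon>
    assume X: "(\<psi>, \<phi>) \<in> forbidden_operator A z0" and \<epsilon>: "0 < \<epsilon>" "\<epsilon> < pi / 2"
      and lim: "((\<lambda>z. F z \<psi>) \<longlongrightarrow> \<phi>) (inf at_infinity (principal (sector z0 \<epsilon>)))"
      and liminf: "Liminf (inf at_infinity (principal (sector z0 \<epsilon>)))
        (\<lambda>z. ereal (cmod z * (norm \<psi> - norm (F z \<psi>)))) < \<infinity>"
    let ?Fl = "inf at_infinity (principal (sector z0 \<epsilon>))"
    let ?k = "z0 - cnj z0"
    have k: "?k \<noteq> 0" by (rule not_Reals_diff_cnj[OF z0])
    have \<psi>: "\<psi> \<in> N" using X by (simp add: forbidden_operator_def)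
    obtain f' where f: "(\<psi> - \<phi>, f') \<in> A" using X by (auto simp: forbidden_operator_def)
    \<comment> \<open>The solution of \<open>U m - m = \<phi> - \<psi>\<close>, available because
      \<open>\<psi> - \<phi>\<close> lies in the domain of \<open>A\<close>. The limit \<phi> thus
      gets the form \<psi> + (U m - m) that \<open>boundary_value_trivial\<close> expects.\<close>
    define m where "m = (- inverse ?k) *\<^sub>C (f' - z0 *\<^sub>C (\<psi> - \<phi>))"
    have mU: "(m, (- inverse ?k) *\<^sub>C (f' - cnj z0 *\<^sub>C (\<psi> - \<phi>))) \<in> cayley A z0"
      unfolding m_def by (rule cayley_scaleC) (use f in \<open>auto simp: cayley_iff\<close>)
    then have m: "m \<in> M" "U m = (- inverse ?k) *\<^sub>C (f' - cnj z0 *\<^sub>C (\<psi> - \<phi>))"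
      using range_at_iff cayley_map_eq[OF mU] by blast+
    have "U m - m = - (inverse ?k *\<^sub>C ?k *\<^sub>C (\<psi> - \<phi>))"
      unfolding m(2) unfolding m_def by (simp add: scaleC_algebra algebra_simps)
    then have Um: "U m - m = \<phi> - \<psi>" using k by (simp add: scaleC_scaleC)
    have sector: "eventually (\<lambda>z. z \<in> sector z0 \<epsilon>) ?Fl"
      by (simp add: eventually_inf_principal)
    obtain C where C: "Liminf ?Fl (\<lambda>z. ereal (cmod z * (norm \<psi> - norm (F z \<psi>)))) < ereal C"
      using liminf ereal_dense2[of _ \<infinity>] by blast
    \<comment> \<open>A finite lower limit gives a bound at arbitrarily distant points of the
      sector, not eventually.\<close>
    have "frequently (\<lambda>z. cmod z * (norm \<psi> - norm (F z \<psi>)) < C) ?Fl"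
    proof (rule ccontr)
      assume "\<not> ?thesis"
      then have "eventually (\<lambda>z. ereal C \<le> ereal (cmod z * (norm \<psi> - norm (F z \<psi>)))) ?Fl"
        by (simp add: not_frequently not_less)
      from Liminf_bounded[OF this] C show False by simp
    qed
    moreover have "eventually (\<lambda>z. cmod z0 \<le> cmod z) ?Fl"
      unfolding eventually_inf_principal by (rule eventually_mono[of "\<lambda>z. cmod z0 \<le> cmod z"])
        (auto simp: eventually_at_infinity)
    ultimately have freq: "frequently (\<lambda>z. cmod z * (norm \<psi> - norm (F z \<psi>)) < C \<and>
        z \<in> sector z0 \<epsilon> \<and> cmod z0 \<le> cmod z) ?Fl"
      using sector by (intro frequently_eventually_frequently eventually_conj)
    define c where "c = sin \<epsilon> * \<bar>Im z0\<bar>"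
    have c: "0 < c" unfolding c_def using \<epsilon> z0
      by (intro mult_pos_pos sin_gt_zero) (auto simp: complex_is_Real_iff)
    show "\<psi> = 0"
    proof (rule boundary_value_trivial[OF dense SU[OF m(1)]])
      show "cinner m \<psi> = 0" using \<psi> m(1) by (auto simp: defect_space_orth intro: orth_cinner')
      show "eventually (\<lambda>z. cmod (disc_map z0 z) < 1) ?Fl"
        using sector by eventually_elim (intro norm_disc_map sector_half_plane)
      show "(disc_map z0 \<longlongrightarrow> 1) ?Fl"
        by (rule tendsto_mono[OF inf_le1 disc_map_tendsto])
      show "((\<lambda>z. charfun (disc_map z0 z) \<psi>) \<longlongrightarrow> \<psi> + (U m - m)) ?Fl"
        using lim by (simp add: Um F_def)
      show "frequently (\<lambda>z. norm (state (disc_map z0 z) \<psi>) \<le> 2 * norm \<psi> * C / c + 1) ?Fl"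
      proof (rule frequently_mono[OF _ freq], safe)
        fix z assume z: "cmod z * (norm \<psi> - norm (F z \<psi>)) < C" "z \<in> sector z0 \<epsilon>" "cmod z0 \<le> cmod z"
        note hp = sector_half_plane[OF z(2)]
        let ?h = "norm (state (disc_map z0 z) \<psi>)"
        \<comment> \<open>The sector estimate and the energy identity bound the state;
          \<open>2 * norm \<psi>\<close> replaces the factor
          \<open>norm \<psi> + norm (F z \<psi>)\<close> of the difference of squares.\<close>
        have "c * ?h\<^sup>2 \<le> cmod z * (1 - (cmod (disc_map z0 z))\<^sup>2) * ?h\<^sup>2"
          unfolding c_def by (intro mult_right_mono sector_defect_lower[OF z(2) \<epsilon> z(3)]) simp
        also have "\<dots> = cmod z * ((norm \<psi>)\<^sup>2 - (norm (F z \<psi>))\<^sup>2)"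
          unfolding F_def energy[OF norm_disc_map[OF hp]] by simp
        also have "\<dots> = (cmod z * (norm \<psi> - norm (F z \<psi>))) * (norm \<psi> + norm (F z \<psi>))"
          by (simp add: power2_eq_square algebra_simps)
        also have "\<dots> \<le> (cmod z * (norm \<psi> - norm (F z \<psi>))) * (2 * norm \<psi>)"
          using contraction_norm[OF F[OF hp], of \<psi>] by (intro mult_left_mono) auto
        also have "\<dots> \<le> C * (2 * norm \<psi>)" using z(1) by (intro mult_right_mono) auto
        finally have "?h\<^sup>2 \<le> 2 * norm \<psi> * C / c" using c by (simp add: field_simps)
        moreover have "?h \<le> ?h\<^sup>2 + 1"
          using zero_le_power2[of "?h - 1"] unfolding power2_diff by (simp add: power2_eq_square) (smt (verit) mult_nonneg_nonneg norm_ge_zero)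
        ultimately show "?h \<le> 2 * norm \<psi> * C / c + 1" by linarith
      qed
    qed
  qed
  then show ?thesis using resolvents by blast
qed

end

section \<open>Positive kernels\<close>

definition positive_kernel :: "('x \<Rightarrow> 'x \<Rightarrow> complex) \<Rightarrow> bool" where
  "positive_kernel k \<longleftrightarrow> (\<forall>x y. k y x = cnj (k x y)) \<and>
    (\<forall>n (p :: nat \<Rightarrow> 'x) a. 0 \<le> Re (\<Sum>i<n. \<Sum>j<n. a i * cnj (a j) * k (p i) (p j)))"

lemma positive_kernel_commute: "positive_kernel k \<Longrightarrow> k y x = cnj (k x y)"
  unfolding positive_kernel_def by blast

lemma positive_kernel_nonneg:
  fixes n :: nat
  assumes "positive_kernel k"
  shows "0 \<le> Re (\<Sum>i<n. \<Sum>j<n. a i * cnj (a j) * k (p i) (p j))"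
  using conjunct2[OF assms[unfolded positive_kernel_def], rule_format, of a p n] .

lemma positive_kernel_diag: assumes "positive_kernel k"
  shows "0 \<le> Re (k x x)" "Im (k x x) = 0"
  using positive_kernel_nonneg[OF assms, where n = 1 and a = "\<lambda>_. 1" and p = "\<lambda>_. x"]
    arg_cong[OF positive_kernel_commute[OF assms, of x x], of Im]
  by simp_all

lemma positive_kernel_of_real_diag: "positive_kernel k \<Longrightarrow> complex_of_real (Re (k x x)) = k x x"
  using positive_kernel_diag(2)[of k x] by (simp add: complex_eq_iff)

text \<open>Adjoining the point \<open>z\<close> with weight \<open>t\<close> to the family gives an
  expression quadratic in \<open>t\<close> that is nonnegative for every complex \<open>t\<close>;
  the best \<open>t\<close> yields the inequality.\<close>

lemma positive_kernel_Cauchy_Schwarz: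
  fixes n :: nat
  assumes k: "positive_kernel k"
  shows "(cmod (\<Sum>i<n. a i * k (p i) z))\<^sup>2
    \<le> Re (\<Sum>i<n. \<Sum>j<n. a i * cnj (a j) * k (p i) (p j)) * Re (k z z)"
proof -
  define s where "s = (\<Sum>i<n. a i * k (p i) z)"
  define Q where "Q = (\<Sum>i<n. \<Sum>j<n. a i * cnj (a j) * k (p i) (p j))"
  define \<kappa> where "\<kappa> = Re (k z z)"
  have ineq: "0 \<le> Re Q + 2 * Re (cnj t * s) + (cmod t)\<^sup>2 * \<kappa>" for t
  proof -
    define a' where "a' = a(n := t)"
    define p' where "p' = p(n := z)"
    have "(\<Sum>i<Suc n. \<Sum>j<Suc n. a' i * cnj (a' j) * k (p' i) (p' j))
        = Q + (\<Sum>i<n. a i * cnj t * k (p i) z) + (\<Sum>j<n. t * cnj (a j) * k z (p j)) + t * cnj t * k z z"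
      by (simp add: a'_def p'_def Q_def sum.distrib)
    also have "(\<Sum>i<n. a i * cnj t * k (p i) z) = cnj t * s"
      unfolding s_def sum_distrib_left by (simp add: mult_ac)
    also have "(\<Sum>j<n. t * cnj (a j) * k z (p j)) = cnj (cnj t * s)"
      unfolding s_def by (simp add: sum_distrib_left positive_kernel_commute[OF k, of _ z] mult_ac)
    finally have "(\<Sum>i<Suc n. \<Sum>j<Suc n. a' i * cnj (a' j) * k (p' i) (p' j))
        = Q + cnj t * s + cnj (cnj t * s) + t * cnj t * k z z" .
    moreover have "Re (t * cnj t * k z z) = (cmod t)\<^sup>2 * \<kappa>"
      unfolding complex_norm_square[symmetric] \<kappa>_def by simp
    ultimately have "Re (\<Sum>i<Suc n. \<Sum>j<Suc n. a' i * cnj (a' j) * k (p' i) (p' j))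
        = Re Q + 2 * Re (cnj t * s) + (cmod t)\<^sup>2 * \<kappa>"
      by (simp only: plus_complex.sel complex_cnj(1)) (simp add: algebra_simps)
    then show ?thesis using positive_kernel_nonneg[OF k, where n = "Suc n" and a = a' and p = p'] by linarith
  qed
  have \<kappa>0: "0 \<le> \<kappa>" unfolding \<kappa>_def by (rule positive_kernel_diag[OF k])
  have re: "Re (cnj (complex_of_real \<tau> * s) * s) = \<tau> * (cmod s)\<^sup>2" for \<tau>
    by (simp add: mult.assoc mult.commute[of "cnj s"] flip: complex_norm_square of_real_power)
  have "(cmod s)\<^sup>2 \<le> Re Q * \<kappa>"
  proof (cases "\<kappa> = 0")
    case True
    have "s = 0"
    proof (rule ccontr)
      assume "s \<noteq> 0"
      then have pos: "0 < (cmod s)\<^sup>2" by simp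
      \<comment> \<open>Without quadratic term, a large negative multiple of \<open>s\<close> as
        weight makes the expression negative; this one gives -1.\<close>
      define \<tau> where "\<tau> = - (Re Q + 1) / (2 * (cmod s)\<^sup>2)"
      have "0 \<le> Re Q + 2 * (\<tau> * (cmod s)\<^sup>2)"
        using ineq[of "complex_of_real \<tau> * s"] unfolding re by (simp add: True)
      moreover have "2 * (\<tau> * (cmod s)\<^sup>2) = - (Re Q + 1)" unfolding \<tau>_def using pos by simp
      ultimately show False by linarith
    qed
    then show ?thesis using True by simp
  next
    case False
    then have pos: "0 < \<kappa>" using \<kappa>0 by simp
    \<comment> \<open>The minimizing weight is -s / \<kappa>.\<close>
    have "0 \<le> Re Q + 2 * (- inverse \<kappa> * (cmod s)\<^sup>2) + (inverse \<kappa> * cmod s)\<^sup>2 * \<kappa>"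
      using ineq[of "complex_of_real (- inverse \<kappa>) * s"] unfolding re
      using pos by (simp add: norm_mult norm_inverse)
    also have "\<dots> = Re Q - (cmod s)\<^sup>2 / \<kappa>"
      using pos by (simp add: power2_eq_square field_simps)
    finally show ?thesis using pos by (simp add: field_simps)
  qed
  then show ?thesis by (simp add: s_def Q_def \<kappa>_def)
qed

lemma positive_kernel_diag_zero:
  assumes k: "positive_kernel k" and "k z z = 0" shows "k x z = 0" "k z x = 0"
proof -
  show "k x z = 0"
    using positive_kernel_Cauchy_Schwarz[OF k, where n = 1 and a = "\<lambda>_. 1" and p = "\<lambda>_. x" and z = z] assms(2) by simp
  then show "k z x = 0" by (subst positive_kernel_commute[OF k]) simp
qed

text \<open>If \<open>k z z = 0\<close>, the quotient is 0 and nothing is split off. This is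
  consistent, since positivity then makes the row and the column of \<open>z\<close> vanish.\<close>

definition schur_complement :: "('x \<Rightarrow> 'x \<Rightarrow> complex) \<Rightarrow> 'x \<Rightarrow> 'x \<Rightarrow> 'x \<Rightarrow> complex" where
  "schur_complement k z x y = k x y - k x z * k z y / k z z"

text \<open>On a finite family the subtracted rank one term is |s|^2 / k z z, which Cauchy-Schwarz
  bounds by the quadratic form of \<open>k\<close>.\<close>

lemma positive_kernel_schur_complement:
  assumes k: "positive_kernel k" shows "positive_kernel (schur_complement k z)"
  unfolding positive_kernel_def
proof (intro conjI allI)
  fix x y
  have "k y x = cnj (k x y)" "k y z = cnj (k z y)" "k z x = cnj (k x z)" "cnj (k z z) = k z z"
    using positive_kernel_commute[OF k] by metis+
  then show "schur_complement k z y x = cnj (schur_complement k z x y)"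
    unfolding schur_complement_def by (simp add: mult.commute)
next
  fix n a and p :: "nat \<Rightarrow> 'a"
  define s where "s = (\<Sum>i<n. a i * k (p i) z)"
  define Q where "Q = (\<Sum>i<n. \<Sum>j<n. a i * cnj (a j) * k (p i) (p j))"
  have kz: "k z (p j) = cnj (k (p j) z)" for j by (rule positive_kernel_commute[OF k])
  have "(\<Sum>i<n. \<Sum>j<n. a i * cnj (a j) * (k (p i) z * k z (p j) / k z z)) = s * cnj s / k z z"
    unfolding s_def cnj_sum sum_product sum_divide_distrib
    by (simp add: kz mult_ac)
  then have "(\<Sum>i<n. \<Sum>j<n. a i * cnj (a j) * schur_complement k z (p i) (p j)) = Q - s * cnj s / k z z"
    by (simp add: schur_complement_def Q_def right_diff_distrib sum_subtractf)
  moreover have "s * cnj s / k z z = complex_of_real ((cmod s)\<^sup>2 / Re (k z z))"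
    by (simp add: complex_norm_square[symmetric] positive_kernel_of_real_diag[OF k] del: of_real_power)
  moreover have "(cmod s)\<^sup>2 / Re (k z z) \<le> Re Q"
    using positive_kernel_Cauchy_Schwarz[OF k, where n = n and a = a and p = p and z = z] positive_kernel_diag(1)[OF k, of z]
      positive_kernel_nonneg[OF k, where n = n and a = a and p = p]
    unfolding s_def[symmetric] Q_def[symmetric]
    by (cases "Re (k z z) = 0") (simp_all add: field_simps)
  ultimately show "0 \<le> Re (\<Sum>i<n. \<Sum>j<n. a i * cnj (a j) * schur_complement k z (p i) (p j))"
    by simp
qed

text \<open>Cholesky factorization: the kernel is exhausted by successive Schur complements, and the
  \<open>n\<close>-th coordinate of the vector with index \<open>i\<close> is the rank one term split off at step \<open>n\<close>.\<close>
lemma positive_kernel_nat_ell2: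
  fixes k :: "nat \<Rightarrow> nat \<Rightarrow> complex"
  assumes k: "positive_kernel k"
  obtains v :: "nat \<Rightarrow> ell2" where "\<And>i j. cinner (v i) (v j) = k i j"
proof -
  define K where "K = rec_nat k (\<lambda>n K. schur_complement K n)"
  have K0: "K 0 = k" and KS: "K (Suc n) = schur_complement (K n) n" for n
    by (simp_all add: K_def)
  have pos: "positive_kernel (K n)" for n
    by (induction n) (simp_all add: K0 KS k positive_kernel_schur_complement)
  \<comment> \<open>After n steps the rows and columns below n are exhausted; hence the vector with
    index i has support in \<open>{..i}\<close>.\<close>
  have zero: "i < n \<or> j < n \<Longrightarrow> K n i j = 0" for n i j
  proof (induction n arbitrary: i j)
    case (Suc n)
    have "K n n n = 0 \<Longrightarrow> K n n j = 0" "K n n n = 0 \<Longrightarrow> K n i n = 0"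
      using positive_kernel_diag_zero[OF pos] by blast+
    moreover have "K n i j = 0" if "i < n \<or> j < n" using Suc.IH that by blast
    moreover have "K n i n = 0" if "i < n" using Suc.IH that by blast
    moreover have "K n n j = 0" if "j < n" using Suc.IH that by blast
    ultimately show ?case using Suc.prems
      unfolding KS schur_complement_def by (auto simp: less_Suc_eq)
  qed simp
  define x where "x i n = K n i n / complex_of_real (sqrt (Re (K n n n)))" for i n
  have x_zero: "x i n = 0" if "n \<notin> {..i}" for i n using zero[of i n n] that by (simp add: x_def)
  \<comment> \<open>Each product is the difference of consecutive kernels, so the inner product
    telescopes.\<close>
  have x_prod: "x i n * cnj (x j n) = K n i j - K (Suc n) i j" for i j n
  proof -
    have "complex_of_real (sqrt (Re (K n n n))) * complex_of_real (sqrt (Re (K n n n))) = K n n n"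
      using positive_kernel_diag(1)[OF pos] positive_kernel_of_real_diag[OF pos]
      by (simp flip: of_real_mult)
    moreover have "cnj (K n j n) = K n n j" by (rule positive_kernel_commute[OF pos, symmetric])
    ultimately show ?thesis
      by (simp add: x_def KS schur_complement_def)
  qed
  define v where "v i = Abs_ell2 (x i)" for i
  have "summable (\<lambda>n. (cmod (x i n))\<^sup>2)" for i
    by (rule summable_finite[of "{..i}"]) (simp_all add: x_zero)
  then have coord_v: "coord (v i) = x i" for i by (simp add: v_def Abs_ell2_inverse)
  have "cinner (v i) (v j) = k i j" for i j
  proof -
    have "cinner (v i) (v j) = (\<Sum>n\<in>{..i}. x i n * cnj (x j n))"
      unfolding cinner_ell2_def cinner_seq_def coord_v
      by (rule suminf_finite) (simp_all add: x_zero)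
    also have "\<dots> = (\<Sum>n<Suc i. K n i j - K (Suc n) i j)"
      by (simp only: x_prod lessThan_Suc_atMost)
    also have "\<dots> = K 0 i j - K (Suc i) i j" by (rule sum_lessThan_telescope')
    also have "\<dots> = k i j" using zero[of i "Suc i" j] by (simp add: K0)
    finally show ?thesis .
  qed
  then show ?thesis by (rule that)
qed

text \<open>The squared distance of the two vectors that are still to be found, expressed by the
  kernel alone.\<close>

definition kernel_dist_sq :: "('x \<Rightarrow> 'x \<Rightarrow> complex) \<Rightarrow> 'x \<Rightarrow> 'x \<Rightarrow> real" where
  "kernel_dist_sq k x y = Re (k x x) - 2 * Re (k x y) + Re (k y y)"

lemma kernel_dist_sq_triangle:
  assumes k: "positive_kernel k"
  shows "kernel_dist_sq k x z \<le> 2 * kernel_dist_sq k x y + 2 * kernel_dist_sq k z y"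
proof -
  have re: "Re (k b a) = Re (k a b)" for a b by (subst positive_kernel_commute[OF k]) simp
  \<comment> \<open>The weights 1, -2, 1 say that x + z - 2 y has nonnegative square norm, which is
    what the parallelogram law leaves to prove.\<close>
  have "0 \<le> Re (\<Sum>i<3. \<Sum>j<3. [1, -2, 1] ! i * cnj ([1, -2, 1] ! j) * k ([x, y, z] ! i) ([x, y, z] ! j))"
    by (rule positive_kernel_nonneg[OF k])
  then show ?thesis
    unfolding kernel_dist_sq_def
    by (simp add: eval_nat_numeral re[of x y] re[of x z] re[of y z])
qed

lemma kernel_diff_le:
  assumes k: "positive_kernel k"
  shows "(cmod (k x z - k y z))\<^sup>2 \<le> kernel_dist_sq k x y * Re (k z z)"
proof -
  have re: "Re (k y x) = Re (k x y)" by (subst positive_kernel_commute[OF k]) simp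
  show ?thesis
    using positive_kernel_Cauchy_Schwarz[OF k, where n = 2 and a = "\<lambda>i. [1, -1] ! i" and p = "\<lambda>i. [x, y] ! i" and z = z]
    by (simp add: kernel_dist_sq_def eval_nat_numeral re algebra_simps)
qed

text \<open>Factorize along the dense sequence and pass to limits: approximants of a point have
  Cauchy images in \<open>ell2\<close>, and by \<open>kernel_diff_le\<close> the kernel is
  continuous in each argument, so the inner products converge to it.\<close>

lemma positive_kernel_ell2:
  fixes k :: "'x \<Rightarrow> 'x \<Rightarrow> complex" and d :: "nat \<Rightarrow> 'x"
  assumes k: "positive_kernel k" and dense: "\<And>x e. 0 < e \<Longrightarrow> \<exists>n. kernel_dist_sq k (d n) x < e"
  obtains v :: "'x \<Rightarrow> ell2" where "\<And>x y. cinner (v x) (v y) = k x y"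
proof -
  have "positive_kernel (\<lambda>i j. k (d i) (d j))"
    unfolding positive_kernel_def
  proof (intro conjI allI)
    fix n a and p :: "nat \<Rightarrow> nat"
    show "0 \<le> Re (\<Sum>i<n. \<Sum>j<n. a i * cnj (a j) * k (d (p i)) (d (p j)))"
      by (rule positive_kernel_nonneg[OF k, where p = "\<lambda>i. d (p i)"])
  qed (rule positive_kernel_commute[OF k])
  then obtain u :: "nat \<Rightarrow> ell2" where u: "\<And>i j. cinner (u i) (u j) = k (d i) (d j)"
    using positive_kernel_nat_ell2 by blast
  have u_dist: "(norm (u i - u j))\<^sup>2 = kernel_dist_sq k (d i) (d j)" for i j
    unfolding norm_diff_sq kernel_dist_sq_def by (simp add: norm_sq_cinner u)
  have "\<exists>s. \<forall>m. kernel_dist_sq k (d (s m)) x < 1 / real (Suc m)" for x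
    by (rule choice, rule allI, rule dense) simp
  then obtain s where s: "\<And>x m. kernel_dist_sq k (d (s x m)) x < 1 / real (Suc m)" by metis
  have nonneg: "0 \<le> kernel_dist_sq k x y" for x y
    using kernel_dist_sq_triangle[OF k, of x x y] by (simp add: kernel_dist_sq_def)
  have s0: "(\<lambda>m. kernel_dist_sq k (d (s x m)) x) \<longlonglongrightarrow> 0" for x
    by (rule real_tendsto_sandwich[OF _ _ tendsto_const LIMSEQ_inverse_real_of_nat])
      (use s nonneg in \<open>auto simp: inverse_eq_divide less_imp_le intro!: always_eventually\<close>)
  have "Cauchy (\<lambda>m. u (s x m))" for x
  proof (rule CauchyI)
    fix e :: real assume e: "0 < e"
    then have "eventually (\<lambda>m. kernel_dist_sq k (d (s x m)) x < e\<^sup>2 / 4) sequentially"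
      by (intro order_tendstoD[OF s0]) simp
    then obtain M where M: "\<And>m. m \<ge> M \<Longrightarrow> kernel_dist_sq k (d (s x m)) x < e\<^sup>2 / 4"
      by (auto simp: eventually_sequentially)
    have "norm (u (s x m) - u (s x n)) < e" if "m \<ge> M" "n \<ge> M" for m n
    proof (rule power2_less_imp_less)
      show "(norm (u (s x m) - u (s x n)))\<^sup>2 < e\<^sup>2"
        using kernel_dist_sq_triangle[OF k, of "d (s x m)" "d (s x n)" x] M[OF that(1)] M[OF that(2)]
        by (simp add: u_dist)
    qed (use e in simp)
    then show "\<exists>M. \<forall>m\<ge>M. \<forall>n\<ge>M. norm (u (s x m) - u (s x n)) < e" by blast
  qed
  then have "\<exists>l. (\<lambda>m. u (s x m)) \<longlonglongrightarrow> l" for x using Cauchy_convergent convergent_def by blast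
  then obtain v where v: "\<And>x. (\<lambda>m. u (s x m)) \<longlonglongrightarrow> v x" by metis
  have "cinner (v x) (v y) = k x y" for x y
  proof (rule LIMSEQ_unique)
    show "(\<lambda>m. cinner (u (s x m)) (u (s y m))) \<longlonglongrightarrow> cinner (v x) (v y)"
      by (intro tendsto_cinner v)
    let ?p = "\<lambda>m. d (s x m)" and ?q = "\<lambda>m. d (s y m)"
    have "(\<lambda>m. k (?p m) (?q m) - k x (?q m)) \<longlonglongrightarrow> 0"
    proof (rule Lim_null_comparison)
      show "eventually (\<lambda>m. cmod (k (?p m) (?q m) - k x (?q m))
          \<le> sqrt (kernel_dist_sq k (?p m) x * (norm (u (s y m)))\<^sup>2)) sequentially"
        using kernel_diff_le[OF k, of _ "?q _" x]
        by (intro always_eventually allI real_le_rsqrt) (simp add: norm_sq_cinner u)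
      have "(\<lambda>m. sqrt (kernel_dist_sq k (?p m) x * (norm (u (s y m)))\<^sup>2)) \<longlonglongrightarrow> sqrt (0 * (norm (v y))\<^sup>2)"
        by (intro tendsto_intros s0 v)
      then show "(\<lambda>m. sqrt (kernel_dist_sq k (?p m) x * (norm (u (s y m)))\<^sup>2)) \<longlonglongrightarrow> 0" by simp
    qed
    moreover have "(\<lambda>m. k x (?q m) - k x y) \<longlonglongrightarrow> 0"
    proof (rule Lim_null_comparison)
      have "cmod (k x b - k x c) = cmod (k b x - k c x)" for b c
        by (metis complex_cnj_diff complex_mod_cnj positive_kernel_commute[OF k])
      then show "eventually (\<lambda>m. cmod (k x (?q m) - k x y)
          \<le> sqrt (kernel_dist_sq k (?q m) y * Re (k x x))) sequentially"
        using kernel_diff_le[OF k, of _ x y]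
        by (intro always_eventually allI real_le_rsqrt) simp
      have "(\<lambda>m. sqrt (kernel_dist_sq k (?q m) y * Re (k x x))) \<longlonglongrightarrow> sqrt (0 * Re (k x x))"
        by (intro tendsto_intros s0)
      then show "(\<lambda>m. sqrt (kernel_dist_sq k (?q m) y * Re (k x x))) \<longlonglongrightarrow> 0" by simp
    qed
    ultimately have "(\<lambda>m. k (?p m) (?q m) - k x y) \<longlonglongrightarrow> 0 + 0"
      using tendsto_add by fastforce
    then show "(\<lambda>m. cinner (u (s x m)) (u (s y m))) \<longlonglongrightarrow> k x y"
      unfolding u by (simp add: Lim_null[of _ "k x y"])
  qed
  then show ?thesis by (rule that)
qed

section \<open>Extending an isometric correspondence to a unitary operator\<close>

lemma subspace_closure:
  fixes S :: "'a::real_normed_vector set"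
  assumes S: "subspace S" shows "subspace (closure S)"
  unfolding subspace_def
proof (intro conjI ballI allI)
  show "0 \<in> closure S" using subspace_0[OF S] closure_subset by blast
  fix x c assume "x \<in> closure S"
  then obtain a where a: "\<forall>n. a n \<in> S" "a \<longlonglongrightarrow> x" by (auto simp: closure_sequential)
  show "c *\<^sub>R x \<in> closure S"
    unfolding closure_sequential
    by (intro exI[of _ "\<lambda>n. c *\<^sub>R a n"] conjI allI tendsto_intros a(2) subspace_scale[OF S] a(1)[rule_format])
  fix y assume "y \<in> closure S"
  then obtain b where b: "\<forall>n. b n \<in> S" "b \<longlonglongrightarrow> y" by (auto simp: closure_sequential)
  show "x + y \<in> closure S"
    unfolding closure_sequential
    by (intro exI[of _ "\<lambda>n. a n + b n"] conjI allI tendsto_intros a(2) b(2) subspace_add[OF S] a(1)[rule_format] b(1)[rule_format])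
qed

lemma orth_orth:
  assumes "closed S" "csubspace S" and x: "\<And>y. y \<in> orth S \<Longrightarrow> cinner x y = 0"
  shows "x \<in> S"
proof -
  have "x - proj S x \<in> orth S" "proj S x \<in> S" by (rule proj_orth[OF assms(1,2)] proj_mem[OF assms(1,2)])+
  then have "cinner (x - proj S x) (x - proj S x) = 0"
    using x[of "x - proj S x"] orth_cinner'[of "x - proj S x" S "proj S x"] by (simp add: cinner_diff_left)
  then have "x = proj S x" by simp
  then show ?thesis using \<open>proj S x \<in> S\<close> by simp
qed

text \<open>\<open>span\<close> is the real span; this is why the complex multiples are put among
  the generators.\<close>

definition isometric_graph :: "('x \<Rightarrow> 'k::complex_hilbert) \<Rightarrow> ('x \<Rightarrow> 'k) \<Rightarrow> ('k \<times> 'k) set" where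
  "isometric_graph v w = closure (span {(c *\<^sub>C v x, c *\<^sub>C w x) | c x. True})"

text \<open>A closed predicate passes from the span to its closure, so it suffices to add one
  generator at a time.\<close>

lemma isometric_graph_induct [consumes 1, case_names closed zero add]:
  assumes ab: "(a, b) \<in> isometric_graph v w" and closed: "closed {p. P (fst p) (snd p)}"
    and zero: "P 0 0" and add: "\<And>c x a b. P a b \<Longrightarrow> P (c *\<^sub>C v x + a) (c *\<^sub>C w x + b)"
  shows "P a b"
proof -
  have "P (fst p) (snd p)" if "p \<in> span {(c *\<^sub>C v x, c *\<^sub>C w x) | c x. True}" for p
    using that
  proof (induction rule: span_induct_alt)
    case (step r p q)
    then obtain c x where "p = (c *\<^sub>C v x, c *\<^sub>C w x)" by blast
    then have "r *\<^sub>R p + q = ((complex_of_real r * c) *\<^sub>C v x + fst q, (complex_of_real r * c) *\<^sub>C w x + snd q)"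
      by (simp add: scaleR_eq_scaleC scaleC_scaleC prod_eq_iff)
    then show ?case using add[OF step.IH] by simp
  qed (use zero in simp)
  then have "isometric_graph v w \<subseteq> {p. P (fst p) (snd p)}"
    unfolding isometric_graph_def using closed by (intro closure_minimal) auto
  then show ?thesis using ab by auto
qed

lemma closed_isometric_graph: "closed (isometric_graph v w)"
  by (simp add: isometric_graph_def)

lemma subspace_isometric_graph: "subspace (isometric_graph v w)"
  unfolding isometric_graph_def by (rule subspace_closure) (rule subspace_span)

lemma isometric_graph_base: "(c *\<^sub>C v x, c *\<^sub>C w x) \<in> isometric_graph v w"
  unfolding isometric_graph_def by (rule subsetD[OF closure_subset], rule span_base) blast

lemma isometric_graph_zero: "(0, 0) \<in> isometric_graph v w"
  using subspace_0[OF subspace_isometric_graph] by (simp add: zero_prod_def)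

lemma isometric_graph_add:
  "(a, b) \<in> isometric_graph v w \<Longrightarrow> (a', b') \<in> isometric_graph v w \<Longrightarrow> (a + a', b + b') \<in> isometric_graph v w"
  using subspace_add[OF subspace_isometric_graph, of "(a, b)" v w "(a', b')"] by simp

lemma isometric_graph_diff:
  "(a, b) \<in> isometric_graph v w \<Longrightarrow> (a', b') \<in> isometric_graph v w \<Longrightarrow> (a - a', b - b') \<in> isometric_graph v w"
  using subspace_diff[OF subspace_isometric_graph, of "(a, b)" v w "(a', b')"] by simp

lemma isometric_graph_scaleC:
  assumes "(a, b) \<in> isometric_graph v w" shows "(c *\<^sub>C a, c *\<^sub>C b) \<in> isometric_graph v w"
  using assms
proof (induction rule: isometric_graph_induct)
  case closed
  have "{p. (c *\<^sub>C fst p, c *\<^sub>C snd p) \<in> isometric_graph v w}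
      = (\<lambda>p. (c *\<^sub>C fst p, c *\<^sub>C snd p)) -` isometric_graph v w" by auto
  also have "closed \<dots>"
    by (intro closed_vimage closed_isometric_graph continuous_on_Pair continuous_on_scaleC continuous_intros)
  finally show ?case .
next
  case (add d x a b)
  with isometric_graph_base[of "c * d" v x w] show ?case
    using isometric_graph_add by (simp add: scaleC_algebra)
qed (simp add: isometric_graph_zero)

lemma isometric_graph_converse:
  assumes "(a, b) \<in> isometric_graph v w" shows "(b, a) \<in> isometric_graph w v"
  using assms
proof (induction rule: isometric_graph_induct)
  case closed
  have "{p. (snd p, fst p) \<in> isometric_graph w v} = (\<lambda>p. (snd p, fst p)) -` isometric_graph w v" by auto
  also have "closed \<dots>" by (intro closed_vimage closed_isometric_graph continuous_intros)
  finally show ?case .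
qed (auto intro: isometric_graph_zero isometric_graph_add isometric_graph_base)

lemma isometric_graph_cinner:
  assumes iso: "\<And>x y. cinner (w x) (w y) = cinner (v x) (v y)"
    and ab: "(a, b) \<in> isometric_graph v w" and ab': "(a', b') \<in> isometric_graph v w"
  shows "cinner b b' = cinner a a'"
proof -
  have 1: "cinner b (w x) = cinner a (v x)" for x
    using ab
  proof (induction rule: isometric_graph_induct)
    case closed
    show ?case by (intro closed_Collect_eq continuous_on_cinner continuous_intros)
  qed (simp_all add: cinner_algebra iso)
  show ?thesis
    using ab'
  proof (induction rule: isometric_graph_induct)
    case closed
    show ?case by (intro closed_Collect_eq continuous_on_cinner continuous_intros)
  qed (simp_all add: cinner_algebra 1)
qed

lemma isometric_graph_norm:
  assumes "\<And>x y. cinner (w x) (w y) = cinner (v x) (v y)" and "(a, b) \<in> isometric_graph v w"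
  shows "norm b = norm a"
  using isometric_graph_cinner[OF assms(1) assms(2) assms(2)]
  by (simp add: cinner_self power2_eq_iff_nonneg flip: of_real_power)

text \<open>The double complement is the closed complex span of \<open>v\<close>. The domain
  contains every \<open>v x\<close> and is a closed subspace, as the domain of a closed isometric
  graph.\<close>

lemma Domain_isometric_graph:
  assumes iso: "\<And>x y. cinner (w x) (w y) = cinner (v x) (v y)"
  shows "Domain (isometric_graph v w) = orth (orth (range v))"
proof (intro equalityI subsetI)
  fix a assume "a \<in> Domain (isometric_graph v w)"
  then obtain b where ab: "(a, b) \<in> isometric_graph v w" by blast
  have "cinner a y = 0" if y: "y \<in> orth (range v)" for y
    using ab
  proof (induction rule: isometric_graph_induct)
    case closed
    show ?case by (intro closed_Collect_eq continuous_on_cinner continuous_intros)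
  qed (use orth_cinner'[OF y] in \<open>simp_all add: cinner_algebra\<close>)
  then show "a \<in> orth (orth (range v))" by (simp add: orth_def[of "orth _"])
next
  let ?K = "Domain (isometric_graph v w)"
  fix a assume a: "a \<in> orth (orth (range v))"
  show "a \<in> ?K"
  proof (rule orth_orth)
    show "closed ?K"
      by (rule closed_Domain_isometric[OF closed_isometric_graph])
        (rule isometric_graph_norm[OF iso isometric_graph_diff])
    show "csubspace ?K"
      unfolding csubspace_def
      using isometric_graph_zero isometric_graph_add isometric_graph_scaleC by (meson DomainE DomainI)
    fix y assume "y \<in> orth ?K"
    then have "y \<in> orth (range v)"
      using isometric_graph_base[of 1 v _ w] by (auto simp: orth_def)
    then show "cinner a y = 0" by (rule orth_cinner[OF a])
  qed
qed

text \<open>Equal ranges make domain and range of the closed graph the same subspace, so the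
  isometry is onto it and any unitary on the complement completes it. The choice -1 has no nonzero
  fixed vectors; under the inverse Cayley transform it becomes multiplication by Re z0.\<close>

lemma unitary_extension:
  fixes v w :: "'x \<Rightarrow> 'k::complex_hilbert"
  assumes iso: "\<And>x y. cinner (w x) (w y) = cinner (v x) (v y)" and range: "range v = range w"
  obtains S where "isometric_embedding S" "surj S" "\<And>x. S (v x) = w x"
    "\<And>y. (\<And>x. cinner y (v x) = 0) \<Longrightarrow> S y = - y"
proof -
  let ?G = "isometric_graph v w"
  define K where "K = orth (orth (range v))"
  have K: "closed K" "csubspace K" unfolding K_def by (rule closed_orth csubspace_orth)+
  have Dom: "Domain ?G = K" unfolding K_def by (rule Domain_isometric_graph[OF iso])
  have Ran: "Range ?G = K"
  proof -
    have "Range ?G = Domain (isometric_graph w v)" using isometric_graph_converse by blast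
    then show ?thesis unfolding K_def range by (simp add: Domain_isometric_graph iso)
  qed
  have vK: "v x \<in> K" for x using isometric_graph_base[of 1 v x w] Dom by auto
  define U where "U a = (SOME b. (a, b) \<in> ?G)" for a
  have U: "(a, U a) \<in> ?G" if "a \<in> K" for a
    using that unfolding Dom[symmetric] U_def by (auto intro: someI)
  have U_eq: "U a = b" if ab: "(a, b) \<in> ?G" for a b
  proof -
    have "(a, U a) \<in> ?G" by (rule U) (use ab Dom in blast)
    from isometric_graph_norm[OF iso isometric_graph_diff[OF ab this]] show ?thesis by simp
  qed
  have UK: "U a \<in> K" if "a \<in> K" for a using U[OF that] Ran by blast
  let ?P = "proj K"
  note PK = proj_mem[OF K] and PO = proj_orth[OF K] and linP = contraction_clinear[OF contraction_proj[OF K]]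
  define S where "S x = U (?P x) - (x - ?P x)" for x
  have "isometric_embedding S"
    unfolding isometric_embedding_def
  proof (intro conjI allI)
    fix x y c
    have "U (?P (x + y)) = U (?P x) + U (?P y)" "U (?P (c *\<^sub>C x)) = c *\<^sub>C U (?P x)"
      unfolding clinear_add[OF linP] clinear_scaleC[OF linP]
      by (intro U_eq isometric_graph_add isometric_graph_scaleC U PK)+
    then show "S (x + y) = S x + S y" "S (c *\<^sub>C x) = c *\<^sub>C S x"
      by (simp_all add: S_def clinear_add[OF linP] clinear_scaleC[OF linP] scaleC_algebra)
    have o: "cinner a (x - ?P x) = 0" "cinner (x - ?P x) a = 0" if "a \<in> K" for a x
      using that PO[of x] by (auto intro: orth_cinner orth_cinner')
    have "cinner (S x) (S y) = cinner (U (?P x)) (U (?P y)) + cinner (x - ?P x) (y - ?P y)"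
      unfolding S_def using o[OF UK[OF PK]] by (simp only: cinner_diff_left[of "U _"] cinner_diff_right[of _ "U _"]) simp
    also have "\<dots> = cinner (?P x) (?P y) + cinner (x - ?P x) (y - ?P y)"
      by (simp add: isometric_graph_cinner[OF iso U[OF PK] U[OF PK]])
    also have "\<dots> = cinner (?P x + (x - ?P x)) (?P y + (y - ?P y))"
      using o[OF PK] by (simp only: cinner_add_left cinner_add_right) simp
    finally show "cinner (S x) (S y) = cinner x y" by simp
  qed
  moreover have "y \<in> range S" for y
  proof -
    obtain a where a: "(a, ?P y) \<in> ?G" using PK[of y] Ran by blast
    \<comment> \<open>The orthogonal part is subtracted because \<open>S\<close> reverses its
      sign.\<close>
    have "?P (a - (y - ?P y)) = a"
      using csubspace_scaleC[OF csubspace_orth PO, of "-1" y] a Dom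
      by (intro proj_eqI[OF K]) auto
    then have "S (a - (y - ?P y)) = y" by (simp add: S_def U_eq[OF a])
    then show ?thesis by (metis rangeI)
  qed
  then have "surj S" by blast
  moreover have "S (v x) = w x" for x
    using isometric_graph_base[of 1 v x w] by (simp add: S_def proj_id[OF K vK] U_eq)
  moreover have "S y = - y" if "\<And>x. cinner y (v x) = 0" for y
  proof -
    have "y \<in> orth K" using that by (auto simp: K_def orth_def cinner_eq_zero_commute[of y])
    then show ?thesis using U_eq[OF isometric_graph_zero] by (simp add: S_def proj_zero[OF K])
  qed
  ultimately show ?thesis by (rule that)
qed

section \<open>Unitary dilation of a Schur function\<close>

abbreviation unit_circle :: "real \<Rightarrow> complex" where
  "unit_circle t \<equiv> exp (2 * of_real pi * \<i> * of_real t)"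

text \<open>Cauchy's formula for derivatives on the circle of radius \<open>r\<close> if n \<ge> 0;
  otherwise the contour integrand is holomorphic and Cauchy's theorem gives 0.\<close>

lemma holomorphic_fourier_coefficient:
  fixes n :: int and r :: real
  assumes f: "f holomorphic_on ball 0 1" and r: "0 < r" "r < 1"
  shows "((\<lambda>t. f (of_real r * unit_circle t) * unit_circle t powi (- n))
    has_integral (if 0 \<le> n then (deriv ^^ nat n) f 0 / fact (nat n) * of_real r ^ nat n else 0)) {0..1}"
proof -
  have deriv: "vector_derivative (circlepath 0 r) (at t within {0..1}) = 2 * of_real pi * \<i> * of_real r * unit_circle t"
    if "t \<in> {0..1}" for t
    using vector_derivative_circlepath01[of t 0 r] that by simp
  have circ: "circlepath 0 r t = of_real r * unit_circle t" for t by (simp add: circlepath)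
  show ?thesis
  proof (cases "0 \<le> n")
    case True
    then obtain k where k: "n = int k" by (metis nonneg_int_cases)
    have "((\<lambda>u. f u / (u - 0) ^ Suc k) has_contour_integral (2 * of_real pi * \<i>) / fact k * (deriv ^^ k) f 0) (circlepath 0 r)"
    proof -
      have "f holomorphic_on cball 0 r" "f holomorphic_on ball 0 r"
        using r by (auto intro!: holomorphic_on_subset[OF f])
      then show ?thesis
        using Cauchy_has_contour_integral_higher_derivative_circlepath[of 0 r f 0 k] r
        by (simp add: holomorphic_on_imp_continuous_on del: power_Suc)
    qed
    then have "((\<lambda>t. f (circlepath 0 r t) / circlepath 0 r t ^ Suc k * vector_derivative (circlepath 0 r) (at t within {0..1}))
        has_integral (2 * of_real pi * \<i>) / fact k * (deriv ^^ k) f 0) {0..1}"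
      unfolding has_contour_integral_def by simp
    then have "((\<lambda>t. (of_real r ^ k / (2 * of_real pi * \<i>)) * (f (circlepath 0 r t) / circlepath 0 r t ^ Suc k * vector_derivative (circlepath 0 r) (at t within {0..1})))
        has_integral (of_real r ^ k / (2 * of_real pi * \<i>)) * ((2 * of_real pi * \<i>) / fact k * (deriv ^^ k) f 0)) {0..1}"
      by (rule has_integral_mult_right)
    moreover have "(of_real r ^ k / (2 * of_real pi * \<i>)) * (f (circlepath 0 r t) / circlepath 0 r t ^ Suc k * vector_derivative (circlepath 0 r) (at t within {0..1}))
        = f (of_real r * unit_circle t) * unit_circle t powi (- n)" if "t \<in> {0..1}" for t
      unfolding deriv[OF that] circ k using r
      by (simp add: power_int_minus field_simps power_mult_distrib)
    ultimately have "((\<lambda>t. f (of_real r * unit_circle t) * unit_circle t powi (- n))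
        has_integral (of_real r ^ k / (2 * of_real pi * \<i>)) * ((2 * of_real pi * \<i>) / fact k * (deriv ^^ k) f 0)) {0..1}"
      by (rule has_integral_eq[rotated]) 
    then show ?thesis using k by (simp add: field_simps)
  next
    case False
    \<comment> \<open>The shift by one accounts for the factor u that du contributes to the contour
      integral.\<close>
    then obtain k where k: "n = - int (Suc k)" by (metis int_cases not_le of_nat_0_le_iff)
    have "((\<lambda>u. f u * u ^ k) has_contour_integral 0) (circlepath 0 r)"
      using r by (intro Cauchy_theorem_disc_simple[of _ 0 1] holomorphic_intros f) auto
    then have "((\<lambda>t. f (circlepath 0 r t) * circlepath 0 r t ^ k * vector_derivative (circlepath 0 r) (at t within {0..1}))
        has_integral 0) {0..1}"
      unfolding has_contour_integral_def by simp
    then have "((\<lambda>t. (1 / (2 * of_real pi * \<i> * of_real r ^ Suc k)) * (f (circlepath 0 r t) * circlepath 0 r t ^ k * vector_derivative (circlepath 0 r) (at t within {0..1})))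
        has_integral (1 / (2 * of_real pi * \<i> * of_real r ^ Suc k)) * 0) {0..1}"
      by (rule has_integral_mult_right)
    moreover have "(1 / (2 * of_real pi * \<i> * of_real r ^ Suc k)) * (f (circlepath 0 r t) * circlepath 0 r t ^ k * vector_derivative (circlepath 0 r) (at t within {0..1}))
        = f (of_real r * unit_circle t) * unit_circle t powi (- n)" if "t \<in> {0..1}" for t
      unfolding deriv[OF that] circ k minus_minus power_int_of_nat using r
      by (simp add: field_simps power_mult_distrib)
    ultimately have "((\<lambda>t. f (of_real r * unit_circle t) * unit_circle t powi (- n))
        has_integral (1 / (2 * of_real pi * \<i> * of_real r ^ Suc k)) * 0) {0..1}"
      by (rule has_integral_eq[rotated])
    then show ?thesis using False by simp
  qed
qed

text \<open>Differentiability is pointwise in \<open>x\<close>: this gives holomorphy of the scalar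
  functions (G \<zeta> x, y), to which complex analysis is applied.\<close>

locale schur_function =
  fixes W :: "complex \<Rightarrow> 'h::complex_hilbert \<Rightarrow> 'h"
  assumes contr: "cmod \<zeta> < 1 \<Longrightarrow> contraction (W \<zeta>)"
    and diff: "cmod \<zeta> < 1 \<Longrightarrow> \<exists>L. ((\<lambda>\<omega>. inverse (\<omega> - \<zeta>) *\<^sub>C (W \<omega> x - W \<zeta> x)) \<longlongrightarrow> L) (at \<zeta>)"
begin

definition G :: "complex \<Rightarrow> 'h \<Rightarrow> 'h" where
  "G \<zeta> = neumann (W \<zeta>) \<zeta>"

lemma G_eq: "cmod \<zeta> < 1 \<Longrightarrow> G \<zeta> x = x + \<zeta> *\<^sub>C W \<zeta> (G \<zeta> x)"
  unfolding G_def by (rule neumann_eq[OF contr])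

lemma norm_G: "cmod \<zeta> < 1 \<Longrightarrow> norm (G \<zeta> x) \<le> norm x / (1 - cmod \<zeta>)"
  unfolding G_def by (rule norm_neumann[OF contr])

lemma clinear_G: "cmod \<zeta> < 1 \<Longrightarrow> clinear (G \<zeta>)"
  unfolding G_def by (rule clinear_neumann[OF contr])

lemma eventually_disc: "cmod \<zeta> < 1 \<Longrightarrow> eventually (\<lambda>\<omega>. cmod \<omega> < 1) (at \<zeta>)"
  using eventually_at_in_open'[of "ball 0 1" \<zeta>] by simp

lemma W_continuous: assumes "cmod \<zeta> < 1" shows "((\<lambda>\<omega>. W \<omega> x) \<longlongrightarrow> W \<zeta> x) (at \<zeta>)"
proof -
  obtain L where L: "((\<lambda>\<omega>. inverse (\<omega> - \<zeta>) *\<^sub>C (W \<omega> x - W \<zeta> x)) \<longlongrightarrow> L) (at \<zeta>)"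
    using diff[OF assms] by blast
  have "((\<lambda>\<omega>. (\<omega> - \<zeta>) *\<^sub>C inverse (\<omega> - \<zeta>) *\<^sub>C (W \<omega> x - W \<zeta> x)) \<longlongrightarrow> (\<zeta> - \<zeta>) *\<^sub>C L) (at \<zeta>)"
    by (intro tendsto_scaleC L tendsto_intros)
  then have "((\<lambda>\<omega>. (\<omega> - \<zeta>) *\<^sub>C inverse (\<omega> - \<zeta>) *\<^sub>C (W \<omega> x - W \<zeta> x)) \<longlongrightarrow> 0) (at \<zeta>)" by simp
  then have "((\<lambda>\<omega>. W \<omega> x - W \<zeta> x) \<longlongrightarrow> 0) (at \<zeta>)"
    by (rule Lim_transform_eventually) (auto simp: eventually_at_filter scaleC_scaleC)
  then show ?thesis by (simp add: Lim_null[of _ "W \<zeta> x"])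
qed

text \<open>The resolvent identity for a varying operator. \<open>W\<close> is evaluated at the
  fixed vector \<open>G \<zeta> x\<close>, where pointwise differentiability applies, and the
  varying \<open>G \<omega>\<close> in front is locally bounded.\<close>

lemma G_diff:
  assumes "cmod \<omega> < 1" "cmod \<zeta> < 1"
  shows "G \<omega> x - G \<zeta> x = G \<omega> (\<omega> *\<^sub>C W \<omega> (G \<zeta> x) - \<zeta> *\<^sub>C W \<zeta> (G \<zeta> x))"
proof -
  let ?d = "G \<omega> x - G \<zeta> x" and ?u = "G \<zeta> x"
  have "\<omega> *\<^sub>C W \<omega> ?d = \<omega> *\<^sub>C W \<omega> (G \<omega> x) - \<omega> *\<^sub>C W \<omega> ?u"
    by (simp add: clinear_diff[OF contraction_clinear[OF contr[OF assms(1)]]] scaleC_diff_right)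
  moreover have "?d = \<omega> *\<^sub>C W \<omega> (G \<omega> x) - \<zeta> *\<^sub>C W \<zeta> ?u"
    using G_eq[OF assms(1), of x] G_eq[OF assms(2), of x] by (metis add_diff_cancel_left)
  ultimately have "?d = (\<omega> *\<^sub>C W \<omega> ?u - \<zeta> *\<^sub>C W \<zeta> ?u) + \<omega> *\<^sub>C W \<omega> ?d" by simp
  from neumann_eqI[OF contr[OF assms(1)] assms(1) this] show ?thesis by (simp add: G_def)
qed

lemma G_bounded_tendsto:
  assumes \<zeta>: "cmod \<zeta> < 1" and q: "(q \<longlongrightarrow> 0) (at \<zeta>)"
  shows "((\<lambda>\<omega>. G \<omega> (q \<omega>)) \<longlongrightarrow> 0) (at \<zeta>)"
proof (rule Lim_null_comparison)
  show "eventually (\<lambda>\<omega>. norm (G \<omega> (q \<omega>)) \<le> norm (q \<omega>) / (1 - cmod \<omega>)) (at \<zeta>)"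
    using eventually_disc[OF \<zeta>] by eventually_elim (rule norm_G)
  have "((\<lambda>\<omega>. norm (q \<omega>) / (1 - cmod \<omega>)) \<longlongrightarrow> norm (0 :: 'h) / (1 - cmod \<zeta>)) (at \<zeta>)"
    using \<zeta> by (intro tendsto_intros q) auto
  then show "((\<lambda>\<omega>. norm (q \<omega>) / (1 - cmod \<omega>)) \<longlongrightarrow> 0) (at \<zeta>)" by simp
qed

lemma G_continuous: assumes \<zeta>: "cmod \<zeta> < 1" shows "((\<lambda>\<omega>. G \<omega> x) \<longlongrightarrow> G \<zeta> x) (at \<zeta>)"
proof -
  let ?q = "\<lambda>\<omega>. \<omega> *\<^sub>C W \<omega> (G \<zeta> x) - \<zeta> *\<^sub>C W \<zeta> (G \<zeta> x)"
  have "(?q \<longlongrightarrow> \<zeta> *\<^sub>C W \<zeta> (G \<zeta> x) - \<zeta> *\<^sub>C W \<zeta> (G \<zeta> x)) (at \<zeta>)"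
    by (intro tendsto_intros tendsto_scaleC W_continuous \<zeta>)
  then have "((\<lambda>\<omega>. G \<omega> (?q \<omega>)) \<longlongrightarrow> 0) (at \<zeta>)" by (intro G_bounded_tendsto \<zeta>) simp
  then have "((\<lambda>\<omega>. G \<omega> x - G \<zeta> x) \<longlongrightarrow> 0) (at \<zeta>)"
    by (rule Lim_transform_eventually)
      (use eventually_disc[OF \<zeta>] in \<open>eventually_elim, simp add: G_diff[OF _ \<zeta>]\<close>)
  then show ?thesis by (simp add: Lim_null[of _ "G \<zeta> x"])
qed

lemma G_holomorphic: "(\<lambda>\<zeta>. cinner (G \<zeta> x) y) holomorphic_on ball 0 1"
proof (subst holomorphic_on_open[OF open_ball], intro ballI)
  fix \<zeta> :: complex assume "\<zeta> \<in> ball 0 1"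
  then have \<zeta>: "cmod \<zeta> < 1" by simp
  let ?u = "G \<zeta> x"
  obtain L where L: "((\<lambda>\<omega>. inverse (\<omega> - \<zeta>) *\<^sub>C (W \<omega> ?u - W \<zeta> ?u)) \<longlongrightarrow> L) (at \<zeta>)"
    using diff[OF \<zeta>] by blast
  \<comment> \<open>By the product rule, \<open>q \<omega>\<close> is the difference quotient of
    \<open>\<omega> *\<^sub>C W \<omega> ?u\<close>.\<close>
  define q where "q \<omega> = W \<omega> ?u + \<zeta> *\<^sub>C inverse (\<omega> - \<zeta>) *\<^sub>C (W \<omega> ?u - W \<zeta> ?u)" for \<omega>
  define q0 where "q0 = W \<zeta> ?u + \<zeta> *\<^sub>C L"
  have "(q \<longlongrightarrow> q0) (at \<zeta>)"
    unfolding q_def q0_def by (intro tendsto_intros tendsto_scaleC W_continuous \<zeta> L)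
  then have "((\<lambda>\<omega>. q \<omega> - q0) \<longlongrightarrow> 0) (at \<zeta>)" by (simp add: Lim_null[of q])
  then have "((\<lambda>\<omega>. G \<omega> (q \<omega> - q0) + G \<omega> q0) \<longlongrightarrow> 0 + G \<zeta> q0) (at \<zeta>)"
    by (intro tendsto_add G_bounded_tendsto G_continuous \<zeta>)
  then have "((\<lambda>\<omega>. cinner (G \<omega> (q \<omega> - q0) + G \<omega> q0) y) \<longlongrightarrow> cinner (G \<zeta> q0) y) (at \<zeta>)"
    by (intro tendsto_cinner tendsto_const) simp
  moreover have "eventually (\<lambda>\<omega>. cinner (G \<omega> (q \<omega> - q0) + G \<omega> q0) y
      = (cinner (G \<omega> x) y - cinner (G \<zeta> x) y) / (\<omega> - \<zeta>)) (at \<zeta>)"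
    using eventually_disc[OF \<zeta>] eventually_neq_at_within[of \<zeta> \<zeta> UNIV]
  proof eventually_elim
    case (elim \<omega>)
    note lin = clinear_G[OF elim(1)]
    have "(\<omega> - \<zeta>) * (\<zeta> * inverse (\<omega> - \<zeta>)) = \<zeta>" using elim(2) by (simp add: field_simps)
    then have "(\<omega> - \<zeta>) *\<^sub>C q \<omega> = (\<omega> - \<zeta>) *\<^sub>C W \<omega> ?u + \<zeta> *\<^sub>C (W \<omega> ?u - W \<zeta> ?u)"
      by (simp only: q_def scaleC_scaleC scaleC_add_right)
    then have "(\<omega> - \<zeta>) *\<^sub>C q \<omega> = \<omega> *\<^sub>C W \<omega> ?u - \<zeta> *\<^sub>C W \<zeta> ?u"
      by (simp add: scaleC_algebra)
    then have "G \<omega> x - G \<zeta> x = (\<omega> - \<zeta>) *\<^sub>C G \<omega> (q \<omega>)"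
      unfolding G_diff[OF elim(1) \<zeta>] by (simp flip: clinear_scaleC[OF lin])
    then have "cinner (G \<omega> x) y - cinner (G \<zeta> x) y = (\<omega> - \<zeta>) * cinner (G \<omega> (q \<omega>)) y"
      by (simp flip: cinner_diff_left cinner_scaleC_left)
    then show ?case using elim(2) by (simp add: clinear_diff[OF lin])
  qed
  ultimately have "((\<lambda>\<omega>. (cinner (G \<omega> x) y - cinner (G \<zeta> x) y) / (\<omega> - \<zeta>)) \<longlongrightarrow> cinner (G \<zeta> q0) y) (at \<zeta>)"
    by (rule Lim_transform_eventually)
  then show "\<exists>f'. ((\<lambda>\<zeta>. cinner (G \<zeta> x) y) has_field_derivative f') (at \<zeta>)"
    unfolding has_field_derivative_iff by blast
qed

section \<open>The Toeplitz kernel of the Taylor coefficients\<close>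

definition coef :: "nat \<Rightarrow> 'h \<Rightarrow> 'h \<Rightarrow> complex" where
  "coef n x y = (deriv ^^ n) (\<lambda>\<zeta>. cinner (G \<zeta> x) y) 0 / fact n"

text \<open>The boundary Fourier coefficients of G + G* - 1. At n = 0 they give 1 + 1 - 1 = 1, in
  agreement with \<open>coef 0\<close>.\<close>

definition toeplitz :: "int \<Rightarrow> 'h \<Rightarrow> 'h \<Rightarrow> complex" where
  "toeplitz n x y = (if 0 \<le> n then coef (nat n) x y else cnj (coef (nat (- n)) y x))"

lemma G_zero: "G 0 x = x"
  using G_eq[of 0 x] by simp

lemma coef_zero: "coef 0 x y = cinner x y"
  by (simp add: coef_def G_zero)

lemma toeplitz_commute: "toeplitz (- n) y x = cnj (toeplitz n x y)"
  by (cases "n = 0") (auto simp: toeplitz_def coef_zero cinner_commute[of y x])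

text \<open>With u = G p, the difference u - p is \<zeta> W u, so contractivity says norm (u - p)
  \<le> norm u; expanding the squares gives the claim.\<close>

lemma G_real_part:
  assumes "cmod \<zeta> < 1"
  shows "0 \<le> 2 * Re (cinner (G \<zeta> p) p) - (norm p)\<^sup>2"
proof -
  let ?u = "G \<zeta> p" and ?w = "\<zeta> *\<^sub>C W \<zeta> (G \<zeta> p)"
  have "norm ?w \<le> 1 * norm ?u"
    unfolding norm_scaleC using assms by (intro mult_mono contraction_norm[OF contr]) auto
  then have "(norm ?w)\<^sup>2 \<le> (norm ?u)\<^sup>2" by (intro power_mono) auto
  moreover have "?w = ?u - p" using G_eq[OF assms, of p] by (simp add: algebra_simps)
  ultimately have "(norm (?u - p))\<^sup>2 \<le> (norm ?u)\<^sup>2" by simp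
  then show ?thesis by (simp add: norm_diff_sq)
qed

text \<open>The first summand carries the nonnegative frequencies, the second the nonpositive ones,
  and the third corrects the constant counted twice.\<close>

lemma toeplitz_integral:
  fixes n :: int and r :: real
  assumes r: "0 < r" "r < 1"
  shows "((\<lambda>t. (cinner (G (of_real r * unit_circle t) x) y
      + cnj (cinner (G (of_real r * unit_circle t) y) x) - cinner x y)
      * unit_circle t powi (- n))
    has_integral toeplitz n x y * of_real (r ^ nat \<bar>n\<bar>)) {0..1}"
proof -
  have "((\<lambda>t. cinner (G (of_real r * unit_circle t) x) y * unit_circle t powi (- n))
      has_integral (if 0 \<le> n then coef (nat n) x y * of_real r ^ nat n else 0)) {0..1}"
    using holomorphic_fourier_coefficient[OF G_holomorphic r, of x y n] unfolding coef_def .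
  moreover have "((\<lambda>t. cnj (cinner (G (of_real r * unit_circle t) y) x * unit_circle t powi (- (- n))))
      has_integral cnj (if 0 \<le> - n then coef (nat (- n)) y x * of_real r ^ nat (- n) else 0)) {0..1}"
    using iffD2[OF has_integral_cnj holomorphic_fourier_coefficient[OF G_holomorphic r, of y x "- n"]]
    unfolding coef_def o_def .
  moreover have "((\<lambda>t. cinner x y * unit_circle t powi (- n)) has_integral (if n = 0 then cinner x y else 0)) {0..1}"
    using holomorphic_fourier_coefficient[of "\<lambda>_. cinner x y", OF _ r, of n]
    by (auto simp: higher_deriv_const split: if_splits)
  ultimately have "((\<lambda>t. cinner (G (of_real r * unit_circle t) x) y * unit_circle t powi (- n)
      + cnj (cinner (G (of_real r * unit_circle t) y) x * unit_circle t powi (- (- n))) - cinner x y * unit_circle t powi (- n))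
    has_integral (if 0 \<le> n then coef (nat n) x y * of_real r ^ nat n else 0)
      + cnj (if 0 \<le> - n then coef (nat (- n)) y x * of_real r ^ nat (- n) else 0) - (if n = 0 then cinner x y else 0)) {0..1}"
    by (intro has_integral_add has_integral_diff)
  moreover have "cnj (unit_circle t powi n) = unit_circle t powi (- n)" for t
    by (simp add: exp_cnj exp_minus power_int_minus power_int_inverse flip: exp_power_int)
  moreover have "(if 0 \<le> n then coef (nat n) x y * of_real r ^ nat n else 0)
      + cnj (if 0 \<le> - n then coef (nat (- n)) y x * of_real r ^ nat (- n) else 0) - (if n = 0 then cinner x y else 0)
      = toeplitz n x y * of_real (r ^ nat \<bar>n\<bar>)"
    by (auto simp: toeplitz_def coef_zero cinner_commute[of y x])
  ultimately show ?thesis by (simp add: algebra_simps)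
qed

text \<open>For r < 1 the damped quadratic form is the integral over the circle of 2 Re (G s, s) -
  |s|^2 for a combination s of the given vectors, hence nonnegative. The sums are finite, so r may
  tend to 1.\<close>

lemma positive_kernel_toeplitz:
  "positive_kernel (\<lambda>p q. toeplitz (fst p - fst q) (snd p) (snd q))"
  unfolding positive_kernel_def
proof (intro conjI allI)
  fix p q :: "int \<times> 'h"
  show "toeplitz (fst q - fst p) (snd q) (snd p) = cnj (toeplitz (fst p - fst q) (snd p) (snd q))"
    using toeplitz_commute[of "fst p - fst q"] by simp
next
  fix N :: nat and p :: "nat \<Rightarrow> int \<times> 'h" and a :: "nat \<Rightarrow> complex"
  define n where "n i = fst (p i)" for i
  define x where "x i = snd (p i)" for i
  have nonneg: "0 \<le> Re (\<Sum>i<N. \<Sum>j<N. a i * cnj (a j) * (toeplitz (n i - n j) (x i) (x j) * of_real (r ^ nat \<bar>n i - n j\<bar>)))"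
    if r: "0 < r" "r < 1" for r
  proof -
    define \<Phi> where "\<Phi> t = (\<Sum>i<N. \<Sum>j<N. a i * cnj (a j) * ((cinner (G (of_real r * unit_circle t) (x i)) (x j)
        + cnj (cinner (G (of_real r * unit_circle t) (x j)) (x i)) - cinner (x i) (x j)) * unit_circle t powi (- (n i - n j))))" for t
    have "(\<Phi> has_integral (\<Sum>i<N. \<Sum>j<N. a i * cnj (a j) * (toeplitz (n i - n j) (x i) (x j) * of_real (r ^ nat \<bar>n i - n j\<bar>)))) {0..1}"
      unfolding \<Phi>_def by (intro has_integral_sum has_integral_mult_right toeplitz_integral r finite_lessThan)
    then have "((\<lambda>t. Re (\<Phi> t)) has_integral Re (\<Sum>i<N. \<Sum>j<N. a i * cnj (a j) * (toeplitz (n i - n j) (x i) (x j) * of_real (r ^ nat \<bar>n i - n j\<bar>)))) {0..1}"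
      by (rule has_integral_linear[OF _ bounded_linear_Re, unfolded o_def])
    then show ?thesis
    proof (rule has_integral_nonneg)
      fix t :: real assume "t \<in> {0..1}"
      define \<zeta> where "\<zeta> = of_real r * unit_circle t"
      have \<zeta>: "cmod \<zeta> < 1" using r by (simp add: \<zeta>_def norm_mult)
      note lin = clinear_G[OF \<zeta>]
      \<comment> \<open>The exponential of n i - n j factors into one part for i and the conjugate
        of one for j, to be absorbed into the coefficients.\<close>
      define b where "b i = a i * unit_circle t powi (- n i)" for i
      define s where "s = (\<Sum>i<N. b i *\<^sub>C x i)"
      have Eb: "a i * cnj (a j) * (z * unit_circle t powi (- (n i - n j))) = b i * cnj (b j) * z" for i j z
      proof -
        have "cnj (unit_circle t powi (- n j)) = unit_circle t powi (n j)"
          by (simp add: exp_cnj exp_minus power_int_minus power_int_inverse flip: exp_power_int)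
        then show ?thesis
          by (simp add: b_def power_int_diff power_int_minus field_simps)
      qed
      have sumC: "cinner (\<Sum>i<N. c i *\<^sub>C y i) z = (\<Sum>i<N. c i * cinner (y i) z)"
        "cinner z (\<Sum>i<N. c i *\<^sub>C y i) = (\<Sum>i<N. cnj (c i) * cinner z (y i))" for c y and z :: 'h
        by (induction N) (simp_all add: cinner_algebra)
      have Gs: "G \<zeta> s = (\<Sum>i<N. b i *\<^sub>C G \<zeta> (x i))"
        unfolding s_def by (induction N) (simp_all add: clinear_zero[OF lin] clinear_add[OF lin] clinear_scaleC[OF lin])
      have "\<Phi> t = (\<Sum>i<N. \<Sum>j<N. b i * cnj (b j) * (cinner (G \<zeta> (x i)) (x j)
        + cnj (cinner (G \<zeta> (x j)) (x i)) - cinner (x i) (x j)))"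
        unfolding \<Phi>_def Eb \<zeta>_def ..
      also have "\<dots> = (\<Sum>i<N. \<Sum>j<N. b i * cnj (b j) * cinner (G \<zeta> (x i)) (x j))
        + (\<Sum>i<N. \<Sum>j<N. b i * cnj (b j) * cnj (cinner (G \<zeta> (x j)) (x i)))
        - (\<Sum>i<N. \<Sum>j<N. b i * cnj (b j) * cinner (x i) (x j))"
        by (simp add: distrib_left right_diff_distrib sum.distrib sum_subtractf)
      also have "(\<Sum>i<N. \<Sum>j<N. b i * cnj (b j) * cinner (G \<zeta> (x i)) (x j)) = cinner (G \<zeta> s) s"
        unfolding Gs unfolding s_def sumC(1) unfolding sumC(2) by (simp add: sum_distrib_left mult_ac)
      also have "(\<Sum>i<N. \<Sum>j<N. b i * cnj (b j) * cnj (cinner (G \<zeta> (x j)) (x i))) = cnj (cinner (G \<zeta> s) s)"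
        unfolding Gs unfolding s_def sumC(1) unfolding sumC(2) by (subst sum.swap) (simp add: sum_distrib_left mult_ac)
      also have "(\<Sum>i<N. \<Sum>j<N. b i * cnj (b j) * cinner (x i) (x j)) = cinner s s"
        unfolding s_def sumC(1) unfolding sumC(2) by (simp add: sum_distrib_left mult_ac)
      finally have "Re (\<Phi> t) = 2 * Re (cinner (G \<zeta> s) s) - (norm s)\<^sup>2"
        by (simp add: norm_sq_cinner)
      then show "0 \<le> Re (\<Phi> t)" using G_real_part[OF \<zeta>, of s] by simp
    qed
  qed
  let ?f = "\<lambda>r. Re (\<Sum>i<N. \<Sum>j<N. a i * cnj (a j) * (toeplitz (n i - n j) (x i) (x j) * of_real (r ^ nat \<bar>n i - n j\<bar>)))"
  have "(?f \<longlongrightarrow> ?f 1) (at_left 1)"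
    by (intro tendsto_intros)
  moreover have "eventually (\<lambda>r. 0 \<le> ?f r) (at_left 1)"
    using eventually_at_left_real[OF zero_less_one[where 'a = real]] by (rule eventually_mono) (use nonneg in auto)
  ultimately have "0 \<le> ?f 1"
    by (rule tendsto_lowerbound) simp
  then show "0 \<le> Re (\<Sum>i<N. \<Sum>j<N. a i * cnj (a j) * toeplitz (fst (p i) - fst (p j)) (snd (p i)) (snd (p j)))"
    by (simp add: n_def x_def)
qed

text \<open>The dilation is \<open>v (n, x) = S^n (V x)\<close>, realized by the Toeplitz kernel of the
  Taylor coefficients of \<open>G = (1 - \<zeta> W)^(-1)\<close>; off the span of these vectors \<open>S = -1\<close>, so that no
  fixed vector is orthogonal to the range of \<open>V\<close>.\<close>
theorem unitary_dilation_exists: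
  obtains V :: "'h \<Rightarrow> ell2" and S :: "ell2 \<Rightarrow> ell2"
  where "unitary_dilation V S"
    and "\<And>\<zeta> x. cmod \<zeta> < 1 \<Longrightarrow> unitary_dilation.charfun V S \<zeta> x = W \<zeta> x"
    and "\<And>y. S y = y \<Longrightarrow> (\<And>g. cinner y (V g) = 0) \<Longrightarrow> y = 0"
proof -
  let ?k = "\<lambda>p q :: int \<times> 'h. toeplitz (fst p - fst q) (snd p) (snd q)"
  obtain Q :: "'h set" where Q: "countable Q" "\<And>U. open U \<Longrightarrow> U \<noteq> {} \<Longrightarrow> \<exists>q\<in>Q. q \<in> U"
    using countable_dense_exists by metis
  \<comment> \<open>Indices with the same integer are as far apart as their vectors in H, so all
    integers paired with a dense set are dense for the kernel.\<close>
  let ?D = "(UNIV :: int set) \<times> Q"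
  have D: "countable ?D" "?D \<noteq> {}" using Q(1) Q(2)[of UNIV] by auto
  have "\<exists>m. kernel_dist_sq ?k (from_nat_into ?D m) p < e" if e: "0 < e" for p e
  proof -
    obtain n x where p: "p = (n, x)" by (cases p)
    have "ball x (sqrt e) \<noteq> {}" using e by simp
    then obtain q where q: "q \<in> Q" "dist x q < sqrt e" using Q(2)[OF open_ball] by (metis mem_ball)
    obtain m where m: "from_nat_into ?D m = (n, q)"
      using from_nat_into_surj[OF D(1), of "(n, q)"] q(1) by auto
    have "kernel_dist_sq ?k (n, q) p = (norm (q - x))\<^sup>2"
      unfolding norm_diff_sq by (simp add: kernel_dist_sq_def p toeplitz_def coef_zero norm_sq_cinner)
    also have "\<dots> < (sqrt e)\<^sup>2"
      using q(2) by (intro power_strict_mono) (auto simp: dist_norm norm_minus_commute)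
    finally have "kernel_dist_sq ?k (from_nat_into ?D m) p < e" using e unfolding m by simp
    then show ?thesis by blast
  qed
  then obtain v :: "int \<times> 'h \<Rightarrow> ell2" where "\<And>p q. cinner (v p) (v q) = ?k p q"
    using positive_kernel_ell2[OF positive_kernel_toeplitz] by blast
  then have v: "cinner (v (n, x)) (v (m, y)) = toeplitz (n - m) x y" for n m x y by simp
  have t0: "toeplitz 0 x y = cinner x y" for x y by (simp add: toeplitz_def coef_zero)
  let ?shift = "\<lambda>p :: int \<times> 'h. (fst p + 1, snd p)"
  have iso: "cinner (v (?shift p)) (v (?shift q)) = cinner (v p) (v q)" for p q
    using v[of "fst p" "snd p" "fst q" "snd q"] by (simp add: v)
  have range: "range v = range (\<lambda>p. v (?shift p))"
  proof -
    have "v p \<in> range (\<lambda>p. v (?shift p))" for p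
      by (rule range_eqI[of _ _ "(fst p - 1, snd p)"]) simp
    then show ?thesis by auto
  qed
  obtain S where Sp: "isometric_embedding S" "surj S" "\<And>p. S (v p) = v (?shift p)"
    "\<And>y. (\<And>p. cinner y (v p) = 0) \<Longrightarrow> S y = - y"
    using unitary_extension[of "\<lambda>p. v (?shift p)" v, OF iso range] by metis
  define V where "V x = v (0, x)" for x
  have V: "isometric_embedding V"
    unfolding isometric_embedding_def
  proof (intro conjI allI)
    fix x y c
    show c: "cinner (V x) (V y) = cinner x y" for x y by (simp add: V_def v t0)
    \<comment> \<open>The kernel vectors carry no linearity of their own; it follows since the
      defect has norm 0 by the inner products of H.\<close>
    have "cinner (V (x + y) - V x - V y) (V (x + y) - V x - V y) = 0"
      by (simp add: cinner_algebra c)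
    then have "V (x + y) - V x - V y = 0" by (simp only: cinner_self_eq_zero)
    then show "V (x + y) = V x + V y" by (simp add: algebra_simps)
    have "cinner (V (c *\<^sub>C x) - c *\<^sub>C V x) (V (c *\<^sub>C x) - c *\<^sub>C V x) = 0"
      by (simp add: cinner_algebra c)
    then show "V (c *\<^sub>C x) = c *\<^sub>C V x" by (simp only: cinner_self_eq_zero right_minus_eq)
  qed
  interpret unitary_dilation V S by standard (rule V Sp)+
  note linS = isometric_clinear[OF Sp(1)]
  have powS: "(S ^^ n) (v (m, x)) = v (m + int n, x)" for n m x
    by (induction n) (simp_all add: Sp(3) algebra_simps)
  have char_ne: "charfun \<zeta> x = W \<zeta> x" if \<zeta>: "cmod \<zeta> < 1" "\<zeta> \<noteq> 0" for \<zeta> x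
  proof -
    define w where "w = charfun \<zeta> x"
    define u where "u = V x + \<zeta> *\<^sub>C state \<zeta> x"
    \<comment> \<open>Eliminating the state h from u = V x + \<zeta> h and S u = V w + h leaves (1 -
      \<zeta> S) u = V x'.\<close>
    define x' where "x' = x - \<zeta> *\<^sub>C w"
    have u: "u = V x' + \<zeta> *\<^sub>C S u"
      using unitary_state[OF \<zeta>(1), of x] isometric_clinear[OF V]
      by (simp add: u_def x'_def w_def clinear_diff clinear_scaleC scaleC_algebra)
    \<comment> \<open>The Neumann series of \<open>S\<close> with remainder. Projected to H, the
      left side becomes x and the series becomes G x', so G x' = x; the equation of \<open>G\<close>
      then reads x = x' + \<zeta> W x.\<close>
    have iter: "u = (\<Sum>n<N. \<zeta> ^ n *\<^sub>C (S ^^ n) (V x')) + \<zeta> ^ N *\<^sub>C (S ^^ N) u" for N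
    proof (induction N)
      case (Suc N)
      have e: "(S ^^ N) u = (S ^^ N) (V x') + \<zeta> *\<^sub>C (S ^^ Suc N) u"
      proof -
        have lin: "clinear (S ^^ N)"
          by (induction N) (simp_all add: clinear_def clinear_add[OF linS] clinear_scaleC[OF linS])
        show ?thesis
          by (subst u) (simp add: clinear_add[OF lin] clinear_scaleC[OF lin] funpow_swap1)
      qed
      have "\<zeta> ^ N *\<^sub>C (S ^^ N) u = \<zeta> ^ N *\<^sub>C (S ^^ N) (V x') + \<zeta> ^ Suc N *\<^sub>C (S ^^ Suc N) u"
        by (subst e) (simp add: scaleC_add_right scaleC_scaleC mult.commute)
      then show ?case using Suc.IH by (simp add: add.assoc)
    qed simp
    have "cinner (G \<zeta> x') y = cinner x y" for y
    proof -
      have "(\<lambda>n. coef n x' y * \<zeta> ^ n) sums cinner (G \<zeta> x') y"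
        using holomorphic_power_series[OF G_holomorphic, of \<zeta>] \<zeta>(1) by (simp add: coef_def)
      then have "(\<lambda>N. \<Sum>n<N. coef n x' y * \<zeta> ^ n) \<longlonglongrightarrow> cinner (G \<zeta> x') y" by (simp add: sums_def)
      moreover have "(\<Sum>n<N. coef n x' y * \<zeta> ^ n) = cinner x y - \<zeta> ^ N * cinner ((S ^^ N) u) (V y)" for N
      proof -
        have "cinner u (V y) = cinner x y"
          by (simp add: u_def cinner_add_left cinner_scaleC_left state_orth[OF \<zeta>(1)] isometric_cinner[OF V])
        moreover have "cinner ((S ^^ n) (V x')) (V y) = coef n x' y" for n
          by (simp add: V_def powS v toeplitz_def)
        then have "cinner (\<Sum>n<N. \<zeta> ^ n *\<^sub>C (S ^^ n) (V x')) (V y) = (\<Sum>n<N. coef n x' y * \<zeta> ^ n)"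
          by (induction N) (simp_all add: cinner_algebra mult.commute)
        ultimately show ?thesis
          using arg_cong[OF iter[of N], of "\<lambda>a. cinner a (V y)"]
          by (simp add: cinner_add_left cinner_scaleC_left eq_diff_eq)
      qed
      moreover have "(\<lambda>N. cinner x y - \<zeta> ^ N * cinner ((S ^^ N) u) (V y)) \<longlonglongrightarrow> cinner x y - 0"
      proof (intro tendsto_diff tendsto_const)
        have "norm ((S ^^ N) u) = norm u" for N
          by (induction N) (simp_all add: isometric_norm[OF Sp(1)])
        then have b: "cmod (\<zeta> ^ N * cinner ((S ^^ N) u) (V y)) \<le> cmod \<zeta> ^ N * (norm u * norm (V y))" for N
          using norm_cinner_le[of "(S ^^ N) u" "V y"] by (simp add: norm_mult norm_power mult_left_mono)
        have lim: "(\<lambda>N. cmod \<zeta> ^ N * (norm u * norm (V y))) \<longlonglongrightarrow> 0 * (norm u * norm (V y))"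
          using \<zeta>(1) by (intro tendsto_mult tendsto_const LIMSEQ_power_zero) simp
        show "(\<lambda>N. \<zeta> ^ N * cinner ((S ^^ N) u) (V y)) \<longlonglongrightarrow> 0"
          by (rule Lim_null_comparison[OF always_eventually[OF allI[OF b]]]) (use lim in simp)
      qed
      ultimately have "(\<lambda>N. \<Sum>n<N. coef n x' y * \<zeta> ^ n) \<longlonglongrightarrow> cinner (G \<zeta> x') y"
        "(\<lambda>N. \<Sum>n<N. coef n x' y * \<zeta> ^ n) \<longlonglongrightarrow> cinner x y" by simp_all
      then show ?thesis by (rule LIMSEQ_unique)
    qed
    then have "G \<zeta> x' = x" by (rule cinner_eqI)
    then have "x = x' + \<zeta> *\<^sub>C W \<zeta> x" using G_eq[OF \<zeta>(1), of x'] by simp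
    then have "\<zeta> *\<^sub>C w = \<zeta> *\<^sub>C W \<zeta> x" by (simp add: x'_def algebra_simps)
    then have "inverse \<zeta> *\<^sub>C \<zeta> *\<^sub>C w = inverse \<zeta> *\<^sub>C \<zeta> *\<^sub>C W \<zeta> x" by (rule arg_cong)
    then show ?thesis using \<zeta>(2) by (simp add: scaleC_scaleC w_def)
  qed
  have char: "charfun \<zeta> x = W \<zeta> x" if \<zeta>: "cmod \<zeta> < 1" for \<zeta> x
  proof (cases "\<zeta> = 0")
    case True
    \<comment> \<open>At 0 the factor \<zeta> cannot be cancelled, so the value comes from
      continuity of both functions.\<close>
    have "((\<lambda>\<omega>. charfun \<omega> x) \<longlongrightarrow> W 0 x) (at 0)"
    proof (rule Lim_transform_eventually)
      show "((\<lambda>\<omega>. W \<omega> x) \<longlongrightarrow> W 0 x) (at 0)" by (rule W_continuous) simp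
      show "eventually (\<lambda>\<omega>. W \<omega> x = charfun \<omega> x) (at 0)"
        by (rule eventually_mono[OF eventually_conj[OF eventually_disc[of 0] eventually_neq_at_within[of 0 0 UNIV]]])
          (auto simp: char_ne)
    qed
    moreover have "((\<lambda>\<omega>. charfun \<omega> x) \<longlongrightarrow> charfun 0 x) (at 0)"
    proof -
      have "((\<lambda>\<omega>. charfun \<omega> x - charfun 0 x) \<longlongrightarrow> 0) (at 0)"
      proof (rule Lim_null_comparison)
        show "eventually (\<lambda>\<omega>. norm (charfun \<omega> x - charfun 0 x) \<le> cmod \<omega> * (norm (state 0 x) / (1 - cmod \<omega>))) (at 0)"
        proof (rule eventually_mono[OF eventually_disc])
          fix \<omega> :: complex assume \<omega>: "cmod \<omega> < 1"
          have "norm (compr (S (neumann T \<omega> (state 0 x)))) \<le> norm (state 0 x) / (1 - cmod \<omega>)"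
            by (rule order_trans[OF contraction_norm[OF contraction_comp[OF contraction_compr contraction_S]]
                  norm_neumann[OF contraction_T \<omega>]])
          then show "norm (charfun \<omega> x - charfun 0 x) \<le> cmod \<omega> * (norm (state 0 x) / (1 - cmod \<omega>))"
            using charfun_diff[OF \<omega>, of 0 x] by (simp add: mult_left_mono del: times_divide_eq_right)
        qed simp
        have "((\<lambda>\<omega>. cmod \<omega> * (norm (state 0 x) / (1 - cmod \<omega>))) \<longlongrightarrow> cmod 0 * (norm (state 0 x) / (1 - cmod 0))) (at 0)"
          by (intro tendsto_intros) auto
        then show "((\<lambda>\<omega>. cmod \<omega> * (norm (state 0 x) / (1 - cmod \<omega>))) \<longlongrightarrow> 0) (at 0)" by simp
      qed
      then show ?thesis by (simp add: Lim_null[of _ "charfun 0 x"])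
    qed
    ultimately have "charfun 0 x = W 0 x" by (intro tendsto_unique[of "at (0 :: complex)"]) auto
    then show ?thesis by (simp add: True)
  qed (rule char_ne[OF \<zeta>])
  have fixed: "y = 0" if Sy: "S y = y" and y: "\<And>g. cinner y (V g) = 0" for y
  proof -
    \<comment> \<open>The products of a fixed \<open>y\<close> with v (n, x) do not depend on n, so
      orthogonality to the range of \<open>V\<close>, the case n = 0, propagates to all n, and then
      \<open>S y = - y\<close>.\<close>
    have shift: "cinner y (v (n + 1, x)) = cinner y (v (n, x))" for n x
      using isometric_cinner[OF Sp(1), of y "v (n, x)"] by (simp add: Sp(3) Sy)
    have "cinner y (v (n, x)) = 0" for n x
    proof (induction n rule: int_induct[of _ 0])
      case base
      then show ?case using y[of x] by (simp add: V_def)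
    next
      case (step1 i)
      then show ?case by (simp add: shift)
    next
      case (step2 i)
      then show ?case using shift[of "i - 1" x] by simp
    qed
    then have "S y = - y" by (intro Sp(4)) (metis prod.collapse)
    then have "y + y = 0" using Sy by (metis add.right_inverse)
    then have "2 *\<^sub>R y = 0" by (simp add: scaleR_2)
    then show "y = 0" by simp
  qed
  show ?thesis
    by (rule that[OF unitary_dilation_axioms char fixed])
qed

end

section \<open>Every admissible function gives a generalized resolvent\<close>

definition disc_map_inv :: "complex \<Rightarrow> complex \<Rightarrow> complex" where
  "disc_map_inv z0 \<zeta> = (z0 - \<zeta> * cnj z0) / (1 - \<zeta>)"

lemma disc_map_inv_disc_map: "z \<in> half_plane z0 \<Longrightarrow> disc_map_inv z0 (disc_map z0 z) = z"
proof -
  assume z: "z \<in> half_plane z0"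
  note d = half_plane_neq_cnj[OF z] and k = not_Reals_diff_cnj[OF half_plane_not_Reals(2)[OF z]]
  have "z0 - disc_map z0 z * cnj z0 = z * ((z0 - cnj z0) / (z - cnj z0))"
    using d by (simp add: disc_map_def field_simps)
  then show ?thesis using d k by (simp add: disc_map_inv_def one_minus_disc_map[OF z])
qed

lemma disc_map_inv_half_plane:
  assumes z0: "z0 \<notin> \<real>" and \<zeta>: "cmod \<zeta> < 1"
  shows "disc_map_inv z0 \<zeta> \<in> half_plane z0"
proof -
  let ?z = "disc_map_inv z0 \<zeta>" and ?k = "z0 - cnj z0"
  have ne: "1 - \<zeta> \<noteq> 0" using \<zeta> by auto
  define q where "q = ?k / (1 - \<zeta>)"
  have "q \<noteq> 0" using ne not_Reals_diff_cnj[OF z0] by (simp add: q_def)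
  moreover have "?z - cnj z0 = q" "?z - z0 = \<zeta> * q"
    using ne by (simp_all add: q_def disc_map_inv_def field_simps)
  ultimately have "cmod (?z - z0) < cmod (?z - cnj z0)"
    using \<zeta> by (simp only: norm_mult) simp
  then have "(cmod (?z - z0))\<^sup>2 < (cmod (?z - cnj z0))\<^sup>2" by (intro power_strict_mono) auto
  moreover have "(cmod (?z - cnj z0))\<^sup>2 - (cmod (?z - z0))\<^sup>2 = 4 * (Im ?z * Im z0)"
    unfolding cmod_power2 by (simp add: power2_eq_square algebra_simps)
  ultimately show ?thesis by (simp add: half_plane_def)
qed

lemma disc_map_inv_inj:
  assumes z0: "z0 \<notin> \<real>" and "cmod \<zeta> < 1" "cmod \<omega> < 1" "disc_map_inv z0 \<zeta> = disc_map_inv z0 \<omega>"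
  shows "\<zeta> = \<omega>"
proof -
  have ne: "1 - \<zeta> \<noteq> 0" "1 - \<omega> \<noteq> 0" using assms(2,3) by auto
  have "disc_map_inv z0 \<eta> - cnj z0 = (z0 - cnj z0) / (1 - \<eta>)" if "1 - \<eta> \<noteq> 0" for \<eta>
    using that by (simp add: disc_map_inv_def field_simps)
  from this[OF ne(1)] this[OF ne(2)] have "(z0 - cnj z0) / (1 - \<zeta>) = (z0 - cnj z0) / (1 - \<omega>)"
    unfolding assms(4) by (rule trans[OF sym])
  then have "1 - \<zeta> = 1 - \<omega>" using not_Reals_diff_cnj[OF z0] unfolding divide_cancel_left by blast
  then show ?thesis by simp
qed

lemma disc_map_inv_deriv:
  assumes "cmod \<zeta> < 1"
  shows "\<exists>d. (disc_map_inv z0 has_field_derivative d) (at \<zeta>)"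
proof -
  have "1 - \<zeta> \<noteq> 0" using assms by auto
  then have "((\<lambda>\<zeta>. (z0 - \<zeta> * cnj z0) / (1 - \<zeta>)) has_field_derivative
      ((- cnj z0) * (1 - \<zeta>) - (z0 - \<zeta> * cnj z0) * (- 1)) / ((1 - \<zeta>) * (1 - \<zeta>))) (at \<zeta>)"
    by (intro DERIV_divide) (auto intro!: derivative_eq_intros)
  then show ?thesis unfolding disc_map_inv_def[abs_def] by blast
qed

text \<open>Every sector contains a half of the imaginary axis. This makes limits along the filter
  unique.\<close>

lemma sector_filter_nontrivial:
  assumes z0: "z0 \<notin> \<real>" and \<epsilon>: "0 < \<epsilon>" "\<epsilon> < pi / 2"
  shows "inf at_infinity (principal (sector z0 \<epsilon>)) \<noteq> bot"
proof
  assume "inf at_infinity (principal (sector z0 \<epsilon>)) = bot"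
  then have "eventually (\<lambda>_. False) (inf at_infinity (principal (sector z0 \<epsilon>)))" by simp
  then have "eventually (\<lambda>z. z \<in> sector z0 \<epsilon> \<longrightarrow> False) at_infinity"
    unfolding eventually_inf_principal .
  then obtain b where b: "\<And>z. b \<le> cmod z \<Longrightarrow> z \<notin> sector z0 \<epsilon>"
    unfolding eventually_at_infinity by blast
  define r where "r = \<bar>b\<bar> + 1"
  have r: "0 < r" "b \<le> r" by (simp_all add: r_def)
  define z where "z = (if 0 < Im z0 then of_real r * \<i> else of_real r * (- \<i>))"
  have Arg: "Arg (of_real r * \<i>) = pi / 2" "Arg (of_real r * (- \<i>)) = - pi / 2"
    by (simp_all only: Arg_times_of_real[OF r(1)] Arg_ii Arg_minus_ii)
  have "\<bar>Arg z\<bar> = pi / 2"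
    unfolding z_def by (cases "0 < Im z0"; simp only: if_True if_False Arg; simp)
  moreover have "0 < Im z * Im z0"
    using r z0 by (auto simp: z_def complex_is_Real_iff zero_less_mult_iff)
  ultimately have "z \<in> sector z0 \<epsilon>" using \<epsilon> by (simp add: sector_def half_plane_def)
  moreover have "b \<le> cmod z" using r by (simp add: z_def norm_mult)
  ultimately show False using b by blast
qed

section \<open>Fixed vectors and nontangential limits\<close>

context unitary_dilation
begin

text \<open>At \<zeta> = 1 the fixed vector itself solves the dilation equation, with state
  \<open>rest y\<close> and value \<open>compr y\<close>. The estimates say how closely the solution
  at \<zeta> stays to it; \<open>C\<close> is the aperture of a Stolz region.\<close>

lemma fixed_vector_bounds:
  assumes y: "S y = y" and \<zeta>: "cmod \<zeta> < 1" and C: "cmod (1 - \<zeta>) \<le> C * (1 - cmod \<zeta>)"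
  shows "norm (state \<zeta> (compr y) - rest y) \<le> C * norm (rest y)"
    and "(norm (charfun \<zeta> (compr y) - compr y))\<^sup>2 \<le> cmod (1 - \<zeta>) * (2 * C + cmod (1 - \<zeta>)) * (norm (rest y))\<^sup>2"
proof -
  let ?g = "compr y" and ?h = "rest y"
  let ?d = "state \<zeta> ?g - ?h"
  note linT = linT and linS = linS
    and linV = linV
  have yd: "y = V ?g + ?h" by (simp add: rest_def)
  have h: "?h = T (V ?g) + T ?h"
    using yd y by (metis clinear_add[OF linT])
  have st: "state \<zeta> ?g = T (V ?g) + \<zeta> *\<^sub>C T (state \<zeta> ?g)"
    unfolding state_def by (rule neumann_eq[OF contraction_T \<zeta>])
  \<comment> \<open>The deviation solves a Neumann equation whose right side has the factor \<zeta>
    - 1; the hypothesis on \<open>C\<close> absorbs the quotient by 1 - |\<zeta>|.\<close>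
  have "?d = \<zeta> *\<^sub>C T (state \<zeta> ?g) - T ?h"
    using st h by (metis add_diff_cancel_left)
  also have "\<dots> = (\<zeta> - 1) *\<^sub>C T ?h + \<zeta> *\<^sub>C T ?d"
    by (simp add: clinear_diff[OF linT] scaleC_algebra)
  finally have "neumann T \<zeta> ((\<zeta> - 1) *\<^sub>C T ?h) = ?d"
    by (rule neumann_eqI[OF contraction_T \<zeta>])
  then have "norm ?d \<le> norm ((\<zeta> - 1) *\<^sub>C T ?h) / (1 - cmod \<zeta>)"
    using norm_neumann[OF contraction_T \<zeta>, of "(\<zeta> - 1) *\<^sub>C T ?h"] by simp
  also have "\<dots> \<le> (cmod (1 - \<zeta>) * norm ?h) / (1 - cmod \<zeta>)"
  proof (intro divide_right_mono)
    show "norm ((\<zeta> - 1) *\<^sub>C T ?h) \<le> cmod (1 - \<zeta>) * norm ?h"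
      using contraction_norm[OF contraction_T, of ?h] by (simp add: norm_minus_commute mult_left_mono)
  qed (use \<zeta> in simp)
  also have "\<dots> \<le> (C * (1 - cmod \<zeta>) * norm ?h) / (1 - cmod \<zeta>)"
    using C \<zeta> by (intro divide_right_mono mult_right_mono) auto
  finally show d: "norm ?d \<le> C * norm ?h" using \<zeta> by simp
  let ?e = "cmod (1 - \<zeta>)" and ?w = "charfun \<zeta> ?g"
  \<comment> \<open>The dilation equations at \<zeta> and at 1 are subtracted. The two terms on the
    right are orthogonal, so the square norm of \<open>?d\<close> cancels and only terms with a
    factor |1 - \<zeta>| remain.\<close>
  have "S (\<zeta> *\<^sub>C state \<zeta> ?g - ?h) = V (?w - ?g) + ?d"
  proof -
    have "\<zeta> *\<^sub>C state \<zeta> ?g - ?h = (V ?g + \<zeta> *\<^sub>C state \<zeta> ?g) - (V ?g + ?h)" by simp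
    then have "S (\<zeta> *\<^sub>C state \<zeta> ?g - ?h) = S (V ?g + \<zeta> *\<^sub>C state \<zeta> ?g) - S (V ?g + ?h)"
      by (metis clinear_diff[OF linS])
    also have "\<dots> = (V ?w + state \<zeta> ?g) - (V ?g + ?h)"
      using unitary_state[OF \<zeta>, of ?g] y yd by metis
    finally show ?thesis by (simp add: clinear_diff[OF linV])
  qed
  moreover have "cinner (V (?w - ?g)) ?d = 0"
    using state_orth[OF \<zeta>, of ?g "?w - ?g"] rest_orth[of y "?w - ?g"]
    by (subst cinner_eq_zero_commute) (simp add: cinner_diff_left)
  ultimately have "(norm (\<zeta> *\<^sub>C state \<zeta> ?g - ?h))\<^sup>2 = (norm (?w - ?g))\<^sup>2 + (norm ?d)\<^sup>2"
    using pythagoras[of "V (?w - ?g)" ?d] by (metis norm_S norm_V)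
  moreover have "norm (\<zeta> *\<^sub>C state \<zeta> ?g - ?h) \<le> norm ?d + ?e * norm ?h"
  proof -
    have "\<zeta> *\<^sub>C state \<zeta> ?g - ?h = \<zeta> *\<^sub>C ?d - (1 - \<zeta>) *\<^sub>C ?h" by (simp add: scaleC_algebra)
    then have "norm (\<zeta> *\<^sub>C state \<zeta> ?g - ?h) \<le> cmod \<zeta> * norm ?d + ?e * norm ?h"
      using norm_triangle_ineq4[of "\<zeta> *\<^sub>C ?d" "(1 - \<zeta>) *\<^sub>C ?h"] by simp
    also have "cmod \<zeta> * norm ?d \<le> norm ?d" using \<zeta> by (intro mult_left_le_one_le) auto
    finally show ?thesis by simp
  qed
  then have "(norm (\<zeta> *\<^sub>C state \<zeta> ?g - ?h))\<^sup>2 \<le> (norm ?d + ?e * norm ?h)\<^sup>2"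
    by (rule power_mono) simp
  ultimately have "(norm (?w - ?g))\<^sup>2 \<le> 2 * norm ?d * (?e * norm ?h) + (?e * norm ?h)\<^sup>2"
    by (simp add: power2_sum)
  also have "\<dots> \<le> 2 * (C * norm ?h) * (?e * norm ?h) + (?e * norm ?h)\<^sup>2"
    using d by (intro add_right_mono mult_right_mono mult_left_mono) auto
  finally show "(norm (?w - ?g))\<^sup>2 \<le> ?e * (2 * C + ?e) * (norm ?h)\<^sup>2"
    by (simp add: power2_eq_square algebra_simps)
qed

end

section \<open>The self-adjoint extension of an admissible function\<close>

context closed_symmetric
begin

lemma schur_class_tendsto:
  assumes F: "F \<in> schur_class (half_plane z0) N N'" and z: "z \<in> half_plane z0" and \<psi>: "\<psi> \<in> N"
  shows "\<exists>L. ((\<lambda>\<mu>. inverse (\<mu> - z) *\<^sub>C (F \<mu> \<psi> - F z \<psi>)) \<longlongrightarrow> L) (at z)"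
proof -
  have bet: "contraction_between N N' (F \<mu>)" if "\<mu> \<in> half_plane z0" for \<mu>
    using F that by (simp add: schur_class_def)
  obtain L where L: "uniform_limit {\<psi> \<in> N. norm \<psi> \<le> 1}
      (\<lambda>\<mu> \<psi>. inverse (\<mu> - z) *\<^sub>C (F \<mu> \<psi> - F z \<psi>)) L (at z)"
    using F z by (auto simp: schur_class_def)
  have pos: "0 < norm \<psi> + 1" using norm_ge_zero[of \<psi>] by linarith
  \<comment> \<open>Scales \<psi> into the unit ball; the summand 1 covers \<psi> = 0.\<close>
  define c where "c = complex_of_real (norm \<psi> + 1)"
  have c: "c \<noteq> 0" "cmod c = norm \<psi> + 1"
    unfolding c_def norm_of_real of_real_eq_0_iff using pos by simp_all
  let ?\<psi> = "inverse c *\<^sub>C \<psi>"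
  have "?\<psi> \<in> {\<psi> \<in> N. norm \<psi> \<le> 1}"
    using csubspace_scaleC[OF csubspace_defect \<psi>] pos
    by (simp add: c(2) norm_inverse divide_le_eq flip: divide_inverse_commute)
  from tendsto_uniform_limitI[OF L this]
  have "((\<lambda>\<mu>. c *\<^sub>C inverse (\<mu> - z) *\<^sub>C (F \<mu> ?\<psi> - F z ?\<psi>)) \<longlongrightarrow> c *\<^sub>C L ?\<psi>) (at z)"
    by (intro tendsto_scaleC tendsto_const)
  moreover have "eventually (\<lambda>\<mu>. c *\<^sub>C inverse (\<mu> - z) *\<^sub>C (F \<mu> ?\<psi> - F z ?\<psi>)
      = inverse (\<mu> - z) *\<^sub>C (F \<mu> \<psi> - F z \<psi>)) (at z)"
  proof (rule eventually_mono[OF eventually_at_in_open'[OF open_half_plane z]])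
    fix \<mu> assume \<mu>: "\<mu> \<in> half_plane z0"
    have "F \<mu> ?\<psi> = inverse c *\<^sub>C F \<mu> \<psi>" "F z ?\<psi> = inverse c *\<^sub>C F z \<psi>"
      using bet[OF \<mu>] bet[OF z] \<psi> by (auto simp: contraction_between_def)
    then have "F \<mu> ?\<psi> - F z ?\<psi> = inverse c *\<^sub>C (F \<mu> \<psi> - F z \<psi>)" by (simp add: scaleC_diff_right)
    then show "c *\<^sub>C inverse (\<mu> - z) *\<^sub>C (F \<mu> ?\<psi> - F z ?\<psi>) = inverse (\<mu> - z) *\<^sub>C (F \<mu> \<psi> - F z \<psi>)"
      using c(1) by (metis scaleC_scaleC mult.left_commute mult.right_neutral right_inverse)
  qed
  ultimately show ?thesis by - (rule exI, rule Lim_transform_eventually)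
qed

lemma schur_function_cayley_extension:
  assumes F: "F \<in> schur_class (half_plane z0) N N'"
  shows "schur_function (\<lambda>\<zeta>. cayley_extension A z0 (F (disc_map_inv z0 \<zeta>)))"
proof
  fix \<zeta> :: complex assume \<zeta>: "cmod \<zeta> < 1"
  let ?m = "disc_map_inv z0"
  show "contraction (cayley_extension A z0 (F (?m \<zeta>)))"
    using F disc_map_inv_half_plane[OF z0 \<zeta>] by (intro contraction_cayley_extension) (simp add: schur_class_def)
  fix x
  obtain d where d: "(?m has_field_derivative d) (at \<zeta>)" using disc_map_inv_deriv[OF \<zeta>] by blast
  obtain L where L: "((\<lambda>\<mu>. inverse (\<mu> - ?m \<zeta>) *\<^sub>C (F \<mu> (x - P x) - F (?m \<zeta>) (x - P x))) \<longlongrightarrow> L) (at (?m \<zeta>))"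
    using schur_class_tendsto[OF F disc_map_inv_half_plane[OF z0 \<zeta>] P_defect] by blast
  have ev: "eventually (\<lambda>\<omega>. cmod \<omega> < 1) (at \<zeta>)"
    using eventually_at_in_open'[of "ball 0 1" \<zeta>] \<zeta> by simp
  \<comment> \<open>Injectivity keeps the inner variable off its limit, as composition with a
    punctured limit requires.\<close>
  have ne: "eventually (\<lambda>\<omega>. ?m \<omega> \<noteq> ?m \<zeta> \<and> \<omega> \<noteq> \<zeta>) (at \<zeta>)"
    using ev eventually_neq_at_within[of \<zeta> \<zeta> UNIV]
    by eventually_elim (use disc_map_inv_inj[OF z0 _ \<zeta>] in blast)
  have "filterlim ?m (at (?m \<zeta>)) (at \<zeta>)"
    unfolding filterlim_at using DERIV_isCont[OF d] ne by (auto simp: isCont_def elim: eventually_mono)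
  from filterlim_compose[OF L this]
  have "((\<lambda>\<omega>. ((?m \<omega> - ?m \<zeta>) / (\<omega> - \<zeta>)) *\<^sub>C inverse (?m \<omega> - ?m \<zeta>) *\<^sub>C (F (?m \<omega>) (x - P x) - F (?m \<zeta>) (x - P x)))
      \<longlongrightarrow> d *\<^sub>C L) (at \<zeta>)"
    using d unfolding has_field_derivative_iff by (intro tendsto_scaleC)
  moreover have "eventually (\<lambda>\<omega>. ((?m \<omega> - ?m \<zeta>) / (\<omega> - \<zeta>)) *\<^sub>C inverse (?m \<omega> - ?m \<zeta>) *\<^sub>C (F (?m \<omega>) (x - P x) - F (?m \<zeta>) (x - P x))
      = inverse (\<omega> - \<zeta>) *\<^sub>C (cayley_extension A z0 (F (?m \<omega>)) x - cayley_extension A z0 (F (?m \<zeta>)) x)) (at \<zeta>)"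
    using ne by eventually_elim (simp add: scaleC_scaleC cayley_extension_def field_simps)
  ultimately show "\<exists>L. ((\<lambda>\<omega>. inverse (\<omega> - \<zeta>) *\<^sub>C (cayley_extension A z0 (F (?m \<omega>)) x - cayley_extension A z0 (F (?m \<zeta>)) x)) \<longlongrightarrow> L) (at \<zeta>)"
    by - (rule exI, rule Lim_transform_eventually)
qed

theorem shtraus_generalized_resolvent:
  assumes adm: "F \<in> admissible_functions A z0"
  shows "generalized_resolvent TYPE(ell2) A (shtraus_resolvent A z0 F)"
proof -
  have F: "F \<in> schur_class (half_plane z0) N N'" using adm by (simp add: admissible_functions_def)
  have bet: "contraction_between N N' (F z)" if "z \<in> half_plane z0" for z
    using F that by (simp add: schur_class_def)
  obtain V :: "'h \<Rightarrow> ell2" and S :: "ell2 \<Rightarrow> ell2" where dil: "unitary_dilation V S"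
    and char: "\<And>\<zeta> x. cmod \<zeta> < 1 \<Longrightarrow>
      unitary_dilation.charfun V S \<zeta> x = cayley_extension A z0 (F (disc_map_inv z0 \<zeta>)) x"
    and minimal: "\<And>y. S y = y \<Longrightarrow> (\<And>g. cinner y (V g) = 0) \<Longrightarrow> y = 0"
    using schur_function.unitary_dilation_exists[OF schur_function_cayley_extension[OF F]] by metis
  interpret unitary_dilation V S by (rule dil)
  note linV = isometric_clinear[OF V] and linS = isometric_clinear[OF S]
  have charz: "charfun (disc_map z0 z) = cayley_extension A z0 (F z)" if "z \<in> half_plane z0" for z
    using char[OF norm_disc_map[OF that]] by (simp add: disc_map_inv_disc_map[OF that] fun_eq_iff)
  let ?k = "z0 - cnj z0"
  have k: "?k \<noteq> 0" by (rule not_Reals_diff_cnj[OF z0])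
  have SU: "S (V m) = V (U m)" if m: "m \<in> M" for m
  proof -
    have "charfun 0 m = U m"
      using char[of 0 m] cayley_extension_range[OF m bet[OF disc_map_inv_half_plane[OF z0, of 0]]] by simp
    \<comment> \<open>By the energy identity, a value of the same norm as the argument forces the
      state to vanish.\<close>
    moreover have "state 0 m = 0" using energy[of 0 m] calculation by (simp add: U_norm[OF m])
    ultimately show ?thesis using unitary_state[of 0 m] by simp
  qed
  \<comment> \<open>The H component of a fixed vector splits along \<open>M\<close> and
    \<open>N\<close> as m + \<psi>. In the sector F \<psi> tends to a forbidden value with finite
    lower limit, so admissibility gives \<psi> = 0. Then \<open>U\<close> fixes m, which forces m =
    0.\<close>
  have fixed: "y = 0" if y: "S y = y" for y
  proof -
    define g where "g = compr y"
    define h where "h = rest y"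
    \<comment> \<open>Any angle in the open interval would do: admissibility refers to some
      sector.\<close>
    define \<epsilon> where "\<epsilon> = pi / 4"
    have \<epsilon>: "0 < \<epsilon>" "\<epsilon> < pi / 2" by (simp_all add: \<epsilon>_def)
    let ?Fl = "inf at_infinity (principal (sector z0 \<epsilon>))"
    define C where "C = 2 / sin \<epsilon>"
    have C: "0 < C" unfolding C_def using \<epsilon> by (intro divide_pos_pos sin_gt_zero) auto
    have nontrivial: "?Fl \<noteq> bot" by (rule sector_filter_nontrivial[OF z0 \<epsilon>])
    have large: "eventually (\<lambda>z. z \<in> sector z0 \<epsilon> \<and> 2 * cmod z0 \<le> cmod z) ?Fl"
      unfolding eventually_inf_principal eventually_at_infinity by blast
    have bounds: "norm (state (disc_map z0 z) g - h) \<le> C * norm h"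
      "(norm (charfun (disc_map z0 z) g - g))\<^sup>2 \<le> cmod (1 - disc_map z0 z) * (2 * C + cmod (1 - disc_map z0 z)) * (norm h)\<^sup>2"
      if "z \<in> sector z0 \<epsilon>" "2 * cmod z0 \<le> cmod z" for z
    proof -
      have "cmod z0 \<le> cmod z" using that(2) norm_ge_zero[of z0] by linarith
      note b = fixed_vector_bounds[OF y norm_disc_map[OF sector_half_plane[OF that(1)]]
          sector_nontangential[OF that(1) \<epsilon> this, folded C_def]]
      show "norm (state (disc_map z0 z) g - h) \<le> C * norm h"
        "(norm (charfun (disc_map z0 z) g - g))\<^sup>2 \<le> cmod (1 - disc_map z0 z) * (2 * C + cmod (1 - disc_map z0 z)) * (norm h)\<^sup>2"
        unfolding g_def h_def by (rule b)+
    qed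
    have char_lim: "((\<lambda>z. charfun (disc_map z0 z) g) \<longlongrightarrow> g) ?Fl"
    proof -
      have dl: "(disc_map z0 \<longlongrightarrow> 1) ?Fl" by (rule tendsto_mono[OF inf_le1 disc_map_tendsto])
      let ?b = "\<lambda>z. sqrt (cmod (1 - disc_map z0 z) * (2 * C + cmod (1 - disc_map z0 z)) * (norm h)\<^sup>2)"
      have "(?b \<longlongrightarrow> sqrt (cmod (1 - 1) * (2 * C + cmod (1 - 1)) * (norm h)\<^sup>2)) ?Fl"
        by (intro tendsto_intros dl)
      then have "(?b \<longlongrightarrow> 0) ?Fl" by simp
      moreover have "eventually (\<lambda>z. norm (charfun (disc_map z0 z) g - g) \<le> ?b z) ?Fl"
        by (rule eventually_mono[OF large]) (use bounds(2) in \<open>auto intro!: real_le_rsqrt\<close>)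
      ultimately have "((\<lambda>z. charfun (disc_map z0 z) g - g) \<longlongrightarrow> 0) ?Fl"
        by (rule Lim_null_comparison[rotated])
      then show ?thesis by (simp add: Lim_null[of _ g])
    qed
    define m where "m = P g"
    define \<psi> where "\<psi> = g - P g"
    have m: "m \<in> M" and \<psi>: "\<psi> \<in> N" by (simp_all add: m_def \<psi>_def P_mem P_defect)
    have char_g: "charfun (disc_map z0 z) g = U m + F z \<psi>" if "z \<in> half_plane z0" for z
      unfolding charz[OF that] by (simp add: cayley_extension_def m_def \<psi>_def)
    define \<phi> where "\<phi> = g - U m"
    have hp: "eventually (\<lambda>z. z \<in> half_plane z0) ?Fl"
      by (rule eventually_mono[OF large]) (auto intro: sector_half_plane)
    have F_lim: "((\<lambda>z. F z \<psi>) \<longlongrightarrow> \<phi>) ?Fl"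
    proof -
      have "((\<lambda>z. charfun (disc_map z0 z) g - U m) \<longlongrightarrow> \<phi>) ?Fl"
        unfolding \<phi>_def by (intro tendsto_diff tendsto_const char_lim)
      then show ?thesis
        by (rule Lim_transform_eventually) (rule eventually_mono[OF hp], simp add: char_g)
    qed
    have FN': "F z \<psi> \<in> N'" "norm (F z \<psi>) \<le> norm \<psi>" if "z \<in> half_plane z0" for z
      using bet[OF that] \<psi> by (auto simp: contraction_between_def)
    have \<phi>: "\<phi> \<in> N'"
      using closed_orth[of M'] unfolding defect_space_orth[symmetric]
      by (rule Lim_in_closed_set[OF _ _ nontrivial F_lim]) (rule eventually_mono[OF hp FN'(1)])
    obtain f f' where f: "(f, f') \<in> A" "m = f' - z0 *\<^sub>C f" "U m = f' - cnj z0 *\<^sub>C f"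
      using cayley_map[OF m] unfolding cayley_iff by blast
    have Umm: "U m - m = ?k *\<^sub>C f" by (simp only: f(3)) (simp add: f(2) scaleC_algebra)
    have "\<psi> - \<phi> = U m - m" by (simp add: \<psi>_def \<phi>_def m_def)
    then have "\<psi> - \<phi> \<in> Domain A" unfolding Umm using A_scaleC[OF f(1), of ?k] by auto
    then have forb: "(\<psi>, \<phi>) \<in> forbidden_operator A z0" using \<psi> \<phi> by (simp add: forbidden_operator_def)
    have "\<psi> = 0"
    proof (rule ccontr)
      assume \<psi>0: "\<psi> \<noteq> 0"
      \<comment> \<open>The upper estimate of the defect times the squared bound
        \<open>(C + 1) * norm h\<close> of the state; dividing by \<open>norm \<psi>\<close> passes
        from the difference of squares to the difference of norms.\<close>
      define B where "B = 16 * \<bar>Im z0\<bar> * ((C + 1) * norm h)\<^sup>2 / norm \<psi>"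
      have "cmod z * (norm \<psi> - norm (F z \<psi>)) \<le> B" if z: "z \<in> sector z0 \<epsilon>" "2 * cmod z0 \<le> cmod z" for z
      proof -
        note hpz = sector_half_plane[OF z(1)]
        let ?s = "norm (state (disc_map z0 z) g)" and ?\<delta> = "1 - (cmod (disc_map z0 z))\<^sup>2"
        have \<delta>: "0 \<le> ?\<delta>" using norm_disc_map[OF hpz] by (simp add: abs_square_le_1)
        have "?s \<le> (C + 1) * norm h"
          using norm_triangle_sub[of "state (disc_map z0 z) g" h] bounds(1)[OF z] by (simp add: algebra_simps)
        then have s: "?s\<^sup>2 \<le> ((C + 1) * norm h)\<^sup>2" by (rule power_mono) simp
        have "(norm g)\<^sup>2 = (norm m)\<^sup>2 + (norm \<psi>)\<^sup>2"
          using pythagoras[of m \<psi>] \<psi> m by (auto simp: m_def \<psi>_def defect_space_orth intro: orth_cinner')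
        moreover have "(norm (charfun (disc_map z0 z) g))\<^sup>2 = (norm m)\<^sup>2 + (norm (F z \<psi>))\<^sup>2"
          unfolding char_g[OF hpz] U_norm[OF m, symmetric]
          using FN'(1)[OF hpz] cayley_map_mem[OF m]
          by (intro pythagoras) (auto simp: defect_space_orth intro: orth_cinner')
        ultimately have "(norm \<psi>)\<^sup>2 - (norm (F z \<psi>))\<^sup>2 = ?\<delta> * ?s\<^sup>2"
          using energy[OF norm_disc_map[OF hpz], of g] by simp
        moreover have "(norm \<psi> - norm (F z \<psi>)) * norm \<psi> \<le> (norm \<psi> - norm (F z \<psi>)) * (norm \<psi> + norm (F z \<psi>))"
          using FN'(2)[OF hpz] by (intro mult_left_mono) auto
        ultimately have "(norm \<psi> - norm (F z \<psi>)) * norm \<psi> \<le> ?\<delta> * ?s\<^sup>2"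
          by (simp add: power2_eq_square algebra_simps)
        then have "cmod z * ((norm \<psi> - norm (F z \<psi>)) * norm \<psi>) \<le> cmod z * (?\<delta> * ?s\<^sup>2)"
          by (rule mult_left_mono) simp
        also have "\<dots> = (cmod z * ?\<delta>) * ?s\<^sup>2" by (rule mult.assoc[symmetric])
        also have "\<dots> \<le> (16 * \<bar>Im z0\<bar>) * ((C + 1) * norm h)\<^sup>2"
          using s \<delta> by (intro mult_mono sector_defect_upper[OF hpz z(2)]) auto
        finally show ?thesis unfolding B_def using \<psi>0 by (simp add: field_simps)
      qed
      then have "eventually (\<lambda>z. ereal (cmod z * (norm \<psi> - norm (F z \<psi>))) \<le> ereal B) ?Fl"
        by (intro eventually_mono[OF large]) auto
      then have "Liminf ?Fl (\<lambda>z. ereal (cmod z * (norm \<psi> - norm (F z \<psi>)))) \<le> ereal B"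
        by (rule Liminf_le[OF nontrivial])
      then have "Liminf ?Fl (\<lambda>z. ereal (cmod z * (norm \<psi> - norm (F z \<psi>)))) < \<infinity>"
        by (rule le_less_trans) simp
      then have "\<psi> = 0" using adm forb F_lim \<epsilon> unfolding admissible_functions_def by blast
      then show False using \<psi>0 by blast
    qed
    have "F z 0 = 0" if "z \<in> half_plane z0" for z
      using FN'(2)[OF that] \<open>\<psi> = 0\<close> by simp
    then have "((\<lambda>z. F z \<psi>) \<longlongrightarrow> 0) ?Fl"
      unfolding \<open>\<psi> = 0\<close> by (intro tendsto_eventually eventually_mono[OF hp])
    then have "\<phi> = 0" using tendsto_unique[OF nontrivial F_lim] by blast
    then have "?k *\<^sub>C f = 0" using \<open>\<psi> - \<phi> = U m - m\<close> \<open>\<psi> = 0\<close> unfolding Umm by simp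
    then have "inverse ?k *\<^sub>C ?k *\<^sub>C f = 0" by simp
    then have "f = 0" using k by (simp add: scaleC_scaleC)
    then have "m = 0" using A_single[OF f(1)[unfolded \<open>f = 0\<close>] A_zero] f(2) by simp
    then have "compr y = 0" using \<open>\<psi> = 0\<close> by (simp add: \<psi>_def m_def g_def)
    \<comment> \<open>The fixed vector is now orthogonal to the range of \<open>V\<close>, the case
      that the construction of \<open>S\<close> excludes.\<close>
    then have "rest y = y" by (simp add: rest_def clinear_zero[OF linV])
    then have "cinner y (V x) = 0" for x using rest_orth[of y x] by simp
    then show "y = 0" by (rule minimal[OF y])
  qed
  let ?B = "cayley_inverse (graph_on UNIV S) z0"
  have "selfadjoint_operator ?B"
    by (rule unitary_selfadjoint[OF S surj fixed z0])
  moreover have "(V f, V f') \<in> ?B" if f: "(f, f') \<in> A" for f f'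
  proof -
    define m where "m = f' - z0 *\<^sub>C f"
    have "(m, f' - cnj z0 *\<^sub>C f) \<in> cayley A z0" unfolding cayley_iff m_def using f by blast
    then have m: "m \<in> M" "U m = f' - cnj z0 *\<^sub>C f" by (auto simp: range_at_iff cayley_map_eq)
    define u where "u = inverse ?k *\<^sub>C V m"
    have Su: "S u = inverse ?k *\<^sub>C V (f' - cnj z0 *\<^sub>C f)"
      by (simp add: u_def clinear_scaleC[OF linS] SU[OF m(1)] m(2))
    have "S u - u = inverse ?k *\<^sub>C ?k *\<^sub>C V f" "z0 *\<^sub>C S u - cnj z0 *\<^sub>C u = inverse ?k *\<^sub>C ?k *\<^sub>C V f'"
      unfolding Su unfolding u_def m_def
      by (simp_all add: clinear_diff[OF linV] clinear_scaleC[OF linV] scaleC_algebra algebra_simps)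
    then have "V f = S u - u" "V f' = z0 *\<^sub>C S u - cnj z0 *\<^sub>C u" using k by (simp_all add: scaleC_scaleC)
    then show ?thesis unfolding cayley_inverse_def by auto
  qed
  moreover have "shtraus_resolvent A z0 F z = compression V (resolvent ?B z)" if z: "z \<notin> \<real>" for z
  proof (cases "z \<in> half_plane z0")
    case True
    then show ?thesis
      by (simp add: shtraus_resolvent_upper resolvent_charfun charz)
  next
    case False
    then have lower: "z \<in> half_plane (cnj z0)" using half_plane_cases[OF z0 z] by blast
    then have up: "cnj z \<in> half_plane z0" by simp
    obtain g where g: "contraction g" "\<And>x y. cinner (cayley_extension A z0 (F (cnj z)) x) y = cinner x (g y)"
      using contraction_adjoint[OF contraction_cayley_extension[OF bet[OF up]]] by blast
    show ?thesis
      unfolding shtraus_resolvent_lower[where F = F, OF lower bet[OF up] g(2)]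
      by (rule resolvent_charfun_adjoint[symmetric, OF lower g(1)]) (simp add: charz[OF up] g(2))
  qed
  ultimately show ?thesis
    unfolding generalized_resolvent_def using V by blast
qed

end

theorem theorem3p14:
  fixes A :: "('h::complex_hilbert, 'h) op_graph" and z0 :: complex
  assumes "symmetric_operator A" and "closed A" and "z0 \<notin> \<real>"
  shows "(\<forall>R. generalized_resolvent TYPE('k::complex_hilbert) A R \<longrightarrow>
            (\<exists>F \<in> admissible_functions A z0.
               \<forall>z. z \<notin> \<real> \<longrightarrow> R z = shtraus_resolvent A z0 F z)) \<and>
         (\<forall>F \<in> admissible_functions A z0.
            generalized_resolvent TYPE(ell2) A (shtraus_resolvent A z0 F)) \<and>
         (\<forall>F \<in> admissible_functions A z0. \<forall>G \<in> admissible_functions A z0.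
            (\<exists>z \<in> half_plane z0. \<exists>\<psi> \<in> defect_space A z0. F z \<psi> \<noteq> G z \<psi>) \<longrightarrow>
            (\<exists>z. z \<notin> \<real> \<and> shtraus_resolvent A z0 F z \<noteq> shtraus_resolvent A z0 G z))"
proof -
  interpret closed_symmetric A z0 by standard (rule assms)+
  show ?thesis
  proof (intro conjI allI ballI impI)
    fix R assume "generalized_resolvent TYPE('k) A R"
    then show "\<exists>F\<in>admissible_functions A z0. \<forall>z. z \<notin> \<real> \<longrightarrow> R z = shtraus_resolvent A z0 F z"
      by (rule generalized_resolvent_shtraus)
  next
    fix F assume "F \<in> admissible_functions A z0"
    then show "generalized_resolvent TYPE(ell2) A (shtraus_resolvent A z0 F)"
      by (rule shtraus_generalized_resolvent)
  next
    fix F G :: "complex \<Rightarrow> 'h \<Rightarrow> 'h"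
    assume "\<exists>z\<in>half_plane z0. \<exists>\<psi>\<in>defect_space A z0. F z \<psi> \<noteq> G z \<psi>"
    then obtain z \<psi> where "z \<in> half_plane z0" "\<psi> \<in> defect_space A z0" "F z \<psi> \<noteq> G z \<psi>" by blast
    then show "\<exists>z. z \<notin> \<real> \<and> shtraus_resolvent A z0 F z \<noteq> shtraus_resolvent A z0 G z"
      using shtraus_resolvent_inj half_plane_not_Reals(1) by meson
  qed
qed

end
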